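(* Assume $\lambda_0\ge0$. Let $x\in E$. Then: (i) For $h>0$, $\mathrm P_x^{(h)}$ is the law of a continuous-time inhomogeneous Markov chain on $[0,h)$ issued from $x$ with transition rate from $i$ to $j$, $i\ne j$, equal to $\dfrac{\partial_hv_{h-t}(j)}{\partial_hv_{h-t}(i)}\,q_{ij}$ at time $t$, $0\le t<h$. (ii) $\mathrm P_x^{(\infty)}$ is the law of a continuous-time homogeneous Markov chain on $[0,\infty)$ issued from $x$ with transition rate from $i$ to $j$, $i\ne j$, equal to $\dfrac{\phi_0(j)}{\phi_0(i)}\,q_{ij}$.
   Context: $E=\{1,\dots,K\}$ is finite; $Y$, under $(\mathrm P_x)_{x\in E}$ (expectation $\mathrm E_x$, natural right-continuous filtration $\mathcal D_t$), is an irreducible continuous-time pure jump Markov process on $E$ with generator matrix $\mathcal L=(q_{ij})_{1\le i,j\le K}$ (rows summing to $0$, $q_{ij}$ the rate from $i$ to $j$ for $i\ne j$). $\alpha,\beta:E\to\mathbb R$ with $\alpha>0$, $\psi(x,\lambda)=\beta(x)\lambda+\alpha(x)\lambda^2$. $\mathcal M_f(E)$ is the set of finite measures on $E$, $\nu(f)=\int f\,d\nu$. The $(\mathcal L,\beta,\alpha)$-superprocess (multitype Feller diffusion) is the Markov process $X$ on $\Omega=C(\mathbb R_+,\mathcal M_f(E))$ with laws $\mathbb P_\nu$, $\nu\in\mathcal M_f(E)$, such that for nonnegative $f,\phi$: $\mathbb E_\nu[e^{-X_t(f)-\int_0^tX_s(\phi)ds}]=e^{-\nu(u_t)}$, where $u\ge0$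 is the unique solution, bounded on $[0,T]\times E$ for all $T$, of $u_t(x)+\mathrm E_x[\int_0^t\psi(Y_s,u_{t-s}(Y_s))ds]=\mathrm E_x[f(Y_t)+\int_0^t\phi(Y_s)ds]$. Its canonical measures $\mathbb N_x$ are the $\sigma$-finite measures on $\Omega$ such that if $\sum_j\delta_{(x^j,X^j)}$ is Poisson with intensity $\nu(dx)\mathbb N_x[dX]$ then $\sum_jX^j$ has law $\mathbb P_\nu$. $H_{\max}=\inf\{t>0:X_t=0\}$, $v_t(x)=\mathbb N_x[H_{\max}>t]$; $\partial_hv_{h-t}(y)$ is the time derivative of $r\mapsto v_r(y)$ at $r=h-t$. $\lambda_0=\sup\{\ell\in\mathbb R:\exists u>0,\ (\mathrm{Diag}(\beta)-\mathcal L)u=\ell u\}$, and $\phi_0$ is a positive vector with $(\mathrm{Diag}(\beta)-\mathcal L)\phi_0=\lambda_0\phi_0$ (unique up to a multiplicative constant). When $\lambda_0\ge0$, the superprocess becomes extinct a.s., $v$ is differentiable in time with nonzero derivative, and the following are well defined. $\mathrm P_x^{(h)}$ is given by $\frac{d\mathrm P_x^{(h)}}{d\mathrm P_x}\big|_{\mathcal D_t}=M^{(h)}_t:=\frac{\partial_hv_{h-t}(Y_t)}{\partial_hv_h(x)}e^{-\int_0^t\partial_\lambda\psi(Y_s,v_{h-s}(Y_s))ds}$, $0\le t<h$. $\mathrm P_x^{(\infty)}$ is given by $\frac{d\mathrm P_x^{(\infty)}}{d\mathrm P_x}\big|_{\mathcal D_t}=M^{(\infty)}_t:=\lim_{h\to\infty}M^{(h)}_t$,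 $t\ge0$. *)

theory Defs
  imports "HOL-Probability.Probability"
begin

text \<open>The finite state space \<open>E = {1, ..., K}\<close> is a type \<open>'k\<close> of class \<open>finite\<close>, with
  \<open>K = CARD('k)\<close>. Processes are indexed by \<open>real\<close>; only their values at times \<open>t \<ge> 0\<close> matter.\<close>

section \<open>Continuous-time Markov chains\<close>

definition natural_filt ::
  "'a set \<Rightarrow> (real \<Rightarrow> 'a \<Rightarrow> 's) \<Rightarrow> 's measure \<Rightarrow> real \<Rightarrow> 'a measure" where
  "natural_filt Om Y S t = sigma Om {Y u -` A \<inter> Om | u A. 0 \<le> u \<and> u \<le> t \<and> A \<in> sets S}"

text \<open>The natural right-continuous filtration of a process in a discrete space.\<close>

definition natural_rc_filt :: "'a set \<Rightarrow> (real \<Rightarrow> 'a \<Rightarrow> 'k) \<Rightarrow> real \<Rightarrow> 'a measure" where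
  "natural_rc_filt Om Y t =
     sigma Om (\<Inter>s\<in>{t<..}. sets (natural_filt Om Y (count_space UNIV) s))"

definition transition_function ::
  "real set \<Rightarrow> (real \<Rightarrow> real \<Rightarrow> 'k::finite \<Rightarrow> 'k \<Rightarrow> real) \<Rightarrow> bool" where
  "transition_function I p \<longleftrightarrow>
     (\<forall>s\<in>I. \<forall>t\<in>I. s \<le> t \<longrightarrow>
        (\<forall>i j. 0 \<le> p s t i j) \<and> (\<forall>i. (\<Sum>j\<in>UNIV. p s t i j) = 1)) \<and>
     (\<forall>s\<in>I. \<forall>i j. p s s i j = (if i = j then 1 else 0)) \<and>
     (\<forall>s\<in>I. \<forall>t\<in>I. \<forall>u\<in>I. s \<le> t \<and> t \<le> u \<longrightarrow>
        (\<forall>i j. p s u i j = (\<Sum>k\<in>UNIV. p s t i k * p t u k j)))"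

text \<open>\<open>r t i j\<close> is the rate from \<open>i\<close> to \<open>j\<close> at time \<open>t\<close>; diagonal entries of \<open>r t\<close> play no role.
  The rate is required both as a limit over \<open>[t, t + e]\<close> and over \<open>[t - e, t]\<close>: the first limit
  alone would not exclude jumps at deterministic times.\<close>

definition has_transition_rates ::
  "real set \<Rightarrow> (real \<Rightarrow> real \<Rightarrow> 'k::finite \<Rightarrow> 'k \<Rightarrow> real) \<Rightarrow>
   (real \<Rightarrow> 'k \<Rightarrow> 'k \<Rightarrow> real) \<Rightarrow> bool" where
  "has_transition_rates I p r \<longleftrightarrow>
     (\<forall>t\<in>I. \<forall>i j. i \<noteq> j \<longrightarrow>
        ((\<lambda>e. p t (t + e) i j / e) \<longlongrightarrow> r t i j) (at_right 0) \<and>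
        (0 < t \<longrightarrow> ((\<lambda>e. p (t - e) t i j / e) \<longlongrightarrow> r t i j) (at_right 0)))"

text \<open>In a finite discrete space, being right-continuous with left limits amounts to being a
  pure jump path, with finitely many jumps on each compact subinterval of \<open>I\<close>.\<close>

definition jump_path_on :: "real set \<Rightarrow> (real \<Rightarrow> 'k) \<Rightarrow> bool" where
  "jump_path_on I y \<longleftrightarrow>
     (\<forall>t\<in>I. (\<forall>\<^sub>F s in at_right t. y s = y t) \<and>
        (0 < t \<longrightarrow> (\<exists>k. \<forall>\<^sub>F s in at_left t. y s = k)))"

text \<open>The time interval \<open>I\<close> is meant to be \<open>[0, h)\<close> or \<open>[0, \<infinity>)\<close>. The probability measure \<open>M\<close> may
  live on a \<open>\<sigma>\<close>-algebra for which only the \<open>Y t\<close> with \<open>t \<in> I\<close> are measurable.\<close>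

definition markov_chain_with ::
  "real set \<Rightarrow> 'a measure \<Rightarrow> (real \<Rightarrow> 'a \<Rightarrow> 'k::finite) \<Rightarrow> 'k \<Rightarrow>
   (real \<Rightarrow> real \<Rightarrow> 'k \<Rightarrow> 'k \<Rightarrow> real) \<Rightarrow> bool" where
  "markov_chain_with I M Y x p \<longleftrightarrow>
     prob_space M \<and>
     (\<forall>t\<in>I. Y t \<in> measurable M (count_space UNIV)) \<and>
     (\<forall>\<omega>\<in>space M. jump_path_on I (\<lambda>t. Y t \<omega>)) \<and>
     (AE \<omega> in M. Y 0 \<omega> = x) \<and>
     transition_function I p \<and>
     (\<forall>s\<in>I. \<forall>t\<in>I. \<forall>j. s \<le> t \<longrightarrow>
        (AE \<omega> in M. real_cond_exp M (natural_filt (space M) Y (count_space UNIV) s)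
            (indicator {\<omega>'\<in>space M. Y t \<omega>' = j}) \<omega> = p s t (Y s \<omega>) j))"

definition inhomogeneous_markov_chain ::
  "real set \<Rightarrow> 'a measure \<Rightarrow> (real \<Rightarrow> 'a \<Rightarrow> 'k::finite) \<Rightarrow> 'k \<Rightarrow>
   (real \<Rightarrow> 'k \<Rightarrow> 'k \<Rightarrow> real) \<Rightarrow> bool" where
  "inhomogeneous_markov_chain I M Y x r \<longleftrightarrow>
     (\<exists>p. markov_chain_with I M Y x p \<and> has_transition_rates I p r)"

definition homogeneous_markov_chain ::
  "'a measure \<Rightarrow> (real \<Rightarrow> 'a \<Rightarrow> 'k::finite) \<Rightarrow> 'k \<Rightarrow> ('k \<Rightarrow> 'k \<Rightarrow> real) \<Rightarrow> bool" where
  "homogeneous_markov_chain M Y x q \<longleftrightarrow>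
     (\<exists>p. markov_chain_with {0..} M Y x (\<lambda>s t. p (t - s)) \<and>
          has_transition_rates {0..} (\<lambda>s t. p (t - s)) (\<lambda>_. q))"

definition generator_matrix :: "real^'k^'k \<Rightarrow> bool" where
  "generator_matrix L \<longleftrightarrow>
     (\<forall>i j. i \<noteq> j \<longrightarrow> 0 \<le> L $ i $ j) \<and> (\<forall>i. (\<Sum>j\<in>UNIV. L $ i $ j) = 0)"

definition irreducible_generator :: "real^'k^'k \<Rightarrow> bool" where
  "irreducible_generator L \<longleftrightarrow> (\<forall>i j. (i, j) \<in> {(i, j). i \<noteq> j \<and> 0 < L $ i $ j}\<^sup>*)"

definition markov_jump_process ::
  "real^'k^'k \<Rightarrow> ('k::finite \<Rightarrow> 'a measure) \<Rightarrow> (real \<Rightarrow> 'a \<Rightarrow> 'k) \<Rightarrow> bool" where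
  "markov_jump_process L P Y \<longleftrightarrow>
     (\<forall>x y. sets (P x) = sets (P y)) \<and>
     (\<forall>x. homogeneous_markov_chain (P x) Y x (\<lambda>i j. L $ i $ j))"

section \<open>Superprocesses and their canonical measures\<close>

text \<open>A finite measure on \<open>E\<close> is identified with the nonnegative vector of its masses; the topology
  of weak convergence is then the Euclidean one.\<close>

definition fin_meas :: "(real^'k) set" where
  "fin_meas = {\<nu>. \<forall>i. 0 \<le> \<nu> $ i}"

definition pairing :: "real^'k \<Rightarrow> ('k::finite \<Rightarrow> real) \<Rightarrow> real" where
  "pairing \<nu> f = (\<Sum>i\<in>UNIV. \<nu> $ i * f i)"

text \<open>The space of continuous paths \<open>[0, \<infinity>) \<rightarrow> fin_meas\<close>. The trace of the product
  \<open>\<sigma>\<close>-algebra is the Borel \<open>\<sigma>\<close>-algebra of locally uniform convergence.\<close>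

definition path_space :: "(real \<Rightarrow> real^'k::finite) measure" where
  "path_space = restrict_space (PiM {0..} (\<lambda>_. borel))
     {\<omega>. continuous_on {0..} \<omega> \<and> (\<forall>t\<ge>0. \<omega> t \<in> fin_meas)}"

definition psi :: "('k \<Rightarrow> real) \<Rightarrow> ('k \<Rightarrow> real) \<Rightarrow> 'k \<Rightarrow> real \<Rightarrow> real" where
  "psi \<beta> \<alpha> x l = \<beta> x * l + \<alpha> x * l\<^sup>2"

definition mild_solution ::
  "('k::finite \<Rightarrow> 'a measure) \<Rightarrow> (real \<Rightarrow> 'a \<Rightarrow> 'k) \<Rightarrow> ('k \<Rightarrow> real) \<Rightarrow> ('k \<Rightarrow> real) \<Rightarrow>
   ('k \<Rightarrow> real) \<Rightarrow> ('k \<Rightarrow> real) \<Rightarrow> (real \<Rightarrow> 'k \<Rightarrow> real) \<Rightarrow> bool" where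
  "mild_solution P Y \<beta> \<alpha> f \<phi> u \<longleftrightarrow>
     (\<forall>x. set_borel_measurable borel {0..} (\<lambda>t. u t x)) \<and>
     (\<forall>t\<ge>0. \<forall>x. 0 \<le> u t x) \<and>
     (\<forall>T. \<exists>B. \<forall>t\<in>{0..T}. \<forall>x. u t x \<le> B) \<and>
     (\<forall>t\<ge>0. \<forall>x.
        u t x + (LINT \<omega>|P x. (LINT s:{0..t}|lborel. psi \<beta> \<alpha> (Y s \<omega>) (u (t - s) (Y s \<omega>)))) =
        (LINT \<omega>|P x. f (Y t \<omega>) + (LINT s:{0..t}|lborel. \<phi> (Y s \<omega>))))"

text \<open>The solution \<open>u\<close> of the mild equation is unique on \<open>[0, \<infinity>)\<close>, so that no choice is hidden in
  the existential quantifier of the second clause. The last clause is the Markov property.\<close>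

definition superprocess ::
  "('k::finite \<Rightarrow> 'a measure) \<Rightarrow> (real \<Rightarrow> 'a \<Rightarrow> 'k) \<Rightarrow> ('k \<Rightarrow> real) \<Rightarrow> ('k \<Rightarrow> real) \<Rightarrow>
   (real^'k \<Rightarrow> (real \<Rightarrow> real^'k) measure) \<Rightarrow> bool" where
  "superprocess P Y \<beta> \<alpha> PX \<longleftrightarrow>
     (\<forall>\<nu>\<in>fin_meas. prob_space (PX \<nu>) \<and> sets (PX \<nu>) = sets path_space) \<and>
     (\<forall>f \<phi>. (\<forall>x. 0 \<le> f x \<and> 0 \<le> \<phi> x) \<longrightarrow>
        (\<exists>u. mild_solution P Y \<beta> \<alpha> f \<phi> u \<and>
           (\<forall>\<nu>\<in>fin_meas. \<forall>t\<ge>0.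
              (LINT X|PX \<nu>. exp (- pairing (X t) f - (LINT s:{0..t}|lborel. pairing (X s) \<phi>))) =
              exp (- pairing \<nu> (u t))))) \<and>
     (\<forall>\<nu>\<in>fin_meas. \<forall>s\<ge>0. \<forall>t\<ge>0. \<forall>B\<in>sets borel.
        AE X in PX \<nu>.
          real_cond_exp (PX \<nu>) (natural_filt (space path_space) (\<lambda>u X. X u) borel s)
            (indicator {X'\<in>space path_space. X' (s + t) \<in> B}) X =
          measure (PX (X s)) {X'\<in>space path_space. X' t \<in> B})"

definition point_count :: "(nat \<Rightarrow> 'w \<Rightarrow> 'b option) \<Rightarrow> 'b set \<Rightarrow> 'w \<Rightarrow> ennreal" where
  "point_count Z A w = (\<Sum>n. indicator (Some ` A) (Z n w))"

text \<open>The points of the random measure are enumerated (with multiplicity) by \<open>Z\<close>, the value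
  \<open>None\<close> meaning that an index is not used.\<close>

definition poisson_point_measure ::
  "'w measure \<Rightarrow> 'b measure \<Rightarrow> (nat \<Rightarrow> 'w \<Rightarrow> 'b option) \<Rightarrow> bool" where
  "poisson_point_measure W \<mu> Z \<longleftrightarrow>
     prob_space W \<and>
     (\<forall>n. \<forall>w\<in>space W. Z n w \<in> insert None (Some ` space \<mu>)) \<and>
     (\<forall>n. \<forall>A\<in>sets \<mu>. {w\<in>space W. Z n w \<in> Some ` A} \<in> sets W) \<and>
     (\<forall>A\<in>sets \<mu>. emeasure \<mu> A < \<infinity> \<longrightarrow>
        (\<forall>n::nat. measure W {w\<in>space W. point_count Z A w = of_nat n} =
           exp (- measure \<mu> A) * measure \<mu> A ^ n / fact n)) \<and>
     (\<forall>A::nat \<Rightarrow> 'b set. range A \<subseteq> sets \<mu> \<and> disjoint_family A \<longrightarrow>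
        prob_space.indep_vars W (\<lambda>_. borel) (\<lambda>i. point_count Z (A i)) UNIV)"

text \<open>The measure \<open>\<nu>(dx) N\<^sub>x[dX]\<close>.\<close>

definition cluster_intensity ::
  "real^'k \<Rightarrow> ('k::finite \<Rightarrow> (real \<Rightarrow> real^'k) measure) \<Rightarrow> ('k \<times> (real \<Rightarrow> real^'k)) measure" where
  "cluster_intensity \<nu> N =
     measure_of (space (count_space UNIV \<Otimes>\<^sub>M path_space)) (sets (count_space UNIV \<Otimes>\<^sub>M path_space))
       (\<lambda>A. \<Sum>x\<in>UNIV. ennreal (\<nu> $ x) * emeasure (N x) (Pair x -` A))"

text \<open>The random path \<open>S\<close> is the sum of the paths \<open>X\<^sup>j\<close>. The identity is required on \<open>(0, \<infinity>)\<close> only,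
  the value of \<open>S\<close> at \<open>0\<close> being given by continuity: canonical measures are carried by paths
  issued from \<open>0\<close>, whereas the sum is issued from \<open>\<nu>\<close>.\<close>

definition sum_of_clusters ::
  "'w measure \<Rightarrow> (nat \<Rightarrow> 'w \<Rightarrow> ('k::finite \<times> (real \<Rightarrow> real^'k)) option) \<Rightarrow>
   ('w \<Rightarrow> real \<Rightarrow> real^'k) \<Rightarrow> bool" where
  "sum_of_clusters W Z S \<longleftrightarrow>
     S \<in> measurable W path_space \<and>
     (AE w in W. \<forall>t>0. \<forall>i. ennreal (S w t $ i) =
        (\<Sum>n. case Z n w of None \<Rightarrow> 0 | Some (x, X) \<Rightarrow> ennreal (X t $ i)))"

text \<open>The distribution of a Poisson point measure is determined by its intensity, so it does not
  matter which realisation is summed. The sample space consists of sequences of optional points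
  because every realisation can be transported there.\<close>

definition canonical_measures ::
  "(real^'k \<Rightarrow> (real \<Rightarrow> real^'k) measure) \<Rightarrow>
   ('k::finite \<Rightarrow> (real \<Rightarrow> real^'k) measure) \<Rightarrow> bool" where
  "canonical_measures PX N \<longleftrightarrow>
     (\<forall>x. sets (N x) = sets path_space \<and> sigma_finite_measure (N x)) \<and>
     (\<forall>\<nu>\<in>fin_meas. \<exists>(W :: (nat \<Rightarrow> ('k \<times> (real \<Rightarrow> real^'k)) option) measure) Z S.
        poisson_point_measure W (cluster_intensity \<nu> N) Z \<and>
        sum_of_clusters W Z S \<and>
        distr W path_space S = PX \<nu>)"

definition H_max :: "(real \<Rightarrow> real^'k) \<Rightarrow> ereal" where
  "H_max X = Inf {ereal t | t. 0 < t \<and> X t = 0}"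

definition v_ext :: "('k::finite \<Rightarrow> (real \<Rightarrow> real^'k) measure) \<Rightarrow> real \<Rightarrow> 'k \<Rightarrow> real" where
  "v_ext N t x = measure (N x) {X\<in>space (N x). ereal t < H_max X}"

text \<open>Value at \<open>r\<close> of the time derivative of \<open>r \<mapsto> v\<^sub>r(y)\<close>.\<close>

definition dv_ext :: "('k::finite \<Rightarrow> (real \<Rightarrow> real^'k) measure) \<Rightarrow> real \<Rightarrow> 'k \<Rightarrow> real" where
  "dv_ext N r y = deriv (\<lambda>r. v_ext N r y) r"

section \<open>Generalized eigenvalue and the changes of measure\<close>

definition diag_minus :: "('k::finite \<Rightarrow> real) \<Rightarrow> real^'k^'k \<Rightarrow> real^'k^'k" where
  "diag_minus \<beta> L = (\<chi> i j. if i = j then \<beta> i else 0) - L"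

definition lambda0 :: "('k::finite \<Rightarrow> real) \<Rightarrow> real^'k^'k \<Rightarrow> real" where
  "lambda0 \<beta> L = Sup {l. \<exists>u. (\<forall>i. 0 < u $ i) \<and> diag_minus \<beta> L *v u = l *\<^sub>R u}"

definition M_h ::
  "(real \<Rightarrow> 'a \<Rightarrow> 'k::finite) \<Rightarrow> ('k \<Rightarrow> real) \<Rightarrow> ('k \<Rightarrow> real) \<Rightarrow>
   ('k \<Rightarrow> (real \<Rightarrow> real^'k) measure) \<Rightarrow> 'k \<Rightarrow> real \<Rightarrow> real \<Rightarrow> 'a \<Rightarrow> real" where
  "M_h Y \<beta> \<alpha> N x h t \<omega> =
     dv_ext N (h - t) (Y t \<omega>) / dv_ext N h x *
     exp (- (LINT s:{0..t}|lborel. deriv (psi \<beta> \<alpha> (Y s \<omega>)) (v_ext N (h - s) (Y s \<omega>))))"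

definition M_inf ::
  "(real \<Rightarrow> 'a \<Rightarrow> 'k::finite) \<Rightarrow> ('k \<Rightarrow> real) \<Rightarrow> ('k \<Rightarrow> real) \<Rightarrow>
   ('k \<Rightarrow> (real \<Rightarrow> real^'k) measure) \<Rightarrow> 'k \<Rightarrow> real \<Rightarrow> 'a \<Rightarrow> real" where
  "M_inf Y \<beta> \<alpha> N x t \<omega> = Lim at_top (\<lambda>h. M_h Y \<beta> \<alpha> N x h t \<omega>)"

text \<open>\<open>Q\<close> has Radon-Nikodym derivative \<open>M t\<close> with respect to \<open>P\<close> on the natural right-continuous
  filtration of \<open>Y\<close> at each time \<open>t \<in> I\<close>. Nothing is required of \<open>Q\<close> beyond these times.\<close>

definition has_density_process ::
  "real set \<Rightarrow> 'a measure \<Rightarrow> (real \<Rightarrow> 'a \<Rightarrow> 'k) \<Rightarrow> (real \<Rightarrow> 'a \<Rightarrow> real) \<Rightarrow> 'a measure \<Rightarrow> bool" where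
  "has_density_process I P Y M Q \<longleftrightarrow>
     prob_space Q \<and>
     (\<forall>t\<in>I. let D = natural_rc_filt (space P) Y t in
        subalgebra Q D \<and> M t \<in> borel_measurable D \<and>
        restr_to_subalg Q D = density (restr_to_subalg P D) (\<lambda>\<omega>. ennreal (M t \<omega>)))"

end

theory Submission
  imports Defs
begin

text \<open>Both laws are Doob transforms of Feynman-Kac kernels. For a potential \<open>c\<close>, the matrices
  \<open>U s t i j = E\<^sub>i[exp (- \<integral>\<^sub>s\<^sup>t c r (Y (r - s)) dr); Y (t - s) = j]\<close> solve a linear differential equation in
  \<open>t\<close>; uniqueness for this equation yields the Markov property of the weighted chain. If
  \<open>\<theta>\<close> is space-time harmonic for \<open>U\<close>, the density
  \<open>\<theta> t (Y t) / \<theta> 0 x * exp (- \<integral>\<^sub>0\<^sup>t c r (Y r) dr)\<close> therefore produces a chain with rates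
  \<open>\<theta> t j / \<theta> t i * L $ i $ j\<close>.

  The extinction rates \<open>v\<close> are the increasing limits of the solutions of \<open>u' = L u - \<psi>(u)\<close> started
  from constants \<open>n\<close>: void probabilities of the Poisson clusters give \<open>v\<close> as the canonical mass of
  \<open>{X\<^sub>t \<noteq> 0}\<close>, and paths do not leave \<open>0\<close>. Passing to the limit, \<open>v\<close> solves the same equation on
  \<open>(0, \<infinity>)\<close>, and its derivative is negative
  by irreducibility. Differentiating the equation, \<open>\<partial>v\<close> is harmonic for the potential
  \<open>\<beta> + 2 \<alpha> v\<close>, which is the finite horizon case. When \<open>\<lambda>\<^sub>0 \<ge> 0\<close>, \<open>v\<close> tends to \<open>0\<close>; relative to
  \<open>\<phi>\<^sub>0\<close>, the vector \<open>\<partial>v\<close> is transported by nearly stochastic matrices with entries bounded below, so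
  its oscillation vanishes and \<open>\<partial>v (h - t) y / \<partial>v h x\<close> converges to
  \<open>exp (\<lambda>\<^sub>0 t) * \<phi>\<^sub>0 y / \<phi>\<^sub>0 x\<close>, which gives the infinite horizon case.\<close>

text \<open>The hypotheses on the processes are statements about fixed times: the Markov properties
  of \<open>Y\<close> and \<open>X\<close> concern a single later time, and a transition function is
  known through Chapman-Kolmogorov and its rates at 0. Hence the recourse to differential equations:
  an increment over \<open>[t, t + h]\<close> is estimated uniformly in \<open>t\<close> from the
  semigroup near 0, and path functionals enter through linear equations with unique solutions rather
  than through conditional expectations.

  The main obstacle is the extinction time. \<open>H_max\<close> depends on the whole path, whereas
  void probabilities only see \<open>X t \<noteq> 0\<close>; a path might touch 0 at an irrational
  time and come back. In place of a strong Markov property, closeness to 0 at one of countably many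
  times is shown to make later survival unlikely, uniformly in these times, which excludes returns
  under \<open>PX\<close>. The canonical measure is accessible only through a superposition of
  clusters; a return of one cluster is excluded on the event that no other cluster is alive.\<close>

section \<open>Continuity and derivatives from forward increments\<close>

text \<open>Semigroup identities control only increments from \<open>t\<close> to
  \<open>t + h\<close> with \<open>h > 0\<close>. Since \<open>d\<close> does not depend on
  \<open>t\<close>, the estimate can be anchored at whichever of two nearby points lies to the
  left.\<close>

lemma continuous_on_forwardI:
  fixes f :: "real \<Rightarrow> real"
  assumes "\<And>e. 0 < e \<Longrightarrow> \<exists>d>0. \<forall>t h. a \<le> t \<longrightarrow> 0 < h \<longrightarrow> h < d \<longrightarrow> t + h \<le> b \<longrightarrow>
    \<bar>f (t + h) - f t\<bar> \<le> e"
  shows "continuous_on {a..b} f"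
  unfolding continuous_on_iff
proof (intro ballI allI impI)
  fix x e :: real assume x: "x \<in> {a..b}" and e: "0 < e"
  obtain d where d: "d > 0" and *: "\<And>t h. a \<le> t \<Longrightarrow> 0 < h \<Longrightarrow> h < d \<Longrightarrow> t + h \<le> b \<Longrightarrow>
    \<bar>f (t + h) - f t\<bar> \<le> e / 2"
    using assms[of "e / 2"] e by auto
  have "dist (f y) (f x) < e" if y: "y \<in> {a..b}" "dist y x < d" for y
  proof (cases x y rule: linorder_cases)
    case less
    then show ?thesis using *[of x "y - x"] x y e by (auto simp: dist_real_def)
  next
    case greater
    then show ?thesis using *[of y "x - y"] x y e by (auto simp: dist_real_def abs_minus_commute)
  qed (use e in auto)
  with d show "\<exists>d>0. \<forall>x'\<in>{a..b}. dist x' x < d \<longrightarrow> dist (f x') (f x) < e" by auto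
qed

text \<open>For \<open>y < t\<close> the forward estimate is anchored at \<open>y\<close> and
  produces the slope \<open>F y\<close>; continuity of \<open>F\<close> replaces it by
  \<open>F t\<close>. Each of the two errors takes half of \<open>e\<close>.\<close>

lemma has_real_derivative_forwardI:
  fixes f F :: "real \<Rightarrow> real"
  assumes cont: "continuous_on {a..b} F"
    and fwd: "\<And>e. 0 < e \<Longrightarrow> \<exists>d>0. \<forall>t h. a \<le> t \<longrightarrow> 0 < h \<longrightarrow> h < d \<longrightarrow> t + h \<le> b \<longrightarrow>
      \<bar>f (t + h) - f t - h * F t\<bar> \<le> e * h"
    and t: "t \<in> {a..b}"
  shows "(f has_real_derivative F t) (at t within {a..b})"
  unfolding has_field_derivative_def has_derivative_within_alt
proof (intro conjI allI impI)
  show "bounded_linear ((*) (F t))" by (rule bounded_linear_mult_right)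
  fix e :: real assume e: "0 < e"
  obtain d1 where d1: "d1 > 0" and *: "\<And>t h. a \<le> t \<Longrightarrow> 0 < h \<Longrightarrow> h < d1 \<Longrightarrow> t + h \<le> b \<Longrightarrow>
    \<bar>f (t + h) - f t - h * F t\<bar> \<le> e / 2 * h"
    using fwd[of "e / 2"] e by auto
  obtain d2 where d2: "d2 > 0" and c: "\<And>y. y \<in> {a..b} \<Longrightarrow> \<bar>y - t\<bar> < d2 \<Longrightarrow> \<bar>F y - F t\<bar> < e / 2"
    using cont[unfolded continuous_on_iff, rule_format, OF t, of "e / 2"] e
    by (auto simp: dist_real_def)
  have "\<bar>f y - f t - F t * (y - t)\<bar> \<le> e * \<bar>y - t\<bar>" if y: "y \<in> {a..b}" "\<bar>y - t\<bar> < min d1 d2" for y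
  proof (cases t y rule: linorder_cases)
    case less
    then have "\<bar>f y - f t - (y - t) * F t\<bar> \<le> e / 2 * (y - t)" using *[of t "y - t"] t y by auto
    also have "\<dots> \<le> e * \<bar>y - t\<bar>" using e less by auto
    finally show ?thesis by (simp add: mult.commute)
  next
    case greater
    have 1: "\<bar>f t - f y - (t - y) * F y\<bar> \<le> e / 2 * (t - y)" using *[of y "t - y"] t y greater by auto
    have "\<bar>(t - y) * (F y - F t)\<bar> \<le> (t - y) * (e / 2)"
      using c[of y] y greater by (auto simp: abs_mult intro!: mult_left_mono less_imp_le)
    moreover have "f y - f t - F t * (y - t) = - (f t - f y - (t - y) * F y) - (t - y) * (F y - F t)"
      by (simp add: algebra_simps)
    ultimately have "\<bar>f y - f t - F t * (y - t)\<bar> \<le> e / 2 * (t - y) + (t - y) * (e / 2)"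
      using 1 by linarith
    then show ?thesis using greater by (simp add: algebra_simps)
  qed auto
  with d1 d2 show "\<exists>d>0. \<forall>y\<in>{a..b}. norm (y - t) < d \<longrightarrow>
      norm (f y - f t - F t * (y - t)) \<le> e * norm (y - t)"
    by (intro exI[of _ "min d1 d2"]) auto
qed

text \<open>Serves twice: with \<open>c = 0\<close> it bounds an integral, and with \<open>c\<close>
  the value at the left endpoint it gives the first-order term of a short integral.\<close>

lemma set_integral_average_bound:
  fixes f :: "real \<Rightarrow> real"
  assumes f: "set_integrable lborel {t..t+h} f" and h: "0 \<le> h"
    and bd: "\<And>r. t \<le> r \<Longrightarrow> r \<le> t + h \<Longrightarrow> \<bar>f r - c\<bar> \<le> e"
  shows "\<bar>(LINT r:{t..t+h}|lborel. f r) - h * c\<bar> \<le> e * h"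
proof -
  have c: "set_integrable lborel {t..t+h} (\<lambda>_. k)" for k :: real
    unfolding set_integrable_def by (intro integrable_scaleR_left integrable_real_indicator) (auto simp: emeasure_lborel_Icc_eq)
  have I: "(LINT r:{t..t+h}|lborel. k) = h * k" for k :: real
    using h by (simp add: set_lebesgue_integral_def)
  have "(LINT r:{t..t+h}|lborel. f r) \<le> (LINT r:{t..t+h}|lborel. c + e)"
    by (rule set_integral_mono[OF f c]) (use bd in fastforce)
  moreover have "(LINT r:{t..t+h}|lborel. c - e) \<le> (LINT r:{t..t+h}|lborel. f r)"
    by (rule set_integral_mono[OF c f]) (use bd in fastforce)
  ultimately show ?thesis unfolding I by (simp add: algebra_simps abs_le_iff)
qed

section \<open>Semigroups on a finite set\<close>

text \<open>What the Duhamel argument needs from a semigroup, all of it at or near time 0. It is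
  instantiated by \<open>p\<close>, which gives backward equations, and by the transpose of
  \<open>p\<close>, which gives forward equations; the semigroup property itself enters through the
  Duhamel formula.\<close>

locale kernel_at_zero =
  fixes K :: "real \<Rightarrow> 'k::finite \<Rightarrow> 'k \<Rightarrow> real" and G :: "'k \<Rightarrow> 'k \<Rightarrow> real"
  assumes K_deriv: "((\<lambda>e. (K e i j - of_bool (i = j)) / e) \<longlongrightarrow> G i j) (at_right 0)"
    and K_bound: "0 \<le> e \<Longrightarrow> \<bar>K e i j\<bar> \<le> 1"
    and K_zero: "K 0 i j = of_bool (i = j)"
    and K_cont: "continuous_on {0..} (\<lambda>e. K e i j)"
begin

lemma K_near_zero:
  assumes "0 < \<epsilon>"
  obtains d where "d > 0" "\<And>h i j. 0 \<le> h \<Longrightarrow> h < d \<Longrightarrow> \<bar>K h i j - of_bool (i = j)\<bar> \<le> \<epsilon>"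
    "\<And>h i j. 0 < h \<Longrightarrow> h < d \<Longrightarrow> \<bar>K h i j - of_bool (i = j) - h * G i j\<bar> \<le> \<epsilon> * h"
proof -
  have "\<forall>\<^sub>F e in at_right 0. \<bar>(K e i j - of_bool (i = j)) / e - G i j\<bar> < \<epsilon>" for i j
    using tendstoD[OF K_deriv \<open>0 < \<epsilon>\<close>, of i j] by (simp add: dist_real_def)
  then have "\<forall>\<^sub>F e in at_right 0. \<forall>i j. \<bar>(K e i j - of_bool (i = j)) / e - G i j\<bar> < \<epsilon>"
    by (intro eventually_all_finite) auto
  then obtain d1 where d1: "d1 > 0"
    and *: "\<And>e i j. 0 < e \<Longrightarrow> e < d1 \<Longrightarrow> \<bar>(K e i j - of_bool (i = j)) / e - G i j\<bar> < \<epsilon>"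
    unfolding eventually_at_right_field by auto
  have K0: "((\<lambda>e. K e i j - of_bool (i = j)) \<longlongrightarrow> 0) (at_right 0)" for i j
  proof -
    have "((\<lambda>e. (K e i j - of_bool (i = j)) / e * e) \<longlongrightarrow> G i j * 0) (at_right 0)"
      by (intro tendsto_mult K_deriv tendsto_ident_at)
    moreover have "\<forall>\<^sub>F e in at_right (0::real). (K e i j - of_bool (i = j)) / e * e = K e i j - of_bool (i = j)"
      by (auto simp: eventually_at_right_field intro!: exI[of _ 1])
    ultimately show ?thesis using tendsto_cong by fastforce
  qed
  have "\<forall>\<^sub>F e in at_right 0. \<bar>K e i j - of_bool (i = j)\<bar> < \<epsilon>" for i j
    using tendstoD[OF K0 \<open>0 < \<epsilon>\<close>, of i j] by (simp add: dist_real_def)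
  then have "\<forall>\<^sub>F e in at_right 0. \<forall>i j. \<bar>K e i j - of_bool (i = j)\<bar> < \<epsilon>"
    by (intro eventually_all_finite) auto
  then obtain d2 where d2: "d2 > 0"
    and **: "\<And>e i j. 0 < e \<Longrightarrow> e < d2 \<Longrightarrow> \<bar>K e i j - of_bool (i = j)\<bar> < \<epsilon>"
    unfolding eventually_at_right_field by auto
  show thesis
  proof (rule that[of "min d1 d2"])
    show "0 < min d1 d2" using d1 d2 by auto
    show "\<bar>K h i j - of_bool (i = j)\<bar> \<le> \<epsilon>" if "0 \<le> h" "h < min d1 d2" for h i j
      using **[of h i j] that assms K_zero by (cases "h = 0") auto
    show "\<bar>K h i j - of_bool (i = j) - h * G i j\<bar> \<le> \<epsilon> * h" if "0 < h" "h < min d1 d2" for h i j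
    proof -
      have "\<bar>K h i j - of_bool (i = j) - h * G i j\<bar> = \<bar>(K h i j - of_bool (i = j)) / h - G i j\<bar> * h"
        using that by (simp add: field_simps abs_mult_pos' flip: abs_mult_pos)
      also have "\<dots> \<le> \<epsilon> * h" using *[of h i j] that by (intro mult_right_mono) auto
      finally show ?thesis .
    qed
  qed
qed

lemma K_measurable: "set_borel_measurable borel {0..} (\<lambda>e. K e i j)"
  using K_cont by (intro borel_measurable_continuous_on_indicator[unfolded set_borel_measurable_def[symmetric]]) auto

lemma duhamel_integrable:
  fixes g :: "real \<Rightarrow> 'k \<Rightarrow> real"
  assumes g: "\<And>j. set_borel_measurable borel {s..t} (\<lambda>r. g r j)"
    and bd: "\<And>r j. s \<le> r \<Longrightarrow> r \<le> t \<Longrightarrow> \<bar>g r j\<bar> \<le> C"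
  shows "set_integrable lborel {s..t} (\<lambda>r. \<Sum>j\<in>UNIV. K (t - r) i j * g r j)"
    and "set_integrable lborel {s..t} (\<lambda>r. K (t - r) i j * g r j)"
proof -
  show *: "set_integrable lborel {s..t} (\<lambda>r. K (t - r) i j * g r j)" for j
    unfolding set_integrable_def
  proof (rule integrableI_bounded_set[where A = "{s..t}" and B = C])
    have 1: "(\<lambda>r. indicator {0..} (t - r) *\<^sub>R K (t - r) i j) \<in> borel_measurable borel"
      using K_measurable[of i j] unfolding set_borel_measurable_def
      by (rule measurable_compose[rotated]) simp
    have "(\<lambda>r. (indicator {0..} (t - r) *\<^sub>R K (t - r) i j) * (indicator {s..t} r *\<^sub>R g r j)) \<in> borel_measurable borel"
      using 1 g[of j] unfolding set_borel_measurable_def by (rule borel_measurable_times)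
    also have "(\<lambda>r. (indicator {0..} (t - r) *\<^sub>R K (t - r) i j) * (indicator {s..t} r *\<^sub>R g r j)) =
       (\<lambda>r. indicator {s..t} r *\<^sub>R (K (t - r) i j * g r j))"
      by (auto simp: indicator_def)
    finally show "(\<lambda>r. indicator {s..t} r *\<^sub>R (K (t - r) i j * g r j)) \<in> borel_measurable lborel" by simp
    show "emeasure lborel {s..t} < \<infinity>" by (simp add: emeasure_lborel_Icc_eq)
    show "AE r\<in>{s..t} in lborel. norm (indicator {s..t} r *\<^sub>R (K (t - r) i j * g r j)) \<le> C"
    proof (intro AE_I2 impI)
      fix r assume "r \<in> {s..t}"
      then have "\<bar>K (t - r) i j\<bar> * \<bar>g r j\<bar> \<le> 1 * C"
        by (intro mult_mono K_bound bd) auto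
      then show "norm (indicator {s..t} r *\<^sub>R (K (t - r) i j * g r j)) \<le> C"
        using \<open>r \<in> {s..t}\<close> by (simp add: abs_mult)
    qed
  qed auto
  show "set_integrable lborel {s..t} (\<lambda>r. \<Sum>j\<in>UNIV. K (t - r) i j * g r j)"
    using * unfolding set_integrable_def scaleR_sum_right by (intro Bochner_Integration.integrable_sum) auto
qed

context
  fixes u g :: "real \<Rightarrow> 'k \<Rightarrow> real" and a b B C :: real
  assumes u_bound: "\<And>t i. a \<le> t \<Longrightarrow> t \<le> b \<Longrightarrow> \<bar>u t i\<bar> \<le> B"
    and g_bound: "\<And>t i. a \<le> t \<Longrightarrow> t \<le> b \<Longrightarrow> \<bar>g t i\<bar> \<le> C"
    and g_meas: "\<And>j. set_borel_measurable borel {a..b} (\<lambda>r. g r j)"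
    and duhamel: "\<And>t h i. a \<le> t \<Longrightarrow> 0 \<le> h \<Longrightarrow> t + h \<le> b \<Longrightarrow>
      u (t + h) i = (\<Sum>j\<in>UNIV. K h i j * u t j) - (LINT r:{t..t+h}|lborel. \<Sum>j\<in>UNIV. K (t + h - r) i j * g r j)"
begin

lemma duhamel_integrable':
  assumes "a \<le> t" "t + h \<le> b"
  shows "set_integrable lborel {t..t+h} (\<lambda>r. \<Sum>j\<in>UNIV. K (t + h - r) i j * g r j)"
proof (rule duhamel_integrable(1)[where C = C])
  show "set_borel_measurable borel {t..t+h} (\<lambda>r. g r j)" for j
    using g_meas[of j] by (rule set_borel_measurable_subset) (use assms in auto)
qed (use assms g_bound in auto)

text \<open>Boundedness of \<open>u\<close> and \<open>g\<close> suffices: over a step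
  \<open>h\<close> the kernel is close to the identity and the integral is of order
  \<open>h\<close>, both uniformly in \<open>t\<close>.\<close>

lemma duhamel_continuous: "continuous_on {a..b} (\<lambda>t. u t i)"
proof (rule continuous_on_forwardI)
  fix e :: real assume e: "0 < e"
  let ?n = "real CARD('k)"
  have n: "?n > 0" by simp
  define B' where "B' = max B 0 + 1"
  define C' where "C' = max C 0 + 1"
  have B': "B' > 0" "B \<le> B'" and C': "C' > 0" "C \<le> C'" by (auto simp: B'_def C'_def)
  \<comment> \<open>Summed over the \<open>?n\<close> states, errors of size
    \<open>\<epsilon> * B'\<close> amount to \<open>e / 2\<close>; the integral takes the other
    half.\<close>
  define \<epsilon> where "\<epsilon> = e / (2 * ?n * B')"
  have \<epsilon>: "0 < \<epsilon>" using e B' by (simp add: \<epsilon>_def)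
  obtain d where d: "d > 0" "\<And>h i j. 0 \<le> h \<Longrightarrow> h < d \<Longrightarrow> \<bar>K h i j - of_bool (i = j)\<bar> \<le> \<epsilon>"
    using K_near_zero[OF \<epsilon>] by metis
  define d' where "d' = min d (e / (2 * ?n * C'))"
  have "d' > 0" using d e C' by (auto simp: d'_def)
  moreover have "\<bar>u (t + h) i - u t i\<bar> \<le> e" if th: "a \<le> t" "0 < h" "h < d'" "t + h \<le> b" for t h
  proof -
    have 1: "\<bar>(\<Sum>j\<in>UNIV. K h i j * u t j) - u t i\<bar> \<le> e / 2"
    proof -
      have "(\<Sum>j\<in>UNIV. K h i j * u t j) - u t i = (\<Sum>j\<in>UNIV. (K h i j - of_bool (i = j)) * u t j)"
        by (simp add: left_diff_distrib sum_subtractf)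
      also have "\<bar>\<dots>\<bar> \<le> (\<Sum>j\<in>UNIV. \<bar>(K h i j - of_bool (i = j)) * u t j\<bar>)" by (rule sum_abs)
      also have "\<dots> \<le> (\<Sum>j\<in>(UNIV::'k set). \<epsilon> * B')"
      proof (rule sum_mono)
        fix j
        have "\<bar>u t j\<bar> \<le> B'" using u_bound[of t j] th B' by auto
        then show "\<bar>(K h i j - of_bool (i = j)) * u t j\<bar> \<le> \<epsilon> * B'"
          unfolding abs_mult using d(2)[of h i j] th \<epsilon> by (intro mult_mono) (auto simp: d'_def)
      qed
      also have "\<dots> = e / 2" using B' by (simp add: \<epsilon>_def)
      finally show ?thesis .
    qed
    have 2: "\<bar>(LINT r:{t..t+h}|lborel. \<Sum>j\<in>UNIV. K (t + h - r) i j * g r j) - h * 0\<bar> \<le> (?n * C') * h"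
    proof (rule set_integral_average_bound)
      fix r assume r: "t \<le> r" "r \<le> t + h"
      have "\<bar>\<Sum>j\<in>UNIV. K (t + h - r) i j * g r j\<bar> \<le> (\<Sum>j\<in>UNIV. \<bar>K (t + h - r) i j * g r j\<bar>)" by (rule sum_abs)
      also have "\<dots> \<le> (\<Sum>j\<in>(UNIV::'k set). C')"
      proof (rule sum_mono)
        fix j
        have "\<bar>K (t + h - r) i j\<bar> * \<bar>g r j\<bar> \<le> 1 * C'"
          using g_bound[of r j] r th C' by (intro mult_mono K_bound) auto
        then show "\<bar>K (t + h - r) i j * g r j\<bar> \<le> C'" by (simp add: abs_mult)
      qed
      finally show "\<bar>(\<Sum>j\<in>UNIV. K (t + h - r) i j * g r j) - 0\<bar> \<le> ?n * C'" by simp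
    qed (use th duhamel_integrable' in auto)
    have "(?n * C') * h \<le> (?n * C') * (e / (2 * ?n * C'))"
      using th C' by (intro mult_left_mono) (auto simp: d'_def)
    also have "\<dots> = e / 2" using C' by simp
    finally show ?thesis
      using duhamel[of t h i] th 1 2 by (auto simp: abs_if split: if_splits)
  qed
  ultimately show "\<exists>d>0. \<forall>t h. a \<le> t \<longrightarrow> 0 < h \<longrightarrow> h < d \<longrightarrow> t + h \<le> b \<longrightarrow> \<bar>u (t + h) i - u t i\<bar> \<le> e"
    by blast
qed

text \<open>The kernel contributes the term in \<open>G\<close>. In the integral the kernel is close
  to the identity and \<open>g\<close> is uniformly continuous, so that it equals
  \<open>h * g t i\<close> up to a small multiple of \<open>h\<close>.\<close>

lemma duhamel_has_derivative:
  assumes g_cont: "\<And>i. continuous_on {a..b} (\<lambda>t. g t i)" and t: "t \<in> {a..b}"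
  shows "((\<lambda>t. u t i) has_real_derivative ((\<Sum>j\<in>UNIV. G i j * u t j) - g t i)) (at t within {a..b})"
proof (rule has_real_derivative_forwardI[OF _ _ t])
  show "continuous_on {a..b} (\<lambda>t. (\<Sum>j\<in>UNIV. G i j * u t j) - g t i)"
    by (intro continuous_intros g_cont duhamel_continuous)
  fix e :: real assume e: "0 < e"
  let ?n = "real CARD('k)"
  define B' where "B' = max (max B C) 0 + 1"
  have B': "B' > 0" "B \<le> B'" "C \<le> B'" by (auto simp: B'_def)
  \<comment> \<open>One third of \<open>e\<close> for each error: the expansion of the kernel, the
    kernel inside the integral, and the oscillation of \<open>g\<close>.\<close>
  define \<epsilon> where "\<epsilon> = e / (3 * ?n * B')"
  have \<epsilon>: "0 < \<epsilon>" using e B' by (simp add: \<epsilon>_def)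
  obtain d where d: "d > 0" "\<And>h i j. 0 \<le> h \<Longrightarrow> h < d \<Longrightarrow> \<bar>K h i j - of_bool (i = j)\<bar> \<le> \<epsilon>"
    "\<And>h i j. 0 < h \<Longrightarrow> h < d \<Longrightarrow> \<bar>K h i j - of_bool (i = j) - h * G i j\<bar> \<le> \<epsilon> * h"
    using K_near_zero[OF \<epsilon>] by metis
  have "uniformly_continuous_on {a..b} (\<lambda>t. g t i)"
    by (intro compact_uniformly_continuous g_cont) auto
  then obtain d2 where d2: "d2 > 0"
    "\<And>r t. r \<in> {a..b} \<Longrightarrow> t \<in> {a..b} \<Longrightarrow> \<bar>r - t\<bar> < d2 \<Longrightarrow> \<bar>g r i - g t i\<bar> < e / 3"
    unfolding uniformly_continuous_on_def dist_real_def using e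
    by (metis zero_less_divide_iff zero_less_numeral)
  define d' where "d' = min d d2"
  have d': "d' > 0" using d d2 by (auto simp: d'_def)
  have main: "\<bar>u (t + h) i - u t i - h * ((\<Sum>j\<in>UNIV. G i j * u t j) - g t i)\<bar> \<le> e * h"
    if th: "a \<le> t" "0 < h" "h < d'" "t + h \<le> b" for t h
  proof -
    have 1: "\<bar>(\<Sum>j\<in>UNIV. K h i j * u t j) - u t i - h * (\<Sum>j\<in>UNIV. G i j * u t j)\<bar> \<le> e / 3 * h"
    proof -
      have "(\<Sum>j\<in>UNIV. K h i j * u t j) - u t i - h * (\<Sum>j\<in>UNIV. G i j * u t j) =
        (\<Sum>j\<in>UNIV. (K h i j - of_bool (i = j) - h * G i j) * u t j)"
        by (simp add: left_diff_distrib sum_subtractf sum_distrib_left mult.assoc)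
      also have "\<bar>\<dots>\<bar> \<le> (\<Sum>j\<in>UNIV. \<bar>(K h i j - of_bool (i = j) - h * G i j) * u t j\<bar>)" by (rule sum_abs)
      also have "\<dots> \<le> (\<Sum>j\<in>(UNIV::'k set). (\<epsilon> * h) * B')"
      proof (rule sum_mono)
        fix j
        have "\<bar>u t j\<bar> \<le> B'" using u_bound[of t j] th B' by auto
        then show "\<bar>(K h i j - of_bool (i = j) - h * G i j) * u t j\<bar> \<le> (\<epsilon> * h) * B'"
          unfolding abs_mult using d(3)[of h i j] th \<epsilon> by (intro mult_mono) (auto simp: d'_def)
      qed
      also have "\<dots> = e / 3 * h" using B' by (simp add: \<epsilon>_def)
      finally show ?thesis .
    qed
    have 2: "\<bar>(LINT r:{t..t+h}|lborel. \<Sum>j\<in>UNIV. K (t + h - r) i j * g r j) - h * g t i\<bar> \<le> (2 * e / 3) * h"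
    proof (rule set_integral_average_bound)
      fix r assume r: "t \<le> r" "r \<le> t + h"
      have "(\<Sum>j\<in>UNIV. K (t + h - r) i j * g r j) - g r i =
          (\<Sum>j\<in>UNIV. (K (t + h - r) i j - of_bool (i = j)) * g r j)"
        by (simp add: left_diff_distrib sum_subtractf)
      also have "\<bar>\<dots>\<bar> \<le> (\<Sum>j\<in>UNIV. \<bar>(K (t + h - r) i j - of_bool (i = j)) * g r j\<bar>)" by (rule sum_abs)
      also have "\<dots> \<le> (\<Sum>j\<in>(UNIV::'k set). \<epsilon> * B')"
      proof (rule sum_mono)
        fix j
        have "\<bar>g r j\<bar> \<le> B'" using g_bound[of r j] r th B' by auto
        then show "\<bar>(K (t + h - r) i j - of_bool (i = j)) * g r j\<bar> \<le> \<epsilon> * B'"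
          unfolding abs_mult using d(2)[of "t + h - r" i j] th r \<epsilon> by (intro mult_mono) (auto simp: d'_def)
      qed
      also have "\<dots> = e / 3" using B' by (simp add: \<epsilon>_def)
      finally have "\<bar>(\<Sum>j\<in>UNIV. K (t + h - r) i j * g r j) - g r i\<bar> \<le> e / 3" .
      moreover have "\<bar>g r i - g t i\<bar> < e / 3" using d2(2)[of r t] r th by (auto simp: d'_def)
      ultimately show "\<bar>(\<Sum>j\<in>UNIV. K (t + h - r) i j * g r j) - g t i\<bar> \<le> 2 * e / 3" by linarith
    qed (use th duhamel_integrable' in auto)
    have "u (t + h) i - u t i - h * ((\<Sum>j\<in>UNIV. G i j * u t j) - g t i) =
      ((\<Sum>j\<in>UNIV. K h i j * u t j) - u t i - h * (\<Sum>j\<in>UNIV. G i j * u t j)) -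
      ((LINT r:{t..t+h}|lborel. \<Sum>j\<in>UNIV. K (t + h - r) i j * g r j) - h * g t i)"
      using duhamel[of t h i] th by (simp add: algebra_simps)
    then have "\<bar>u (t + h) i - u t i - h * ((\<Sum>j\<in>UNIV. G i j * u t j) - g t i)\<bar> \<le> e / 3 * h + (2 * e / 3) * h"
      using 1 2 by linarith
    then show ?thesis by (simp add: algebra_simps)
  qed
  show "\<exists>d>0. \<forall>t h. a \<le> t \<longrightarrow> 0 < h \<longrightarrow> h < d \<longrightarrow> t + h \<le> b \<longrightarrow>
      \<bar>u (t + h) i - u t i - h * ((\<Sum>j\<in>UNIV. G i j * u t j) - g t i)\<bar> \<le> e * h"
    using main d' by blast
qed

end

end

locale markov_semigroup =
  fixes p :: "real \<Rightarrow> 'k::finite \<Rightarrow> 'k \<Rightarrow> real" and L :: "real^'k^'k"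
  assumes gen: "generator_matrix L"
    and tf: "transition_function {0..} (\<lambda>s t. p (t - s))"
    and rates: "has_transition_rates {0..} (\<lambda>s t. p (t - s)) (\<lambda>_ i j. L $ i $ j)"
begin

lemma p_nonneg: "0 \<le> t \<Longrightarrow> 0 \<le> p t i j"
  and p_sum: "0 \<le> t \<Longrightarrow> (\<Sum>j\<in>UNIV. p t i j) = 1"
proof -
  assume t: "0 \<le> t"
  have "\<forall>s\<in>{0..}. \<forall>t\<in>{0..}. s \<le> t \<longrightarrow>
        (\<forall>i j. 0 \<le> p (t - s) i j) \<and> (\<forall>i. (\<Sum>j\<in>UNIV. p (t - s) i j) = 1)"
    using tf unfolding transition_function_def by blast
  from this[rule_format, of 0 t] t show "0 \<le> p t i j" "(\<Sum>j\<in>UNIV. p t i j) = 1" by auto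
qed

lemma p_zero: "p 0 i j = of_bool (i = j)"
proof -
  have "\<forall>s\<in>{0..}. \<forall>i j. p (s - s) i j = (if i = j then 1 else 0)"
    using tf unfolding transition_function_def by blast
  from this[rule_format, of 0 i j] show ?thesis by auto
qed

lemma p_add: "0 \<le> s \<Longrightarrow> 0 \<le> t \<Longrightarrow> p (s + t) i j = (\<Sum>k\<in>UNIV. p s i k * p t k j)"
proof -
  assume st: "0 \<le> s" "0 \<le> t"
  have "\<forall>s\<in>{0..}. \<forall>t\<in>{0..}. \<forall>u\<in>{0..}. s \<le> t \<and> t \<le> u \<longrightarrow>
        (\<forall>i j. p (u - s) i j = (\<Sum>k\<in>UNIV. p (t - s) i k * p (u - t) k j))"
    using tf unfolding transition_function_def by blast
  from this[rule_format, of 0 s "s + t" i j] st show ?thesis by simp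
qed

lemma p_le_1: "0 \<le> t \<Longrightarrow> p t i j \<le> 1"
proof -
  assume t: "0 \<le> t"
  have "p t i j \<le> (\<Sum>j\<in>UNIV. p t i j)" by (rule member_le_sum) (auto simp: p_nonneg t)
  then show ?thesis by (simp add: p_sum t)
qed

lemma L_nonneg: "i \<noteq> j \<Longrightarrow> 0 \<le> L $ i $ j" and L_sum: "(\<Sum>j\<in>UNIV. L $ i $ j) = 0"
  using gen unfolding generator_matrix_def by auto

text \<open>Rates are prescribed off the diagonal only; the diagonal one follows because the rows of
  \<open>p e\<close> sum to 1 and those of \<open>L\<close> to 0.\<close>

lemma p_deriv: "((\<lambda>e. (p e i j - of_bool (i = j)) / e) \<longlongrightarrow> L $ i $ j) (at_right 0)"
proof -
  have off: "((\<lambda>e. p e i j / e) \<longlongrightarrow> L $ i $ j) (at_right 0)" if "i \<noteq> j" for j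
    using rates that unfolding has_transition_rates_def by (auto dest!: bspec[of _ _ 0])
  show ?thesis
  proof (cases "i = j")
    case False
    with off show ?thesis by simp
  next
    case True
    have "((\<lambda>e. - (\<Sum>k\<in>UNIV - {i}. p e i k / e)) \<longlongrightarrow> - (\<Sum>k\<in>UNIV - {i}. L $ i $ k)) (at_right 0)"
      by (intro tendsto_intros off) auto
    moreover have "- (\<Sum>k\<in>UNIV - {i}. L $ i $ k) = L $ i $ i"
      using L_sum[of i] by (subst (asm) sum.remove[of _ i]) auto
    moreover have "\<forall>\<^sub>F e in at_right 0. - (\<Sum>k\<in>UNIV - {i}. p e i k / e) = (p e i i - 1) / e"
    proof -
      have "- (\<Sum>k\<in>UNIV - {i}. p e i k / e) = (p e i i - 1) / e" if "0 < e" for e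
      proof -
        have "(\<Sum>k\<in>UNIV - {i}. p e i k) = 1 - p e i i"
          using p_sum[OF less_imp_le[OF that], of i] by (subst (asm) sum.remove[of _ i]) auto
        then show ?thesis by (simp add: minus_divide_left flip: sum_divide_distrib)
      qed
      then show ?thesis by (auto simp: eventually_at_right_field intro!: exI[of _ 1])
    qed
    ultimately show ?thesis using True by (auto simp: tendsto_cong)
  qed
qed

text \<open>Writing the step \<open>h\<close> first, \<open>p (t + h)\<close> as \<open>p h\<close>
  times \<open>p t\<close>, leaves a bound by the kernel at time \<open>h\<close> alone, hence
  uniform in \<open>t\<close>.\<close>

lemma p_increment:
  assumes "0 \<le> t" "0 \<le> h"
  shows "\<bar>p (t + h) i j - p t i j\<bar> \<le> (\<Sum>k\<in>UNIV. \<bar>p h i k - of_bool (i = k)\<bar>)"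
proof -
  have "p (t + h) i j - p t i j = (\<Sum>k\<in>UNIV. (p h i k - of_bool (i = k)) * p t k j)"
    using p_add[of h t i j] assms by (simp add: left_diff_distrib sum_subtractf add.commute)
  also have "\<bar>\<dots>\<bar> \<le> (\<Sum>k\<in>UNIV. \<bar>(p h i k - of_bool (i = k)) * p t k j\<bar>)" by (rule sum_abs)
  also have "\<dots> \<le> (\<Sum>k\<in>UNIV. \<bar>p h i k - of_bool (i = k)\<bar>)"
    using assms by (intro sum_mono) (auto simp: abs_mult p_nonneg p_le_1 intro!: mult_left_le)
  finally show ?thesis .
qed

lemma p_tendsto_0: "((\<lambda>e. p e i j - of_bool (i = j)) \<longlongrightarrow> 0) (at_right 0)"
proof -
  have "((\<lambda>e. (p e i j - of_bool (i = j)) / e * e) \<longlongrightarrow> L $ i $ j * 0) (at_right 0)"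
    by (intro tendsto_mult p_deriv tendsto_ident_at)
  moreover have "\<forall>\<^sub>F e in at_right (0::real). (p e i j - of_bool (i = j)) / e * e = p e i j - of_bool (i = j)"
    by (auto simp: eventually_at_right_field intro!: exI[of _ 1])
  ultimately show ?thesis using tendsto_cong by fastforce
qed

lemma p_continuous: "continuous_on {0..} (\<lambda>t. p t i j)"
proof -
  have "continuous_on {0..b} (\<lambda>t. p t i j)" for b
  proof (rule continuous_on_forwardI)
    fix e :: real assume e: "0 < e"
    have "((\<lambda>h. \<Sum>k\<in>UNIV. \<bar>p h i k - of_bool (i = k)\<bar>) \<longlongrightarrow> (\<Sum>k\<in>(UNIV::'k set). \<bar>0\<bar>)) (at_right 0)"
      by (intro tendsto_intros p_tendsto_0)
    then have "\<forall>\<^sub>F h in at_right 0. (\<Sum>k\<in>UNIV. \<bar>p h i k - of_bool (i = k)\<bar>) < e"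
      using e by (intro order_tendstoD(2)) auto
    then obtain d where d: "d > 0"
      "\<And>h. 0 < h \<Longrightarrow> h < d \<Longrightarrow> (\<Sum>k\<in>UNIV. \<bar>p h i k - of_bool (i = k)\<bar>) < e"
      unfolding eventually_at_right_field by auto
    have "\<bar>p (t + h) i j - p t i j\<bar> \<le> e" if "0 \<le> t" "0 < h" "h < d" for t h
      using p_increment[of t h i j] d(2)[of h] that by linarith
    with d(1) show "\<exists>d>0. \<forall>t h. 0 \<le> t \<longrightarrow> 0 < h \<longrightarrow> h < d \<longrightarrow> t + h \<le> b \<longrightarrow> \<bar>p (t + h) i j - p t i j\<bar> \<le> e"
      by blast
  qed
  then have "\<forall>b. continuous_on {0..<b} (\<lambda>t. p t i j)"
    by (meson continuous_on_subset atLeastLessThan_subseteq_atLeastAtMost_iff order_refl)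
  then have "\<forall>t\<ge>0. continuous (at t within {0..}) (\<lambda>t. p t i j)"
  proof (intro allI impI)
    fix t :: real assume c: "\<forall>b. continuous_on {0..<b} (\<lambda>t. p t i j)" and t: "0 \<le> t"
    have "continuous (at t within {0..<t+1}) (\<lambda>t. p t i j)"
      using c t by (auto simp: continuous_on_eq_continuous_within)
    moreover have "at t within {0..<t+1} = at t within {0..}"
      by (rule at_within_nhd[where S = "{..<t+1}"]) auto
    ultimately show "continuous (at t within {0..}) (\<lambda>t. p t i j)" by simp
  qed
  then show ?thesis by (auto simp: continuous_on_eq_continuous_within)
qed

lemma p_abs: "0 \<le> t \<Longrightarrow> \<bar>p t i j\<bar> \<le> 1"
  using p_nonneg[of t i j] p_le_1[of t i j] by simp

lemma backward_kernel: "kernel_at_zero p (\<lambda>i j. L $ i $ j)"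
proof (rule kernel_at_zero.intro)
  show "((\<lambda>e. (p e i j - of_bool (i = j)) / e) \<longlongrightarrow> L $ i $ j) (at_right 0)" for i j
    by (rule p_deriv)
  show "\<bar>p e i j\<bar> \<le> 1" if "0 \<le> e" for e i j
    using that by (rule p_abs)
  show "p 0 i j = of_bool (i = j)" for i j
    by (rule p_zero)
  show "continuous_on {0..} (\<lambda>e. p e i j)" for i j
    by (rule p_continuous)
qed

lemma forward_kernel: "kernel_at_zero (\<lambda>t i j. p t j i) (\<lambda>i j. L $ j $ i)"
proof (rule kernel_at_zero.intro)
  show "((\<lambda>e. (p e j i - of_bool (i = j)) / e) \<longlongrightarrow> L $ j $ i) (at_right 0)" for i j
    using p_deriv[of j i] by (subst eq_commute[of i j])
  show "\<bar>p e j i\<bar> \<le> 1" if "0 \<le> e" for e i j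
    using that by (rule p_abs)
  show "p 0 j i = of_bool (i = j)" for i j
    using p_zero[of j i] by (subst eq_commute[of i j])
  show "continuous_on {0..} (\<lambda>e. p e j i)" for i j
    by (rule p_continuous)
qed

end

section \<open>Uniqueness of the semigroup with given rates\<close>

text \<open>Two semigroups with the same rates differ by at most \<open>e * h\<close> over a short
  step \<open>h\<close>. Stochastic matrices do not amplify errors, so \<open>n\<close> steps of
  length \<open>t / n\<close> accumulate at most \<open>e * t\<close>, with \<open>e\<close>
  arbitrary.\<close>

lemma markov_semigroup_unique:
  assumes "markov_semigroup p L" "markov_semigroup q L" "0 \<le> t"
  shows "p t = q t"
proof -
  interpret p: markov_semigroup p L by fact
  interpret q: markov_semigroup q L by fact
  define R where "R t i = (\<Sum>j\<in>UNIV. \<bar>p t i j - q t i j\<bar>)" for t i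
  \<comment> \<open>The difference of products telescopes into \<open>p s\<close> applied to the
    error at \<open>t\<close> plus the error at \<open>s\<close> applied to \<open>q t\<close>; the
    rows of \<open>q t\<close> sum to 1.\<close>
  have R_add: "R (s + t) i \<le> (\<Sum>k\<in>UNIV. p s i k * R t k) + R s i" if st: "0 \<le> s" "0 \<le> t" for s t i
  proof -
    have "R (s + t) i = (\<Sum>j\<in>UNIV. \<bar>\<Sum>k\<in>UNIV. p s i k * (p t k j - q t k j) + (p s i k - q s i k) * q t k j\<bar>)"
    proof -
      have "p (s + t) i j - q (s + t) i j =
          (\<Sum>k\<in>UNIV. p s i k * (p t k j - q t k j) + (p s i k - q s i k) * q t k j)" for j
        unfolding p.p_add[OF st] q.p_add[OF st] sum_subtractf[symmetric]
        by (intro sum.cong refl) (simp add: algebra_simps)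
      then show ?thesis by (simp add: R_def)
    qed
    also have "\<dots> \<le> (\<Sum>j\<in>UNIV. \<Sum>k\<in>UNIV. p s i k * \<bar>p t k j - q t k j\<bar> + \<bar>p s i k - q s i k\<bar> * q t k j)"
      using st by (intro sum_mono order_trans[OF sum_abs] order_trans[OF abs_triangle_ineq])
        (auto simp: abs_mult p.p_nonneg q.p_nonneg)
    also have "\<dots> = (\<Sum>k\<in>UNIV. \<Sum>j\<in>UNIV. p s i k * \<bar>p t k j - q t k j\<bar> + \<bar>p s i k - q s i k\<bar> * q t k j)"
      by (rule sum.swap)
    also have "\<dots> = (\<Sum>k\<in>UNIV. p s i k * R t k) + R s i"
      using st by (simp add: sum.distrib R_def q.p_sum flip: sum_distrib_left)
    finally show ?thesis .
  qed
  have R0: "R t i \<le> e * t" if e: "0 < e" for e i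
  proof (cases "t = 0")
    case True
    then show ?thesis by (simp add: R_def p.p_zero q.p_zero)
  next
    case False
    with assms have t: "0 < t" by simp
    let ?n = "real CARD('a)"
    define \<epsilon> where "\<epsilon> = e / (2 * ?n)"
    have \<epsilon>: "0 < \<epsilon>" using e by (simp add: \<epsilon>_def)
    obtain d1 where d1: "d1 > 0"
      "\<And>h i j. 0 < h \<Longrightarrow> h < d1 \<Longrightarrow> \<bar>p h i j - of_bool (i = j) - h * L $ i $ j\<bar> \<le> \<epsilon> * h"
      using kernel_at_zero.K_near_zero[OF p.backward_kernel \<epsilon>] by metis
    obtain d2 where d2: "d2 > 0"
      "\<And>h i j. 0 < h \<Longrightarrow> h < d2 \<Longrightarrow> \<bar>q h i j - of_bool (i = j) - h * L $ i $ j\<bar> \<le> \<epsilon> * h"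
      using kernel_at_zero.K_near_zero[OF q.backward_kernel \<epsilon>] by metis
    have small: "R h i \<le> e * h" if h: "0 < h" "h < min d1 d2" for h i
    proof -
      have "R h i \<le> (\<Sum>j\<in>(UNIV::'a set). 2 * \<epsilon> * h)"
        unfolding R_def
      proof (rule sum_mono)
        fix j show "\<bar>p h i j - q h i j\<bar> \<le> 2 * \<epsilon> * h"
          using d1(2)[of h i j] d2(2)[of h i j] h by linarith
      qed
      also have "\<dots> = e * h" by (simp add: \<epsilon>_def)
      finally show ?thesis .
    qed
    obtain n :: nat where n: "n > 0" "t / real n < min d1 d2"
      using real_arch_inverse[of "min d1 d2 / t"] d1 d2 t
      by (auto simp: field_simps)
    define h where "h = t / real n"
    have h: "0 < h" "h < min d1 d2" using n t by (auto simp: h_def)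
    have "R (real m * h) i \<le> real m * (e * h)" for m i
    proof (induction m arbitrary: i)
      case 0
      then show ?case by (simp add: R_def p.p_zero q.p_zero)
    next
      case (Suc m)
      have "R (real (Suc m) * h) i = R (h + real m * h) i" by (simp add: algebra_simps)
      also have "\<dots> \<le> (\<Sum>k\<in>UNIV. p h i k * R (real m * h) k) + R h i" using h by (intro R_add) auto
      also have "\<dots> \<le> (\<Sum>k\<in>UNIV. p h i k * (real m * (e * h))) + e * h"
        using h by (intro add_mono sum_mono mult_left_mono Suc small) (auto simp: p.p_nonneg)
      also have "\<dots> = real (Suc m) * (e * h)"
        unfolding sum_distrib_right[symmetric] using h by (simp add: p.p_sum algebra_simps)
      finally show ?case .
    qed
    from this[of n i] n show ?thesis by (simp add: h_def)
  qed
  have "R t i \<le> 0" for i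
  proof (rule field_le_epsilon)
    fix e :: real assume "0 < e"
    then have "R t i \<le> e / (t + 1) * t" using assms by (intro R0) auto
    also have "\<dots> \<le> 0 + e" using assms \<open>0 < e\<close> by (auto simp: field_simps)
    finally show "R t i \<le> 0 + e" .
  qed
  then have "R t i = 0" for i unfolding R_def by (simp add: order_antisym sum_nonneg)
  then show ?thesis unfolding R_def by (intro ext) (simp add: sum_nonneg_eq_0_iff)
qed

section \<open>Path properties of a jump process\<close>

text \<open>Next to any point the path is constant on each side, so jump times do not accumulate
  there, and a subset of a compact interval without limit points in it is finite.\<close>

lemma jump_path_finite_discontinuities:
  assumes y: "jump_path_on {0..} y" and s: "0 \<le> s"
  shows "finite {r\<in>{s..t}. \<not> (\<forall>\<^sub>F q in at_left r. y q = y r)}" (is "finite ?D")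
proof -
  have "finite ({s..t} \<inter> ?D)"
  proof (rule finite_not_islimpt_in_compact)
    fix z assume z: "z \<in> {s..t}"
    have R: "\<forall>\<^sub>F r in at_right z. r \<notin> ?D"
    proof -
      have "\<forall>\<^sub>F r in at_right z. y r = y z"
        using y z s unfolding jump_path_on_def by simp
      then obtain b where b: "b > z" "\<And>r. z < r \<Longrightarrow> r < b \<Longrightarrow> y r = y z"
        unfolding eventually_at_right_field by auto
      have "\<forall>\<^sub>F q in at_left r. y q = y r" if "z < r" "r < b" for r
        unfolding eventually_at_left_field using b that by (intro exI[of _ z]) auto
      then have "r \<notin> ?D" if "z < r" "r < b" for r using that by simp
      then show ?thesis unfolding eventually_at_right_field using b(1) by blast
    qed
    have L: "\<forall>\<^sub>F r in at_left z. r \<notin> ?D"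
    proof (cases "0 < z")
      case True
      then have "\<exists>k. \<forall>\<^sub>F r in at_left z. y r = k"
        using y unfolding jump_path_on_def by simp
      then obtain b k where b: "b < z" "\<And>r. b < r \<Longrightarrow> r < z \<Longrightarrow> y r = k"
        unfolding eventually_at_left_field by auto
      have "\<forall>\<^sub>F q in at_left r. y q = y r" if "b < r" "r < z" for r
        unfolding eventually_at_left_field using b that by (intro exI[of _ b]) auto
      then have "r \<notin> ?D" if "b < r" "r < z" for r using that by simp
      then show ?thesis unfolding eventually_at_left_field using b(1) by blast
    next
      case False
      \<comment> \<open>Here \<open>z = 0\<close>, because \<open>0 \<le> s \<le> z\<close>; the set
        \<open>?D\<close> contains no negative times.\<close>
      then show ?thesis unfolding eventually_at_left_field using s
        by (intro exI[of _ "z - 1"]) auto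
    qed
    show "\<not> z islimpt ?D"
      unfolding islimpt_iff_eventually using L R by (simp add: eventually_at_split)
  qed auto
  then show ?thesis by (rule rev_finite_subset) auto
qed

locale jump_chain = markov_semigroup p L
  for p :: "real \<Rightarrow> 'k::finite \<Rightarrow> 'k \<Rightarrow> real" and L +
  fixes M :: "'a measure" and Y :: "real \<Rightarrow> 'a \<Rightarrow> 'k" and x :: 'k
  assumes chain: "markov_chain_with {0..} M Y x (\<lambda>s t. p (t - s))"
begin

sublocale prob_space M
  using chain unfolding markov_chain_with_def by auto

abbreviation F where "F \<equiv> natural_filt (space M) Y (count_space UNIV)"

lemma Y_measurable: "0 \<le> t \<Longrightarrow> Y t \<in> measurable M (count_space UNIV)"
  using chain unfolding markov_chain_with_def by auto

lemma Y_path: "\<omega> \<in> space M \<Longrightarrow> jump_path_on {0..} (\<lambda>t. Y t \<omega>)"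
  using chain unfolding markov_chain_with_def by auto

lemma space_F: "space (F t) = space M"
  unfolding natural_filt_def by (rule space_measure_of) auto

lemma sets_F: "sets (F t) = sigma_sets (space M) {Y u -` A \<inter> space M | u A. 0 \<le> u \<and> u \<le> t \<and> A \<in> sets (count_space UNIV)}"
  unfolding natural_filt_def by (rule sets_measure_of) auto

lemma sets_F_subset: "sets (F t) \<subseteq> sets M"
  unfolding sets_F using Y_measurable by (intro sets.sigma_sets_subset) (auto dest: measurable_sets)

lemma sets_F_mono: "s \<le> t \<Longrightarrow> sets (F s) \<subseteq> sets (F t)"
  unfolding sets_F by (intro sigma_sets_mono'') (force intro: sigma_sets_top)+

lemma measurable_F_mono: "s \<le> t \<Longrightarrow> f \<in> measurable (F s) N \<Longrightarrow> f \<in> measurable (F t) N"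
  using sets_F_mono[of s t] space_F[of s] space_F[of t] unfolding measurable_def by auto

lemma measurable_F: "f \<in> measurable (F s) N \<Longrightarrow> f \<in> measurable M N"
  using sets_F_subset[of s] space_F[of s] unfolding measurable_def by auto

lemma Y_adapted: "0 \<le> u \<Longrightarrow> u \<le> t \<Longrightarrow> Y u \<in> measurable (F t) (count_space UNIV)"
  unfolding measurable_def space_F sets_F by (auto intro!: sigma_sets.Basic)

lemma subalgebra_F: "subalgebra M (F t)"
  unfolding subalgebra_def using sets_F_subset space_F by auto

lemma sigma_finite_subalgebra_F: "sigma_finite_subalgebra M (F t)"
  by (intro finite_measure_subalgebra_is_sigma_finite finite_measure_subalgebra.intro
      finite_measure_subalgebra_axioms.intro subalgebra_F finite_measure_axioms)

text \<open>The conditional expectation is replaced by \<open>p (t - s) (Y s) j\<close> and split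
  according to the value of \<open>Y s\<close>. In this integrated form the property is linear in
  \<open>W\<close>.\<close>

lemma markov_property:
  fixes W :: "'a \<Rightarrow> real"
  assumes W: "W \<in> borel_measurable (F s)" and bd: "\<And>\<omega>. \<omega> \<in> space M \<Longrightarrow> \<bar>W \<omega>\<bar> \<le> B" and st: "0 \<le> s" "s \<le> t"
  shows "(LINT \<omega>|M. W \<omega> * of_bool (Y t \<omega> = j)) = (\<Sum>i\<in>UNIV. p (t - s) i j * (LINT \<omega>|M. W \<omega> * of_bool (Y s \<omega> = i)))"
proof -
  interpret sigma_finite_subalgebra M "F s" by (rule sigma_finite_subalgebra_F)
  have WM[measurable]: "W \<in> borel_measurable M" using W by (rule measurable_F)
  have [measurable]: "Y t \<in> measurable M (count_space UNIV)" "Y s \<in> measurable M (count_space UNIV)"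
    using Y_measurable st by auto
  have [measurable]: "{\<omega>'\<in>space M. Y t \<omega>' = j} \<in> sets M" by measurable
  have AEc: "AE \<omega> in M. real_cond_exp M (F s) (indicator {\<omega>'\<in>space M. Y t \<omega>' = j}) \<omega> = p (t - s) (Y s \<omega>) j"
    using chain st unfolding markov_chain_with_def by auto
  have int: "integrable M (\<lambda>\<omega>. W \<omega> * f \<omega>)" if "f \<in> borel_measurable M" "\<And>\<omega>. \<bar>f \<omega>\<bar> \<le> 1" for f :: "'a \<Rightarrow> real"
  proof (rule integrable_const_bound[where B = B])
    show "AE \<omega> in M. norm (W \<omega> * f \<omega>) \<le> B"
    proof (rule AE_I2)
      fix \<omega> assume "\<omega> \<in> space M"
      have "\<bar>W \<omega>\<bar> * \<bar>f \<omega>\<bar> \<le> B * 1" using bd[OF \<open>\<omega> \<in> space M\<close>] that(2) by (intro mult_mono) auto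
      then show "norm (W \<omega> * f \<omega>) \<le> B" by (simp add: abs_mult)
    qed
  qed (use that in measurable)
  have "(LINT \<omega>|M. W \<omega> * of_bool (Y t \<omega> = j)) = (LINT \<omega>|M. W \<omega> * indicator {\<omega>'\<in>space M. Y t \<omega>' = j} \<omega>)"
    by (intro Bochner_Integration.integral_cong) (auto simp: indicator_def)
  also have "\<dots> = (LINT \<omega>|M. W \<omega> * real_cond_exp M (F s) (indicator {\<omega>'\<in>space M. Y t \<omega>' = j}) \<omega>)"
    by (rule real_cond_exp_intg(2)[symmetric]) (auto intro!: int W simp: indicator_def)
  also have "\<dots> = (LINT \<omega>|M. W \<omega> * p (t - s) (Y s \<omega>) j)"
    using AEc by (intro integral_cong_AE) (auto simp: measurable_compose[OF _ borel_measurable_count_space])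
  also have "\<dots> = (LINT \<omega>|M. (\<Sum>i\<in>UNIV. p (t - s) i j * (W \<omega> * of_bool (Y s \<omega> = i))))"
    by (intro Bochner_Integration.integral_cong) (auto simp: of_bool_def if_distrib if_distribR sum.delta cong: if_cong)
  also have "\<dots> = (\<Sum>i\<in>UNIV. (LINT \<omega>|M. p (t - s) i j * (W \<omega> * of_bool (Y s \<omega> = i))))"
    by (intro Bochner_Integration.integral_sum integrable_mult_right int) auto
  finally show ?thesis by simp
qed

lemma AE_start: "AE \<omega> in M. Y 0 \<omega> = x"
  using chain unfolding markov_chain_with_def by auto

lemma prob_Y: "0 \<le> t \<Longrightarrow> (LINT \<omega>|M. of_bool (Y t \<omega> = j)) = p t x j"
proof -
  assume t: "0 \<le> t"
  have [measurable]: "Y 0 \<in> measurable M (count_space UNIV)" by (rule Y_measurable) simp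
  have "(LINT \<omega>|M. of_bool (Y 0 \<omega> = i)) = (LINT \<omega>|M. (of_bool (x = i) :: real))" for i
    using AE_start by (intro integral_cong_AE) (auto simp: measurable_compose[OF _ borel_measurable_count_space])
  then have "(LINT \<omega>|M. of_bool (Y 0 \<omega> = i)) = (of_bool (x = i) :: real)" for i
    by (simp add: prob_space)
  then show ?thesis using markov_property[of "\<lambda>_. 1" 0 1 t j] t by simp
qed

text \<open>Times are approximated from the right by grid points; by right-continuity in a discrete
  space the values agree eventually. Clamping times to \<open>[0, T]\<close> keeps the construction
  inside \<open>F T\<close>.\<close>

lemma Y_jointly_measurable:
  assumes T: "0 \<le> T"
  shows "(\<lambda>(s::real, \<omega>). f (Y (max 0 (min T s)) \<omega>) :: real) \<in> borel_measurable (borel \<Otimes>\<^sub>M F T)"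
proof (rule borel_measurable_LIMSEQ_real)
  \<comment> \<open>With \<open>k\<close> the integer part of \<open>Suc n * c\<close>, the
    \<open>+ 1\<close> puts the grid point strictly to the right of \<open>c\<close>, by at most
    \<open>1 / Suc n\<close>. If \<open>c = T\<close>, clamping returns it to
    \<open>T\<close>.\<close>
  define g where "g n k = max 0 (min T ((real_of_int k + 1) / real (Suc n)))" for n k
  define u where "u n = (\<lambda>z. f (Y (g n \<lfloor>real (Suc n) * max 0 (min T (fst z))\<rfloor>) (snd z)))" for n :: nat and z :: "real \<times> 'a"
  show "u n \<in> borel_measurable (borel \<Otimes>\<^sub>M F T)" for n
    unfolding u_def
  proof (rule measurable_compose_countable[where f = "\<lambda>k z. f (Y (g n k) (snd z))"])
    show "(\<lambda>z. f (Y (g n k) (snd z))) \<in> borel_measurable (borel \<Otimes>\<^sub>M F T)" for k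
    proof -
      have "Y (g n k) \<in> measurable (F T) (count_space UNIV)" using T by (intro Y_adapted) (auto simp: g_def)
      then have "(\<lambda>z. Y (g n k) (snd z)) \<in> measurable (borel \<Otimes>\<^sub>M F T) (count_space UNIV)"
        by (rule measurable_compose[OF measurable_snd])
      then show ?thesis by (rule measurable_compose) simp
    qed
  qed measurable
  fix z :: "real \<times> 'a" assume z: "z \<in> space (borel \<Otimes>\<^sub>M F T)"
  obtain s \<omega> where zs: "z = (s, \<omega>)" by (cases z)
  have \<omega>: "\<omega> \<in> space M" using z by (simp add: zs space_pair_measure space_F)
  define c where "c = max 0 (min T s)"
  have c: "0 \<le> c" "c \<le> T" using T by (auto simp: c_def)
  have "\<forall>\<^sub>F r in at_right c. Y r \<omega> = Y c \<omega>"
    using Y_path[OF \<omega>] c(1) unfolding jump_path_on_def by simp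
  then obtain b where b: "b > c" "\<And>r. c < r \<Longrightarrow> r < b \<Longrightarrow> Y r \<omega> = Y c \<omega>"
    unfolding eventually_at_right_field by auto
  have "\<forall>\<^sub>F n in sequentially. inverse (real (Suc n)) < b - c"
    using LIMSEQ_inverse_real_of_nat b(1) by (intro order_tendstoD(2)[of _ 0]) auto
  then have "\<forall>\<^sub>F n in sequentially. u n z = f (Y c \<omega>)"
  proof eventually_elim
    case (elim n)
    let ?q = "(real_of_int \<lfloor>real (Suc n) * c\<rfloor> + 1) / real (Suc n)"
    have 1: "c < ?q" by (simp add: pos_less_divide_eq mult.commute)
    have "real_of_int \<lfloor>real (Suc n) * c\<rfloor> + 1 \<le> real (Suc n) * c + 1" by simp
    then have "?q \<le> (real (Suc n) * c + 1) / real (Suc n)" by (intro divide_right_mono) auto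
    also have "\<dots> = c + inverse (real (Suc n))" by (simp add: add_divide_distrib inverse_eq_divide del: of_nat_Suc)
    finally have 2: "?q < b" using elim by linarith
    have "max 0 (min T ?q) = c \<or> (c < max 0 (min T ?q) \<and> max 0 (min T ?q) < b)" using 1 2 c by auto
    then have "Y (max 0 (min T ?q)) \<omega> = Y c \<omega>" using b(2) by auto
    then show ?case by (simp add: u_def g_def zs c_def[symmetric])
  qed
  then show "(\<lambda>n. u n z) \<longlonglongrightarrow> (case z of (s, \<omega>) \<Rightarrow> f (Y (max 0 (min T s)) \<omega>))"
    unfolding zs prod.case c_def[symmetric] by (rule tendsto_eventually)
qed

lemma Y_functional_jointly_measurable:
  assumes T: "0 \<le> T" and \<phi>: "\<And>j. (\<lambda>r. \<phi> (max 0 (min T r)) j) \<in> borel_measurable borel"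
  shows "(\<lambda>(s, \<omega>). \<phi> (max 0 (min T s)) (Y (max 0 (min T s)) \<omega>) :: real) \<in> borel_measurable (borel \<Otimes>\<^sub>M F T)"
proof -
  note [measurable] = \<phi> Y_jointly_measurable[OF T, of "\<lambda>i. of_bool (i = j)" for j, unfolded case_prod_beta]
  have "(\<lambda>z. \<Sum>j\<in>UNIV. \<phi> (max 0 (min T (fst z))) j * of_bool (Y (max 0 (min T (fst z))) (snd z) = j)) \<in> borel_measurable (borel \<Otimes>\<^sub>M F T)"
    by (intro borel_measurable_sum borel_measurable_times measurable_compose[OF measurable_fst \<phi>] Y_jointly_measurable[OF T, of "\<lambda>i. of_bool (i = j)" for j, unfolded case_prod_beta])
  also have "(\<lambda>z. \<Sum>j\<in>UNIV. \<phi> (max 0 (min T (fst z))) j * of_bool (Y (max 0 (min T (fst z))) (snd z) = j)) =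
     (\<lambda>(s, \<omega>). \<phi> (max 0 (min T s)) (Y (max 0 (min T s)) \<omega>))"
    by (auto simp: fun_eq_iff of_bool_def if_distrib sum.delta cong: if_cong)
  finally show ?thesis .
qed

lemma measurable_lborel_M:
  assumes "f \<in> borel_measurable (borel \<Otimes>\<^sub>M F T)"
  shows "f \<in> borel_measurable (lborel \<Otimes>\<^sub>M M)"
proof -
  have "(\<lambda>\<omega>. \<omega>) \<in> measurable M (F T)"
    using sets_F_subset space_F by (auto simp: measurable_def Int_absorb2 dest: sets.sets_into_space)
  then have "(\<lambda>z. (fst z, snd z)) \<in> measurable (lborel \<Otimes>\<^sub>M M) (borel \<Otimes>\<^sub>M F T)"
    by (intro measurable_Pair measurable_compose[OF measurable_snd]) auto
  from measurable_compose[OF this assms] show ?thesis by simp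
qed

end

section \<open>The Feynman-Kac kernel\<close>

text \<open>Gronwall's inequality for the squared norm \<open>N\<close>: bounded coefficients give
  \<open>N' \<le> 2 n a N\<close>, so \<open>N\<close> times \<open>exp (- 2 n a t)\<close> is
  nonincreasing; it is nonnegative and starts at 0.\<close>

lemma linear_ode_zero:
  fixes d :: "real \<Rightarrow> 'k::finite \<Rightarrow> real" and A :: "real \<Rightarrow> 'k \<Rightarrow> 'k \<Rightarrow> real"
  assumes deriv: "\<And>t j. t \<in> {s..T} \<Longrightarrow> ((\<lambda>t. d t j) has_real_derivative (\<Sum>i\<in>UNIV. A t i j * d t i)) (at t within {s..T})"
    and bd: "\<And>t i j. t \<in> {s..T} \<Longrightarrow> \<bar>A t i j\<bar> \<le> a"
    and init: "\<And>j. d s j = 0" and t: "t \<in> {s..T}"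
  shows "d t j = 0"
proof -
  define n where "n = real CARD('k)"
  define N where "N t = (\<Sum>j\<in>UNIV. (d t j)\<^sup>2)" for t
  define N' where "N' t = (\<Sum>j\<in>UNIV. 2 * d t j * (\<Sum>i\<in>UNIV. A t i j * d t i))" for t
  have a: "0 \<le> a" using bd[OF t, of undefined undefined] by linarith
  have N_deriv: "(N has_real_derivative N' t) (at t within {s..T})" if "t \<in> {s..T}" for t
    unfolding N_def N'_def
    by (rule derivative_eq_intros deriv[OF that] refl | simp add: mult_ac)+
  have N'_le: "N' t \<le> 2 * n * a * N t" if t: "t \<in> {s..T}" for t
  proof -
    have "N' t = (\<Sum>j\<in>UNIV. \<Sum>i\<in>UNIV. A t i j * (2 * (d t j * d t i)))"
      by (simp add: N'_def sum_distrib_left mult_ac)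
    also have "\<dots> \<le> (\<Sum>j\<in>UNIV. \<Sum>i\<in>UNIV. a * ((d t j)\<^sup>2 + (d t i)\<^sup>2))"
    proof (intro sum_mono)
      fix i j
      have "A t i j * (2 * (d t j * d t i)) \<le> \<bar>A t i j\<bar> * \<bar>2 * (d t j * d t i)\<bar>"
        by (metis abs_ge_self abs_mult)
      also have "\<dots> \<le> a * ((d t j)\<^sup>2 + (d t i)\<^sup>2)"
      proof (rule mult_mono[OF bd[OF t]])
        have "\<bar>2 * (d t j * d t i)\<bar> = 2 * \<bar>d t j\<bar> * \<bar>d t i\<bar>" by (simp add: abs_mult)
        also have "\<dots> \<le> \<bar>d t j\<bar>\<^sup>2 + \<bar>d t i\<bar>\<^sup>2" by (rule sum_squares_bound)
        finally show "\<bar>2 * (d t j * d t i)\<bar> \<le> (d t j)\<^sup>2 + (d t i)\<^sup>2" by simp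
      qed (use a in auto)
      finally show "A t i j * (2 * (d t j * d t i)) \<le> a * ((d t j)\<^sup>2 + (d t i)\<^sup>2)" .
    qed
    also have "\<dots> = 2 * n * a * N t"
      by (simp add: sum.distrib N_def n_def flip: sum_distrib_left)
    finally show ?thesis .
  qed
  define Z where "Z t = N t * exp (- (2 * n * a) * t)" for t
  have "Z t \<le> Z s"
  proof (rule DERIV_nonpos_imp_decreasing_open[of s t])
    show "s \<le> t" using t by auto
    show "\<exists>y. (Z has_real_derivative y) (at r) \<and> y \<le> 0" if r: "s < r" "r < t" for r
    proof (intro exI conjI)
      have "(N has_real_derivative N' r) (at r within {s..T})" using r t by (intro N_deriv) auto
      then have "(N has_real_derivative N' r) (at r)"
        using r t at_within_interior[of r "{s..T}"] by auto
      then show "(Z has_real_derivative (N' r - (2 * n * a) * N r) * exp (- (2 * n * a) * r)) (at r)"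
        unfolding Z_def by (auto intro!: derivative_eq_intros simp: algebra_simps)
      show "(N' r - (2 * n * a) * N r) * exp (- (2 * n * a) * r) \<le> 0"
        using N'_le[of r] r t by (intro mult_nonpos_nonneg) auto
    qed
    have "continuous_on {s..T} N"
      by (rule DERIV_continuous_on) (rule N_deriv)
    then have "continuous_on {s..t} N" by (rule continuous_on_subset) (use t in auto)
    then show "continuous_on {s..t} Z" unfolding Z_def by (intro continuous_intros)
  qed
  moreover have "Z s = 0" by (simp add: Z_def N_def init)
  moreover have "0 \<le> N t" by (simp add: N_def sum_nonneg)
  ultimately have "N t = 0" by (simp add: Z_def mult_le_0_iff)
  then show ?thesis by (simp add: N_def sum_nonneg_eq_0_iff)
qed

definition kac :: "(real \<Rightarrow> 'k \<Rightarrow> real) \<Rightarrow> (real \<Rightarrow> 'a \<Rightarrow> 'k) \<Rightarrow> real \<Rightarrow> real \<Rightarrow> 'a \<Rightarrow> real" where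
  "kac c Y s t \<omega> = exp (- (LINT r:{s..t}|lborel. c r (Y r \<omega>)))"

text \<open>The factor \<open>W\<close> stands for the past up to time \<open>s\<close>. Keeping it
  arbitrary makes one differential equation in \<open>t\<close> serve both for the kernel, where
  \<open>W\<close> is constant, and for the weighted chain restricted to a past event.\<close>

definition kac_expect ::
  "'a measure \<Rightarrow> (real \<Rightarrow> 'k \<Rightarrow> real) \<Rightarrow> (real \<Rightarrow> 'a \<Rightarrow> 'k) \<Rightarrow> ('a \<Rightarrow> real) \<Rightarrow> real \<Rightarrow> real \<Rightarrow> 'k \<Rightarrow> real" where
  "kac_expect M c Y W s t j = (LINT \<omega>|M. W \<omega> * of_bool (Y t \<omega> = j) * kac c Y s t \<omega>)"

context jump_chain
begin

context
  fixes c :: "real \<Rightarrow> 'k \<Rightarrow> real" and T C :: real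
  assumes T: "0 \<le> T" and c_cont: "\<And>j. continuous_on {0..T} (\<lambda>r. c r j)"
    and c_bound: "\<And>r j. 0 \<le> r \<Longrightarrow> r \<le> T \<Longrightarrow> \<bar>c r j\<bar> \<le> C"
begin

lemma C_nonneg: "0 \<le> C"
  using c_bound[of 0 x] T by auto

lemma c_clamped_measurable: "0 \<le> T' \<Longrightarrow> T' \<le> T \<Longrightarrow> (\<lambda>r. c (max 0 (min T' r)) j) \<in> borel_measurable borel"
proof (intro borel_measurable_continuous_onI)
  assume "0 \<le> T'" "T' \<le> T"
  then show "continuous_on UNIV (\<lambda>r. c (max 0 (min T' r)) j)"
    by (intro continuous_on_compose2[OF c_cont[of j]] continuous_intros) auto
qed

lemma c_along_path_jointly_measurable:
  assumes "0 \<le> T'" "T' \<le> T"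
  shows "(\<lambda>(r, \<omega>). c (max 0 (min T' r)) (Y (max 0 (min T' r)) \<omega>)) \<in> borel_measurable (borel \<Otimes>\<^sub>M F T')"
  using assms by (intro Y_functional_jointly_measurable c_clamped_measurable)

lemma c_along_path_integrable:
  assumes "\<omega> \<in> space M" "0 \<le> s" "t \<le> T"
  shows "set_integrable lborel {s..t} (\<lambda>r. c r (Y r \<omega>))"
  unfolding set_integrable_def
proof (rule integrableI_bounded_set[where A = "{s..t}" and B = C])
  have "(\<lambda>r. c (max 0 (min T r)) (Y (max 0 (min T r)) \<omega>)) \<in> borel_measurable borel"
    using measurable_compose[OF measurable_Pair2'[of \<omega> "F T" borel] c_along_path_jointly_measurable[OF T order_refl]]
      assms space_F by simp
  then have "(\<lambda>r. indicator {s..t} r *\<^sub>R c (max 0 (min T r)) (Y (max 0 (min T r)) \<omega>)) \<in> borel_measurable borel"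
    by measurable
  also have "(\<lambda>r. indicator {s..t} r *\<^sub>R c (max 0 (min T r)) (Y (max 0 (min T r)) \<omega>)) =
      (\<lambda>r. indicator {s..t} r *\<^sub>R c r (Y r \<omega>))"
  proof
    fix r
    have "max 0 (min T r) = r" if "r \<in> {s..t}" using assms that by auto
    then show "indicator {s..t} r *\<^sub>R c (max 0 (min T r)) (Y (max 0 (min T r)) \<omega>) = indicator {s..t} r *\<^sub>R c r (Y r \<omega>)"
      by (cases "r \<in> {s..t}") auto
  qed
  finally show "(\<lambda>r. indicator {s..t} r *\<^sub>R c r (Y r \<omega>)) \<in> borel_measurable lborel" by simp
qed (use assms c_bound in \<open>auto simp: emeasure_lborel_Icc_eq indicator_def\<close>)

lemma kac_pos: "0 < kac c Y s t \<omega>"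
  by (simp add: kac_def)

lemma kac_bounds:
  assumes "\<omega> \<in> space M" "0 \<le> s" "s \<le> t" "t \<le> T"
  shows "exp (- C * (t - s)) \<le> kac c Y s t \<omega>" "kac c Y s t \<omega> \<le> exp (C * (t - s))"
proof -
  have "set_integrable lborel {s..s + (t - s)} (\<lambda>r. c r (Y r \<omega>))"
    using c_along_path_integrable[of \<omega> s t] assms by simp
  then have "\<bar>(LINT r:{s..s + (t - s)}|lborel. c r (Y r \<omega>)) - (t - s) * 0\<bar> \<le> C * (t - s)"
    by (rule set_integral_average_bound) (use assms c_bound in auto)
  then show "exp (- C * (t - s)) \<le> kac c Y s t \<omega>" "kac c Y s t \<omega> \<le> exp (C * (t - s))"
    by (auto simp: kac_def abs_le_iff)
qed

lemma kac_self: "kac c Y s s \<omega> = 1"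
proof -
  have "integrable lborel (\<lambda>r. indicator {s..s} r *\<^sub>R c r (Y r \<omega>)) \<and> (LINT r|lborel. indicator {s..s} r *\<^sub>R c r (Y r \<omega>)) = 0"
  proof -
    have "(LINT r|lborel. indicator {s..s} r *\<^sub>R c r (Y r \<omega>)) = (LINT r|lborel. indicator {s} r *\<^sub>R c s (Y s \<omega>))"
      by (intro Bochner_Integration.integral_cong) (auto simp: indicator_def)
    moreover have "integrable lborel (\<lambda>r. indicator {s..s} r *\<^sub>R c r (Y r \<omega>)) = integrable lborel (\<lambda>r. indicator {s} r *\<^sub>R c s (Y s \<omega>))"
      by (intro Bochner_Integration.integrable_cong) (auto simp: indicator_def)
    ultimately show ?thesis by auto
  qed
  then show ?thesis by (simp add: kac_def set_lebesgue_integral_def)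
qed

lemma kac_mult:
  assumes "\<omega> \<in> space M" "0 \<le> s" "s \<le> t" "t \<le> u" "u \<le> T"
  shows "kac c Y s u \<omega> = kac c Y s t \<omega> * kac c Y t u \<omega>"
proof -
  have I: "set_integrable lborel {a..b} (\<lambda>r. c r (Y r \<omega>))" if "0 \<le> a" "b \<le> T" for a b
    using that assms by (intro c_along_path_integrable)
  have "integral {s..t} (\<lambda>r. c r (Y r \<omega>)) + integral {t..u} (\<lambda>r. c r (Y r \<omega>)) = integral {s..u} (\<lambda>r. c r (Y r \<omega>))"
    using assms by (intro Henstock_Kurzweil_Integration.integral_combine set_borel_integral_eq_integral(1)[OF I]) auto
  then show ?thesis
    using assms by (simp add: kac_def set_borel_integral_eq_integral(2)[OF I] flip: exp_add)
qed

text \<open>With the endpoint clamped, the exponent is a parameter integral of a function that is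
  jointly measurable over \<open>F T'\<close>. This yields adaptedness of the weight and the
  measurability required for Fubini.\<close>

lemma kac_jointly_measurable:
  assumes "0 \<le> s" "s \<le> T'" "T' \<le> T"
  shows "(\<lambda>(r, \<omega>). kac c Y s (max 0 (min T' r)) \<omega>) \<in> borel_measurable (borel \<Otimes>\<^sub>M F T')"
proof -
  let ?m = "\<lambda>r. max 0 (min T' r)"
  define g where "g z q = (if s \<le> q \<and> q \<le> ?m (fst z) then c (?m q) (Y (?m q) (snd z)) else 0)" for z :: "real \<times> 'a" and q
  have "(\<lambda>w. c (?m (snd w)) (Y (?m (snd w)) (snd (fst w)))) \<in> borel_measurable ((borel \<Otimes>\<^sub>M F T') \<Otimes>\<^sub>M lborel)"
  proof -
    have "(\<lambda>w. (snd w, snd (fst w))) \<in> measurable ((borel \<Otimes>\<^sub>M F T') \<Otimes>\<^sub>M lborel) (borel \<Otimes>\<^sub>M F T')"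
      by (intro measurable_Pair) (auto intro: measurable_compose[OF measurable_snd] measurable_compose[OF measurable_fst])
    from measurable_compose[OF this c_along_path_jointly_measurable[of T']] assms show ?thesis by simp
  qed
  moreover have "{w \<in> space ((borel \<Otimes>\<^sub>M F T') \<Otimes>\<^sub>M lborel). s \<le> snd w \<and> snd w \<le> ?m (fst (fst w))}
      \<in> sets ((borel \<Otimes>\<^sub>M F T') \<Otimes>\<^sub>M lborel)"
  proof -
    have 1: "(\<lambda>w. snd w) \<in> borel_measurable ((borel \<Otimes>\<^sub>M F T') \<Otimes>\<^sub>M lborel)"
      by (rule measurable_compose[OF measurable_snd]) auto
    have 2: "(\<lambda>w. ?m (fst (fst w))) \<in> borel_measurable ((borel \<Otimes>\<^sub>M F T') \<Otimes>\<^sub>M lborel)"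
      by (intro borel_measurable_max borel_measurable_min measurable_compose[OF measurable_fst measurable_fst]) auto
    note [measurable] = 1 2
    show ?thesis by measurable
  qed
  ultimately have "(\<lambda>(z, q). g z q) \<in> borel_measurable ((borel \<Otimes>\<^sub>M F T') \<Otimes>\<^sub>M lborel)"
    unfolding g_def case_prod_beta by (intro measurable_If) auto
  then have "(\<lambda>z. exp (- (LINT q|lborel. g z q))) \<in> borel_measurable (borel \<Otimes>\<^sub>M F T')"
    by (intro borel_measurable_exp[THEN measurable_compose[rotated]] borel_measurable_uminus lborel.borel_measurable_lebesgue_integral)
  also have "(\<lambda>z. exp (- (LINT q|lborel. g z q))) = (\<lambda>(r, \<omega>). kac c Y s (?m r) \<omega>)"
  proof
    fix z :: "real \<times> 'a"
    have "g z q = indicator {s..?m (fst z)} q *\<^sub>R c q (Y q (snd z))" for q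
    proof (cases "q \<in> {s..?m (fst z)}")
      case True
      then have "?m q = q" using assms by auto
      with True show ?thesis by (simp add: g_def)
    qed (auto simp: g_def)
    then show "exp (- (LINT q|lborel. g z q)) = (case z of (r, \<omega>) \<Rightarrow> kac c Y s (?m r) \<omega>)"
      by (simp add: kac_def set_lebesgue_integral_def case_prod_beta)
  qed
  finally show ?thesis .
qed

lemma kac_measurable:
  assumes "0 \<le> s" "s \<le> t" "t \<le> T"
  shows "kac c Y s t \<in> borel_measurable (F t)"
proof -
  have "(\<lambda>\<omega>. (t, \<omega>)) \<in> measurable (F t) (borel \<Otimes>\<^sub>M F t)" by (rule measurable_Pair1') simp
  from measurable_compose[OF this kac_jointly_measurable[of s t]] assms show ?thesis by simp
qed

text \<open>The fundamental theorem of calculus applied to the weight as a function of its endpoint: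
  off the finitely many jump times the potential along the path is continuous, and at the jumps
  continuity of the weight is enough. In the resulting integral the weight stops at
  \<open>r\<close>, so the integrand at \<open>r\<close> is known at time \<open>r\<close>.\<close>

lemma kac_expansion:
  assumes \<omega>: "\<omega> \<in> space M" and st: "0 \<le> s" "s \<le> t" "t \<le> T"
  shows "set_integrable lborel {s..t} (\<lambda>r. c r (Y r \<omega>) * kac c Y s r \<omega>)"
    and "kac c Y s t \<omega> = 1 - (LINT r:{s..t}|lborel. c r (Y r \<omega>) * kac c Y s r \<omega>)"
proof -
  let ?f = "\<lambda>r. c r (Y r \<omega>)"
  define D where "D = {r\<in>{s..t}. \<not> (\<forall>\<^sub>F q in at_left r. Y q \<omega> = Y r \<omega>)}"
  have D: "finite D" unfolding D_def by (rule jump_path_finite_discontinuities[OF Y_path[OF \<omega>] st(1)])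
  have f_int: "?f integrable_on {s..t}" using c_along_path_integrable[OF \<omega> st(1,3)] by (rule set_borel_integral_eq_integral)
  define G where "G r = exp (- integral {s..r} ?f)" for r
  have kac_G: "kac c Y s r \<omega> = G r" if "r \<le> t" for r
    using c_along_path_integrable[OF \<omega> st(1), of r] that st
    by (simp add: kac_def G_def set_borel_integral_eq_integral(2))
  have contI: "continuous_on {s..t} (\<lambda>r. integral {s..r} ?f)"
    by (rule indefinite_integral_continuous_1[OF f_int])
  have "((\<lambda>r. ?f r * G r) has_integral ((- G t) - (- G s))) {s..t}"
  proof (rule fundamental_theorem_of_calculus_interior_strong[OF D st(2)])
    show "continuous_on {s..t} (\<lambda>r. - G r)" unfolding G_def by (intro continuous_intros contI)
    fix r assume r: "r \<in> {s<..<t} - D"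
    have "\<forall>\<^sub>F q in at_left r. Y q \<omega> = Y r \<omega>" using r unfolding D_def by simp
    moreover have "\<forall>\<^sub>F q in at_right r. Y q \<omega> = Y r \<omega>"
      using Y_path[OF \<omega>] r st unfolding jump_path_on_def by simp
    ultimately have ev: "\<forall>\<^sub>F q in at r. Y q \<omega> = Y r \<omega>" by (simp add: eventually_at_split)
    have "isCont (\<lambda>q. c q (Y r \<omega>)) r"
      using c_cont[of "Y r \<omega>"] r st by (intro continuous_on_interior[of "{0..T}"]) auto
    then have "(?f \<longlongrightarrow> ?f r) (at r)"
      unfolding isCont_def by (rule tendsto_cong[THEN iffD1, rotated]) (use ev in eventually_elim, simp)
    then have "continuous (at r within {s..t}) ?f"
      unfolding continuous_within by (rule tendsto_within_subset) auto
    then have "((\<lambda>u. integral {s..u} ?f) has_vector_derivative ?f r) (at r within {s..t})"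
      using integral_has_vector_derivative_continuous_at[OF f_int, of r "{}"] r by auto
    then have "((\<lambda>u. integral {s..u} ?f) has_real_derivative ?f r) (at r)"
      using r at_within_interior[of r "{s..t}"] by (simp add: has_real_derivative_iff_has_vector_derivative)
    then have "((\<lambda>r. - G r) has_real_derivative ?f r * G r) (at r)"
      unfolding G_def by (auto intro!: derivative_eq_intros)
    then show "((\<lambda>r. - G r) has_vector_derivative ?f r * G r) (at r)"
      by (simp add: has_real_derivative_iff_has_vector_derivative)
  qed
  moreover have "G s = 1" by (simp add: G_def)
  ultimately have HI: "((\<lambda>r. ?f r * kac c Y s r \<omega>) has_integral (1 - kac c Y s t \<omega>)) {s..t}"
    using kac_G st by (subst has_integral_cong[where g = "\<lambda>r. ?f r * G r"]) auto
  show int: "set_integrable lborel {s..t} (\<lambda>r. ?f r * kac c Y s r \<omega>)"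
  proof (rule set_integrable_bound)
    show "set_integrable lborel {s..t} (\<lambda>r. C * exp (C * (t - s)))"
      unfolding set_integrable_def by (intro integrable_scaleR_left integrable_real_indicator) (auto simp: emeasure_lborel_Icc_eq)
    have "continuous_on {s..t} G" unfolding G_def by (intro continuous_intros contI)
    then have G: "set_borel_measurable borel {s..t} G"
      unfolding set_borel_measurable_def by (intro borel_measurable_continuous_on_indicator) auto
    have "(\<lambda>r. (indicator {s..t} r *\<^sub>R ?f r) * (indicator {s..t} r *\<^sub>R G r)) \<in> borel_measurable lborel"
      using c_along_path_integrable[OF \<omega> st(1,3)] G unfolding set_integrable_def set_borel_measurable_def
      by (intro borel_measurable_times) auto
    also have "(\<lambda>r. (indicator {s..t} r *\<^sub>R ?f r) * (indicator {s..t} r *\<^sub>R G r)) =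
        (\<lambda>r. indicator {s..t} r *\<^sub>R (?f r * kac c Y s r \<omega>))"
      by (auto simp: fun_eq_iff indicator_def kac_G)
    finally show "set_borel_measurable lborel {s..t} (\<lambda>r. ?f r * kac c Y s r \<omega>)"
      by (simp add: set_borel_measurable_def)
    show "AE r in lborel. r \<in> {s..t} \<longrightarrow> norm (?f r * kac c Y s r \<omega>) \<le> norm (C * exp (C * (t - s)))"
    proof (intro AE_I2 impI)
      fix r assume r: "r \<in> {s..t}"
      have "kac c Y s r \<omega> \<le> exp (C * (r - s))" using r st by (intro kac_bounds \<omega>) auto
      also have "\<dots> \<le> exp (C * (t - s))" using r C_nonneg by (auto intro!: mult_left_mono)
      finally have "\<bar>?f r\<bar> * \<bar>kac c Y s r \<omega>\<bar> \<le> C * exp (C * (t - s))"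
        using r st c_bound[of r] kac_pos[of s r \<omega>] C_nonneg by (intro mult_mono) auto
      then show "norm (?f r * kac c Y s r \<omega>) \<le> norm (C * exp (C * (t - s)))"
        using C_nonneg by (simp add: abs_mult)
    qed
  qed
  show "kac c Y s t \<omega> = 1 - (LINT r:{s..t}|lborel. ?f r * kac c Y s r \<omega>)"
    using HI integral_unique[OF HI] by (simp add: set_borel_integral_eq_integral(2)[OF int])
qed


lemma kac_weight_bound:
  assumes bd: "\<And>\<omega>. \<omega> \<in> space M \<Longrightarrow> \<bar>W \<omega>\<bar> \<le> B" and st: "0 \<le> s" "s \<le> t" "t \<le> T" and \<omega>: "\<omega> \<in> space M"
  shows "\<bar>W \<omega> * of_bool Q * kac c Y s t \<omega>\<bar> \<le> B * exp (C * (t - s))"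
proof -
  have "0 \<le> B" using bd[OF \<omega>] by linarith
  moreover have "\<bar>W \<omega> * of_bool Q\<bar> \<le> \<bar>W \<omega>\<bar>" by auto
  ultimately have "\<bar>W \<omega> * of_bool Q\<bar> * \<bar>kac c Y s t \<omega>\<bar> \<le> B * exp (C * (t - s))"
    using bd[OF \<omega>] kac_bounds[OF \<omega> st] kac_pos[of s t \<omega>] by (intro mult_mono) auto
  then show ?thesis by (simp add: abs_mult)
qed

text \<open>Insert the expansion of the weight, exchange expectation and time integral, and apply
  the Markov property at time \<open>r\<close> to the factor already determined by
  \<open>F r\<close>.\<close>

lemma kac_duhamel:
  assumes W: "W \<in> borel_measurable (F s)" and bd: "\<And>\<omega>. \<omega> \<in> space M \<Longrightarrow> \<bar>W \<omega>\<bar> \<le> B"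
    and st: "0 \<le> s" "s \<le> t" "t \<le> T"
  shows "kac_expect M c Y W s t j =
    (\<Sum>i\<in>UNIV. p (t - s) i j * kac_expect M c Y W s s i) -
    (LINT r:{s..t}|lborel. \<Sum>i\<in>UNIV. p (t - r) i j * (c r i * kac_expect M c Y W s r i))"
proof -
  have WM[measurable]: "W \<in> borel_measurable M" using W by (rule measurable_F)
  have Yt: "Y t \<in> measurable M (count_space UNIV)" using st by (intro Y_measurable) auto
  have Ytj[measurable]: "(\<lambda>\<omega>. of_bool (Y t \<omega> = j) :: real) \<in> borel_measurable M"
    by (rule measurable_compose[OF Yt]) simp
  have B: "0 \<le> B" using bd not_empty by (meson abs_ge_zero all_not_in_conv order_trans)
  let ?f = "\<lambda>r \<omega>. c r (Y r \<omega>) * kac c Y s r \<omega>"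
  let ?V = "\<lambda>\<omega>. W \<omega> * of_bool (Y t \<omega> = j)"
  define D where "D = B * (C * exp (C * (t - s)))"
  have f_bd: "\<bar>?f r \<omega>\<bar> \<le> C * exp (C * (t - s))" if "r \<in> {s..t}" "\<omega> \<in> space M" for r \<omega>
  proof -
    have "kac c Y s r \<omega> \<le> exp (C * (r - s))" using that st by (intro kac_bounds) auto
    also have "\<dots> \<le> exp (C * (t - s))" using that C_nonneg by (auto intro!: mult_left_mono)
    finally have "\<bar>c r (Y r \<omega>)\<bar> * \<bar>kac c Y s r \<omega>\<bar> \<le> C * exp (C * (t - s))"
      using that st c_bound[of r] kac_pos[of s r \<omega>] C_nonneg by (intro mult_mono) auto
    then show ?thesis by (simp add: abs_mult)
  qed
  have V_bd: "\<bar>?V \<omega>\<bar> \<le> B" if "\<omega> \<in> space M" for \<omega>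
    using bd[OF that] B by (auto simp: of_bool_def)
  have EM: "emeasure (lborel \<Otimes>\<^sub>M M) ({s..t} \<times> space M) = emeasure lborel {s..t} * emeasure M (space M)"
    by (rule emeasure_pair_measure_Times) auto
  interpret pair_sigma_finite lborel M ..
  have joint: "(\<lambda>(r, \<omega>). indicator {s..t} r *\<^sub>R (?V \<omega> * ?f r \<omega>)) \<in> borel_measurable (lborel \<Otimes>\<^sub>M M)"
  proof -
    have "(\<lambda>z. case z of (r, \<omega>) \<Rightarrow> c (max 0 (min t r)) (Y (max 0 (min t r)) \<omega>)) \<in> borel_measurable (lborel \<Otimes>\<^sub>M M)"
      "(\<lambda>z. case z of (r, \<omega>) \<Rightarrow> kac c Y s (max 0 (min t r)) \<omega>) \<in> borel_measurable (lborel \<Otimes>\<^sub>M M)"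
      using st by (intro measurable_lborel_M[of _ t] c_along_path_jointly_measurable kac_jointly_measurable; simp)+
    moreover have "(\<lambda>z. indicator {s..t} (fst z) :: real) \<in> borel_measurable (lborel \<Otimes>\<^sub>M M)"
      by (rule measurable_compose[OF measurable_fst]) simp
    moreover have "(\<lambda>z. W (snd z)) \<in> borel_measurable (lborel \<Otimes>\<^sub>M M)"
      "(\<lambda>z. of_bool (Y t (snd z) = j) :: real) \<in> borel_measurable (lborel \<Otimes>\<^sub>M M)"
      using measurable_compose[OF measurable_snd WM] measurable_compose[OF measurable_snd Ytj] by auto
    ultimately have "(\<lambda>z. indicator {s..t} (fst z) * (?V (snd z) * ((case z of (r, \<omega>) \<Rightarrow> c (max 0 (min t r)) (Y (max 0 (min t r)) \<omega>)) *
      (case z of (r, \<omega>) \<Rightarrow> kac c Y s (max 0 (min t r)) \<omega>)))) \<in> borel_measurable (lborel \<Otimes>\<^sub>M M)"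
      by (intro borel_measurable_times)
    also have "(\<lambda>z. indicator {s..t} (fst z) * (?V (snd z) * ((case z of (r, \<omega>) \<Rightarrow> c (max 0 (min t r)) (Y (max 0 (min t r)) \<omega>)) *
      (case z of (r, \<omega>) \<Rightarrow> kac c Y s (max 0 (min t r)) \<omega>)))) = (\<lambda>(r, \<omega>). indicator {s..t} r *\<^sub>R (?V \<omega> * ?f r \<omega>))"
      using st by (auto simp: fun_eq_iff indicator_def max_def min_def)
    finally show ?thesis .
  qed
  have int: "integrable (lborel \<Otimes>\<^sub>M M) (\<lambda>(r, \<omega>). indicator {s..t} r *\<^sub>R (?V \<omega> * ?f r \<omega>))"
  proof (rule integrableI_bounded_set[where A = "{s..t} \<times> space M" and B = D])
    show "{s..t} \<times> space M \<in> sets (lborel \<Otimes>\<^sub>M M)" by (intro pair_measureI) auto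
    show "emeasure (lborel \<Otimes>\<^sub>M M) ({s..t} \<times> space M) < \<infinity>"
      using st unfolding EM by (simp add: emeasure_space_1)
    show "AE z\<in>{s..t} \<times> space M in lborel \<Otimes>\<^sub>M M. norm (case z of (r, \<omega>) \<Rightarrow> indicator {s..t} r *\<^sub>R (?V \<omega> * ?f r \<omega>)) \<le> D"
    proof (intro AE_I2 impI, clarify)
      fix r \<omega> assume r: "r \<in> {s..t}" and \<omega>: "\<omega> \<in> space M"
      have "\<bar>?V \<omega>\<bar> * \<bar>?f r \<omega>\<bar> \<le> D"
        unfolding D_def using B C_nonneg by (intro mult_mono f_bd[OF r \<omega>] V_bd[OF \<omega>]) auto
      then show "norm (indicator {s..t} r *\<^sub>R (?V \<omega> * ?f r \<omega>)) \<le> D"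
        using r by (simp add: abs_mult)
    qed
  next
    show "AE z in lborel \<Otimes>\<^sub>M M. z \<notin> {s..t} \<times> space M \<longrightarrow> (case z of (r, \<omega>) \<Rightarrow> indicator {s..t} r *\<^sub>R (?V \<omega> * ?f r \<omega>)) = 0"
      by (rule AE_I2) (auto simp: space_pair_measure indicator_def)
  qed (rule joint)
  have int0: "integrable M (\<lambda>\<omega>. ?V \<omega>)"
    by (rule integrable_const_bound[where B = B]) (use V_bd in auto)
  have int1: "integrable M (\<lambda>\<omega>. LINT r|lborel. indicator {s..t} r *\<^sub>R (?V \<omega> * ?f r \<omega>))"
    using integrable_snd[OF int] by simp
  \<comment> \<open>Apart from the indicator of \<open>Y t = j\<close>, every factor is
    \<open>F r\<close>-measurable.\<close>
  have inner: "(LINT \<omega>|M. ?V \<omega> * ?f r \<omega>) = (\<Sum>i\<in>UNIV. p (t - r) i j * (c r i * kac_expect M c Y W s r i))"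
    if r: "r \<in> {s..t}" for r
  proof -
    have meas: "(\<lambda>\<omega>. W \<omega> * ?f r \<omega>) \<in> borel_measurable (F r)"
    proof (intro borel_measurable_times)
      show "W \<in> borel_measurable (F r)" using r W by (auto intro: measurable_F_mono)
      show "(\<lambda>\<omega>. c r (Y r \<omega>)) \<in> borel_measurable (F r)"
        using r st by (intro measurable_compose[OF Y_adapted]) auto
      show "kac c Y s r \<in> borel_measurable (F r)" using r st by (intro kac_measurable) auto
    qed
    have bd': "\<bar>W \<omega> * ?f r \<omega>\<bar> \<le> D" if "\<omega> \<in> space M" for \<omega>
    proof -
      have "\<bar>W \<omega>\<bar> * \<bar>?f r \<omega>\<bar> \<le> D"
        unfolding D_def using B C_nonneg by (intro mult_mono f_bd[OF r that] bd that) auto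
      then show ?thesis by (simp add: abs_mult)
    qed
    have "(LINT \<omega>|M. ?V \<omega> * ?f r \<omega>) = (LINT \<omega>|M. (W \<omega> * ?f r \<omega>) * of_bool (Y t \<omega> = j))"
      by (simp add: mult_ac)
    also have "\<dots> = (\<Sum>i\<in>UNIV. p (t - r) i j * (LINT \<omega>|M. W \<omega> * ?f r \<omega> * of_bool (Y r \<omega> = i)))"
      using r st by (intro markov_property[OF meas bd']) auto
    also have "\<dots> = (\<Sum>i\<in>UNIV. p (t - r) i j * (c r i * kac_expect M c Y W s r i))"
    proof (intro sum.cong refl arg_cong2[where f = "(*)"])
      fix i
      have "(LINT \<omega>|M. W \<omega> * ?f r \<omega> * of_bool (Y r \<omega> = i)) = (LINT \<omega>|M. c r i * (W \<omega> * of_bool (Y r \<omega> = i) * kac c Y s r \<omega>))"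
        by (intro Bochner_Integration.integral_cong) auto
      then show "(LINT \<omega>|M. W \<omega> * ?f r \<omega> * of_bool (Y r \<omega> = i)) = c r i * kac_expect M c Y W s r i"
        by (simp add: kac_expect_def)
    qed
    finally show ?thesis .
  qed
  have "kac_expect M c Y W s t j = (LINT \<omega>|M. ?V \<omega> - (LINT r|lborel. indicator {s..t} r *\<^sub>R (?V \<omega> * ?f r \<omega>)))"
    unfolding kac_expect_def
  proof (intro Bochner_Integration.integral_cong refl)
    fix \<omega> assume \<omega>: "\<omega> \<in> space M"
    have "(LINT r|lborel. indicator {s..t} r *\<^sub>R (?V \<omega> * ?f r \<omega>)) = (LINT r|lborel. ?V \<omega> * (indicator {s..t} r *\<^sub>R ?f r \<omega>))"
      by (intro Bochner_Integration.integral_cong) auto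
    also have "\<dots> = ?V \<omega> * (LINT r:{s..t}|lborel. ?f r \<omega>)"
      unfolding set_lebesgue_integral_def by (rule integral_mult_right_zero)
    finally show "?V \<omega> * kac c Y s t \<omega> = ?V \<omega> - (LINT r|lborel. indicator {s..t} r *\<^sub>R (?V \<omega> * ?f r \<omega>))"
      by (simp only: kac_expansion(2)[OF \<omega> st] right_diff_distrib mult_1_right)
  qed
  also have "\<dots> = (LINT \<omega>|M. ?V \<omega>) - (LINT \<omega>|M. (LINT r|lborel. indicator {s..t} r *\<^sub>R (?V \<omega> * ?f r \<omega>)))"
    by (rule Bochner_Integration.integral_diff[OF int0 int1])
  also have "(LINT \<omega>|M. (LINT r|lborel. indicator {s..t} r *\<^sub>R (?V \<omega> * ?f r \<omega>))) =
      (LINT r|lborel. (LINT \<omega>|M. indicator {s..t} r *\<^sub>R (?V \<omega> * ?f r \<omega>)))"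
    by (rule Fubini_integral[OF int])
  also have "\<dots> = (LINT r:{s..t}|lborel. \<Sum>i\<in>UNIV. p (t - r) i j * (c r i * kac_expect M c Y W s r i))"
    unfolding set_lebesgue_integral_def using inner
    by (intro Bochner_Integration.integral_cong) (auto simp: indicator_def)
  also have "(LINT \<omega>|M. ?V \<omega>) = (\<Sum>i\<in>UNIV. p (t - s) i j * kac_expect M c Y W s s i)"
    using markov_property[OF W bd st(1,2)] by (simp add: kac_expect_def kac_self)
  finally show ?thesis .
qed

text \<open>The expectation is taken against the law at the endpoint, so the transposed kernel
  applies and the equation is a forward equation.\<close>

lemma kac_expect_has_derivative:
  assumes W: "W \<in> borel_measurable (F s)" and bd: "\<And>\<omega>. \<omega> \<in> space M \<Longrightarrow> \<bar>W \<omega>\<bar> \<le> B"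
    and s: "0 \<le> s" and t: "t \<in> {s..T}"
  shows "((\<lambda>t. kac_expect M c Y W s t j) has_real_derivative
    ((\<Sum>i\<in>UNIV. L $ i $ j * kac_expect M c Y W s t i) - c t j * kac_expect M c Y W s t j)) (at t within {s..T})"
proof -
  let ?u = "kac_expect M c Y W s"
  have WM[measurable]: "W \<in> borel_measurable M" using W by (rule measurable_F)
  have B: "0 \<le> B" using bd not_empty by (meson abs_ge_zero all_not_in_conv order_trans)
  define B' where "B' = B * exp (C * (T - s))"
  have B': "0 \<le> B'" using B by (simp add: B'_def)
  have exp_le: "exp (C * (t - s)) \<le> exp (C * (T - s))" if "t \<le> T" for t
    using that C_nonneg by (auto intro!: mult_left_mono)
  have u_bd: "\<bar>?u t i\<bar> \<le> B'" if t: "s \<le> t" "t \<le> T" for t i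
  proof -
    have "norm (?u t i) \<le> (LINT \<omega>|M. B')"
      unfolding kac_expect_def
    proof (rule order_trans[OF integral_norm_bound Bochner_Integration.integral_mono])
      have Yt: "Y t \<in> measurable M (count_space UNIV)" using s t by (intro Y_measurable) auto
      have [measurable]: "(\<lambda>\<omega>. of_bool (Y t \<omega> = i) :: real) \<in> borel_measurable M"
        by (rule measurable_compose[OF Yt]) simp
      have [measurable]: "kac c Y s t \<in> borel_measurable M"
        using kac_measurable[OF s t] by (rule measurable_F)
      have b: "norm (W \<omega> * of_bool (Y t \<omega> = i) * kac c Y s t \<omega>) \<le> B'" if "\<omega> \<in> space M" for \<omega>
        using kac_weight_bound[where W = W and Q = "Y t \<omega> = i", OF bd s t that] mult_left_mono[OF exp_le[OF t(2)] B]
        by (simp add: B'_def)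
      show "integrable M (\<lambda>\<omega>. norm (W \<omega> * of_bool (Y t \<omega> = i) * kac c Y s t \<omega>))"
        by (intro integrable_norm, rule integrable_const_bound[where B = B']) (use b in auto)
      show "norm (W \<omega> * of_bool (Y t \<omega> = i) * kac c Y s t \<omega>) \<le> B'" if "\<omega> \<in> space M" for \<omega>
        using b that .
    qed simp
    then show ?thesis by (simp add: prob_space)
  qed
  have g_bd: "\<bar>c t i * ?u t i\<bar> \<le> C * B'" if t: "s \<le> t" "t \<le> T" for t i
    unfolding abs_mult using t s C_nonneg by (intro mult_mono u_bd c_bound) auto
  have u_meas: "(\<lambda>r. ?u (max 0 (min T r)) i) \<in> borel_measurable borel" if "s \<le> T" for i
    unfolding kac_expect_def
  proof (rule borel_measurable_lebesgue_integral, unfold case_prod_beta, intro borel_measurable_times)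
    have idM: "(\<lambda>z. (fst z, snd z)) \<in> measurable (borel \<Otimes>\<^sub>M M) (lborel \<Otimes>\<^sub>M M)"
      by (intro measurable_Pair) (auto intro: measurable_compose[OF measurable_snd])
    show "(\<lambda>z. W (snd z)) \<in> borel_measurable (borel \<Otimes>\<^sub>M M)" by measurable
    show "(\<lambda>z. of_bool (Y (max 0 (min T (fst z))) (snd z) = i) :: real) \<in> borel_measurable (borel \<Otimes>\<^sub>M M)"
      using measurable_compose[OF idM measurable_lborel_M[OF Y_jointly_measurable[OF T, of "\<lambda>k. of_bool (k = i)"]]] by simp
    show "(\<lambda>z. kac c Y s (max 0 (min T (fst z))) (snd z)) \<in> borel_measurable (borel \<Otimes>\<^sub>M M)"
      using measurable_compose[OF idM measurable_lborel_M[OF kac_jointly_measurable[OF s that order_refl]]] by simp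
  qed
  have g_meas: "set_borel_measurable borel {s..T} (\<lambda>r. c r i * ?u r i)" for i
  proof (cases "s \<le> T")
    case True
    have "(\<lambda>r. indicator {s..T} r *\<^sub>R (c (max 0 (min T r)) i * ?u (max 0 (min T r)) i)) \<in> borel_measurable borel"
      using u_meas[OF True, of i] c_clamped_measurable[OF T order_refl, of i] by measurable
    also have "(\<lambda>r. indicator {s..T} r *\<^sub>R (c (max 0 (min T r)) i * ?u (max 0 (min T r)) i)) =
        (\<lambda>r. indicator {s..T} r *\<^sub>R (c r i * ?u r i))"
      using s by (auto simp: fun_eq_iff indicator_def max_def min_def)
    finally show ?thesis by (simp add: set_borel_measurable_def)
  qed (simp add: set_borel_measurable_def)
  have duh: "?u (t + h) i = (\<Sum>j\<in>UNIV. p h j i * ?u t j) -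
      (LINT r:{t..t+h}|lborel. \<Sum>j\<in>UNIV. p (t + h - r) j i * (c r j * ?u r j))"
    if th: "s \<le> t" "0 \<le> h" "t + h \<le> T" for t h i
  proof -
    \<comment> \<open>Duhamel's formula starts at the time up to which the past is known. To start
      it at \<open>t\<close>, the weight collected on \<open>[s, t]\<close> is absorbed into the
      past factor.\<close>
    define W' where "W' = (\<lambda>\<omega>. W \<omega> * kac c Y s t \<omega>)"
    have W': "W' \<in> borel_measurable (F t)"
      unfolding W'_def using th s W kac_measurable[of s t] by (intro borel_measurable_times) (auto intro: measurable_F_mono)
    have bd': "\<bar>W' \<omega>\<bar> \<le> B * exp (C * (t - s))" if "\<omega> \<in> space M" for \<omega>
      using kac_weight_bound[where W = W and Q = True, OF bd s th(1) _ that] th by (simp add: W'_def)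
    have eq: "kac_expect M c Y W' t r i = ?u r i" if "t \<le> r" "r \<le> T" for r i
      unfolding kac_expect_def using that th s
      by (intro Bochner_Integration.integral_cong) (auto simp: W'_def kac_mult[of _ s t r] mult_ac)
    have "?u (t + h) i = kac_expect M c Y W' t (t + h) i" using th by (intro eq[symmetric]) auto
    also have "\<dots> = (\<Sum>j\<in>UNIV. p (t + h - t) j i * kac_expect M c Y W' t t j) -
      (LINT r:{t..t+h}|lborel. \<Sum>j\<in>UNIV. p (t + h - r) j i * (c r j * kac_expect M c Y W' t r j))"
      using th s by (intro kac_duhamel[OF W' bd']) auto
    also have "(LINT r:{t..t+h}|lborel. \<Sum>j\<in>UNIV. p (t + h - r) j i * (c r j * kac_expect M c Y W' t r j)) =
      (LINT r:{t..t+h}|lborel. \<Sum>j\<in>UNIV. p (t + h - r) j i * (c r j * ?u r j))"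
      unfolding set_lebesgue_integral_def using th eq
      by (intro Bochner_Integration.integral_cong) (auto simp: indicator_def)
    finally show ?thesis using eq[of t] th by simp
  qed
  have cont: "continuous_on {s..T} (\<lambda>t. ?u t i)" for i
    by (rule kernel_at_zero.duhamel_continuous[OF forward_kernel u_bd g_bd g_meas duh])
  have cc: "continuous_on {s..T} (\<lambda>t. c t i)" for i
    using c_cont[of i] by (rule continuous_on_subset) (use s in auto)
  show ?thesis
    by (rule kernel_at_zero.duhamel_has_derivative[OF forward_kernel u_bd g_bd g_meas duh _ t])
      (assumption | intro continuous_intros cont cc)+
qed

end

end

section \<open>Feynman-Kac kernels: bounds, composition and harmonic functions\<close>

text \<open>Under \<open>P i\<close> the chain starts at \<open>i\<close> at time 0, so the
  potential is shifted by \<open>s\<close> instead of starting the chain at time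
  \<open>s\<close>.\<close>

definition kac_kernel ::
  "('k \<Rightarrow> 'a measure) \<Rightarrow> (real \<Rightarrow> 'k \<Rightarrow> real) \<Rightarrow> (real \<Rightarrow> 'a \<Rightarrow> 'k) \<Rightarrow> real \<Rightarrow> real \<Rightarrow> 'k \<Rightarrow> 'k \<Rightarrow> real" where
  "kac_kernel P c Y s t i j = kac_expect (P i) (\<lambda>r. c (s + r)) Y (\<lambda>_. 1) 0 (t - s) j"

locale jump_chains =
  fixes p :: "real \<Rightarrow> 'k::finite \<Rightarrow> 'k \<Rightarrow> real" and L :: "real^'k^'k"
    and P :: "'k \<Rightarrow> 'a measure" and Y :: "real \<Rightarrow> 'a \<Rightarrow> 'k"
  assumes chains: "jump_chain p L (P i) Y i"
begin

sublocale chain: jump_chain p L "P i" Y i for i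
  by (rule chains)

context
  fixes c :: "real \<Rightarrow> 'k \<Rightarrow> real" and T C :: real
  assumes T: "0 \<le> T" and c_cont: "\<And>j. continuous_on {0..T} (\<lambda>r. c r j)"
    and c_bound: "\<And>r j. 0 \<le> r \<Longrightarrow> r \<le> T \<Longrightarrow> \<bar>c r j\<bar> \<le> C"
begin

lemma shifted_cont: "0 \<le> s \<Longrightarrow> continuous_on {0..T - s} (\<lambda>r. c (s + r) j)"
  by (intro continuous_on_compose2[OF c_cont[of j]] continuous_intros) auto

lemma shifted_bound: "0 \<le> s \<Longrightarrow> 0 \<le> r \<Longrightarrow> r \<le> T - s \<Longrightarrow> \<bar>c (s + r) j\<bar> \<le> C"
  by (rule c_bound) auto

lemma kac_kernel_has_derivative:
  assumes s: "0 \<le> s" and t: "t \<in> {s..T}"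
  shows "((\<lambda>t. kac_kernel P c Y s t i j) has_real_derivative
    ((\<Sum>k\<in>UNIV. L $ k $ j * kac_kernel P c Y s t i k) - c t j * kac_kernel P c Y s t i j)) (at t within {s..T})"
proof -
  let ?f = "\<lambda>t. kac_expect (P i) (\<lambda>r. c (s + r)) Y (\<lambda>_. 1) 0 t"
  have img: "(\<lambda>t. t - s) ` {s..T} = {0..T - s}"
    by simp
  have "((\<lambda>t. ?f t j) has_real_derivative
    ((\<Sum>k\<in>UNIV. L $ k $ j * ?f (t - s) k) - c (s + (t - s)) j * ?f (t - s) j)) (at (t - s) within {0..T - s})"
    using s t shifted_cont[OF s] shifted_bound[OF s]
    by (intro chain.kac_expect_has_derivative[where C = C and B = 1]) auto
  then have "((\<lambda>t. ?f t j) \<circ> (\<lambda>t. t - s) has_real_derivative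
    ((\<Sum>k\<in>UNIV. L $ k $ j * ?f (t - s) k) - c (s + (t - s)) j * ?f (t - s) j) * 1) (at t within {s..T})"
    unfolding img[symmetric] by (rule DERIV_image_chain) (auto intro!: derivative_eq_intros)
  then show ?thesis by (simp add: kac_kernel_def o_def)
qed

lemma kac_kernel_self:
  assumes "0 \<le> s" "s \<le> T"
  shows "kac_kernel P c Y s s i j = of_bool (i = j)"
proof -
  have "kac (\<lambda>r. c (s + r)) Y 0 0 \<omega> = 1" for \<omega>
    using assms by (intro chain.kac_self[of "T - s" _ C, OF _ shifted_cont shifted_bound]) auto
  then have "kac_kernel P c Y s s i j = (LINT \<omega>|P i. of_bool (Y 0 \<omega> = j))"
    by (simp add: kac_kernel_def kac_expect_def)
  also have "\<dots> = p 0 i j" by (rule chain.prob_Y) simp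
  finally show ?thesis by (simp only: chain.p_zero)
qed

lemma kac_kernel_nonneg: "0 \<le> kac_kernel P c Y s t i j"
  unfolding kac_kernel_def kac_expect_def
  by (rule Bochner_Integration.integral_nonneg) (simp add: kac_def)

text \<open>For short durations the weight is close to 1, so these bounds give the kernel the same
  off-diagonal rates as \<open>p\<close>.\<close>

lemma kac_kernel_bounds:
  assumes st: "0 \<le> s" "s \<le> t" "t \<le> T"
  shows "p (t - s) i j * exp (- C * (t - s)) \<le> kac_kernel P c Y s t i j"
    and "kac_kernel P c Y s t i j \<le> p (t - s) i j * exp (C * (t - s))"
proof -
  let ?K = "kac (\<lambda>r. c (s + r)) Y 0 (t - s)"
  have b: "exp (- C * (t - s)) \<le> ?K \<omega>" "?K \<omega> \<le> exp (C * (t - s))" if "\<omega> \<in> space (P i)" for \<omega>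
    using chain.kac_bounds[of "T - s" "\<lambda>r. c (s + r)" C \<omega> i 0 "t - s", OF _ shifted_cont shifted_bound] that st by auto
  have Yt: "Y (t - s) \<in> measurable (P i) (count_space UNIV)" using st by (intro chain.Y_measurable) auto
  have [measurable]: "(\<lambda>\<omega>. of_bool (Y (t - s) \<omega> = j) :: real) \<in> borel_measurable (P i)"
    by (rule measurable_compose[OF Yt]) simp
  have [measurable]: "?K \<in> borel_measurable (P i)"
    using st by (intro chain.measurable_F[OF chain.kac_measurable[of "T - s" _ C], OF _ shifted_cont shifted_bound]) auto
  have I1: "integrable (P i) (\<lambda>\<omega>. of_bool (Y (t - s) \<omega> = j) :: real)"
    by (rule chain.integrable_const_bound[where B = 1]) auto
  have I2: "integrable (P i) (\<lambda>\<omega>. of_bool (Y (t - s) \<omega> = j) * ?K \<omega>)"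
  proof (rule chain.integrable_const_bound[where B = "exp (C * (t - s))"])
    show "AE \<omega> in P i. norm (of_bool (Y (t - s) \<omega> = j) * ?K \<omega>) \<le> exp (C * (t - s))"
      using b by (auto simp: kac_def)
  qed measurable
  have "p (t - s) i j * exp (- C * (t - s)) = (LINT \<omega>|P i. of_bool (Y (t - s) \<omega> = j) * exp (- C * (t - s)))"
    using chain.prob_Y[of "t - s" i j] st by simp
  also have "\<dots> \<le> (LINT \<omega>|P i. of_bool (Y (t - s) \<omega> = j) * ?K \<omega>)"
    by (intro Bochner_Integration.integral_mono integrable_mult_left I1 I2) (use b in auto)
  finally show "p (t - s) i j * exp (- C * (t - s)) \<le> kac_kernel P c Y s t i j"
    by (simp add: kac_kernel_def kac_expect_def)
  have "(LINT \<omega>|P i. of_bool (Y (t - s) \<omega> = j) * ?K \<omega>) \<le> (LINT \<omega>|P i. of_bool (Y (t - s) \<omega> = j) * exp (C * (t - s)))"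
    by (intro Bochner_Integration.integral_mono integrable_mult_left I1 I2) (use b in auto)
  also have "\<dots> = p (t - s) i j * exp (C * (t - s))"
    using chain.prob_Y[of "t - s" i j] st by simp
  finally show "kac_kernel P c Y s t i j \<le> p (t - s) i j * exp (C * (t - s))"
    by (simp add: kac_kernel_def kac_expect_def)
qed

text \<open>The assumed Markov property concerns the position at one later time, not functionals
  such as \<open>kac\<close>. Comparing two solutions of a linear equation with equal initial values
  avoids extending it to path functionals.\<close>

lemma kac_expect_markov:
  assumes W: "W \<in> borel_measurable (natural_filt (space (P x)) Y (count_space UNIV) s)"
    and bd: "\<And>\<omega>. \<omega> \<in> space (P x) \<Longrightarrow> \<bar>W \<omega>\<bar> \<le> B"
    and st: "0 \<le> s" "s \<le> t" "t \<le> T"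
  shows "kac_expect (P x) c Y W s t j = (\<Sum>i\<in>UNIV. kac_expect (P x) c Y W s s i * kac_kernel P c Y s t i j)"
proof -
  define m where "m = kac_expect (P x) c Y W s"
  define U where "U = kac_kernel P c Y s"
  define d where "d t j = m t j - (\<Sum>k\<in>UNIV. m s k * U t k j)" for t j
  define A where "A t i j = L $ i $ j - of_bool (i = j) * c t j" for t i j
  define a where "a = (\<Sum>i\<in>UNIV. \<Sum>j\<in>UNIV. \<bar>L $ i $ j\<bar>) + C"
  have A_sum: "(\<Sum>i\<in>UNIV. A t i j * f i) = (\<Sum>i\<in>UNIV. L $ i $ j * f i) - c t j * f j" for t j and f :: "'k \<Rightarrow> real"
    by (simp add: A_def left_diff_distrib sum_subtractf mult.assoc)
  have "d t j = 0"
  proof (rule linear_ode_zero[where d = d and j = j and t = t and s = s and T = T and A = A and a = a])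
    fix t j assume t: "t \<in> {s..T}"
    have 1: "((\<lambda>t. m t j) has_real_derivative (\<Sum>i\<in>UNIV. A t i j * m t i)) (at t within {s..T})" for j
      unfolding A_sum m_def using t st
      by (intro chain.kac_expect_has_derivative[OF T c_cont c_bound W bd]) auto
    have 2: "((\<lambda>t. U t k j) has_real_derivative (\<Sum>i\<in>UNIV. A t i j * U t k i)) (at t within {s..T})" for k j
      unfolding A_sum U_def using t st by (intro kac_kernel_has_derivative) auto
    have "((\<lambda>t. d t j) has_real_derivative (\<Sum>i\<in>UNIV. A t i j * m t i) - (\<Sum>k\<in>UNIV. m s k * (\<Sum>i\<in>UNIV. A t i j * U t k i))) (at t within {s..T})"
      unfolding d_def by (intro DERIV_diff 1 DERIV_sum DERIV_cmult 2)
    also have "(\<Sum>i\<in>UNIV. A t i j * m t i) - (\<Sum>k\<in>UNIV. m s k * (\<Sum>i\<in>UNIV. A t i j * U t k i)) = (\<Sum>i\<in>UNIV. A t i j * d t i)"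
    proof -
      have "(\<Sum>k\<in>UNIV. m s k * (\<Sum>i\<in>UNIV. A t i j * U t k i)) = (\<Sum>k\<in>UNIV. \<Sum>i\<in>UNIV. A t i j * (m s k * U t k i))"
        by (simp add: sum_distrib_left mult_ac)
      also have "\<dots> = (\<Sum>i\<in>UNIV. A t i j * (\<Sum>k\<in>UNIV. m s k * U t k i))"
        by (subst sum.swap) (simp add: sum_distrib_left)
      finally show ?thesis by (simp add: d_def right_diff_distrib sum_subtractf)
    qed
    finally show "((\<lambda>t. d t j) has_real_derivative (\<Sum>i\<in>UNIV. A t i j * d t i)) (at t within {s..T})" .
  next
    fix t i j assume t: "t \<in> {s..T}"
    have "\<bar>L $ i $ j\<bar> \<le> (\<Sum>j\<in>UNIV. \<bar>L $ i $ j\<bar>)" by (rule member_le_sum) auto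
    also have "\<dots> \<le> (\<Sum>i\<in>UNIV. \<Sum>j\<in>UNIV. \<bar>L $ i $ j\<bar>)"
      by (rule member_le_sum[of i UNIV "\<lambda>i. \<Sum>j\<in>UNIV. \<bar>L $ i $ j\<bar>"]) (auto intro: sum_nonneg)
    finally have 1: "\<bar>L $ i $ j\<bar> \<le> (\<Sum>i\<in>UNIV. \<Sum>j\<in>UNIV. \<bar>L $ i $ j\<bar>)" .
    have "\<bar>of_bool (i = j) * c t j\<bar> \<le> \<bar>c t j\<bar>" by auto
    also have "\<dots> \<le> C" using t st by (intro c_bound) auto
    finally show "\<bar>A t i j\<bar> \<le> a" unfolding A_def a_def using 1 by linarith
  next
    fix j show "d s j = 0"
      using kac_kernel_self[of s] st T by (simp add: d_def U_def)
  qed (use st in auto)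
  then show ?thesis by (simp add: d_def m_def U_def)
qed

text \<open>The backward equation of \<open>\<theta>\<close> is adjoint to the forward equation of
  the kernel in its endpoint, so the derivative of their pairing vanishes.\<close>

lemma kac_kernel_harmonic:
  assumes \<theta>: "\<And>t i. t \<in> {0..T} \<Longrightarrow> ((\<lambda>t. \<theta> t i) has_real_derivative
      - ((\<Sum>j\<in>UNIV. L $ i $ j * \<theta> t j) - c t i * \<theta> t i)) (at t within {0..T})"
    and st: "0 \<le> s" "s \<le> t" "t \<le> T"
  shows "(\<Sum>j\<in>UNIV. kac_kernel P c Y s t i j * \<theta> t j) = \<theta> s i"
proof -
  define U where "U t = kac_kernel P c Y s t i" for t
  have "((\<lambda>t. \<Sum>j\<in>UNIV. U t j * \<theta> t j) has_real_derivative 0) (at t within {s..T})" if t: "t \<in> {s..T}" for t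
  proof -
    have 1: "((\<lambda>t. U t j) has_real_derivative ((\<Sum>k\<in>UNIV. L $ k $ j * U t k) - c t j * U t j)) (at t within {s..T})" for j
      unfolding U_def using t st by (intro kac_kernel_has_derivative) auto
    have 2: "((\<lambda>t. \<theta> t j) has_real_derivative
      - ((\<Sum>l\<in>UNIV. L $ j $ l * \<theta> t l) - c t j * \<theta> t j)) (at t within {s..T})" for j
      using \<theta>[of t j] t st by (auto intro: DERIV_subset)
    have "((\<lambda>t. \<Sum>j\<in>UNIV. U t j * \<theta> t j) has_real_derivative
      (\<Sum>j\<in>UNIV. ((\<Sum>k\<in>UNIV. L $ k $ j * U t k) - c t j * U t j) * \<theta> t j +
        (- ((\<Sum>l\<in>UNIV. L $ j $ l * \<theta> t l) - c t j * \<theta> t j)) * U t j)) (at t within {s..T})"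
      by (intro DERIV_sum DERIV_mult 1 2)
    also have "(\<Sum>j\<in>UNIV. ((\<Sum>k\<in>UNIV. L $ k $ j * U t k) - c t j * U t j) * \<theta> t j +
        (- ((\<Sum>l\<in>UNIV. L $ j $ l * \<theta> t l) - c t j * \<theta> t j)) * U t j) =
        (\<Sum>j\<in>UNIV. \<Sum>k\<in>UNIV. L $ k $ j * U t k * \<theta> t j) - (\<Sum>j\<in>UNIV. \<Sum>l\<in>UNIV. L $ j $ l * \<theta> t l * U t j)"
    proof -
      have alg: "(a - c' * u) * q + (- (b - c' * q)) * u = a * q - b * u" for a b c' u q :: real
        by (simp add: algebra_simps)
      show ?thesis unfolding alg sum_subtractf sum_distrib_right ..
    qed
    also have "\<dots> = 0"
      by (subst sum.swap) (simp add: mult_ac)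
    finally show ?thesis .
  qed
  then obtain k where k: "\<And>t. t \<in> {s..T} \<Longrightarrow> (\<Sum>j\<in>UNIV. U t j * \<theta> t j) = k"
    using has_field_derivative_zero_constant[of "{s..T}" "\<lambda>t. \<Sum>j\<in>UNIV. U t j * \<theta> t j"] by auto
  have "(\<Sum>j\<in>UNIV. U t j * \<theta> t j) = (\<Sum>j\<in>UNIV. U s j * \<theta> s j)"
    using k[of s] k[of t] st by auto
  also have "\<dots> = \<theta> s i" using kac_kernel_self[of s] st by (simp add: U_def)
  finally show ?thesis by (simp add: U_def)
qed

end

text \<open>The weighted Markov property with the weight on \<open>[s, t]\<close>, shifted to
  \<open>[0, t - s]\<close>, as the past factor.\<close>

lemma kac_kernel_chapman_kolmogorov:
  assumes T: "0 \<le> T" and c_cont: "\<And>j. continuous_on {0..T} (\<lambda>r. c r j)"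
    and c_bound: "\<And>r j. 0 \<le> r \<Longrightarrow> r \<le> T \<Longrightarrow> \<bar>c r j\<bar> \<le> C"
    and st: "0 \<le> s" "s \<le> t" "t \<le> u" "u \<le> T"
  shows "kac_kernel P c Y s u i j = (\<Sum>k\<in>UNIV. kac_kernel P c Y s t i k * kac_kernel P c Y t u k j)"
proof -
  define c' where "c' = (\<lambda>r. c (s + r))"
  define W where "W = kac c' Y 0 (t - s)"
  have T': "0 \<le> T - s" using st by simp
  have c'_cont: "continuous_on {0..T - s} (\<lambda>r. c' r j)" for j
    unfolding c'_def using st by (intro shifted_cont[OF T c_cont c_bound]) auto
  have c'_bound: "\<bar>c' r j\<bar> \<le> C" if "0 \<le> r" "r \<le> T - s" for r j
    unfolding c'_def using st that by (intro c_bound) auto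
  have W: "W \<in> borel_measurable (natural_filt (space (P i)) Y (count_space UNIV) (t - s))"
    unfolding W_def using st by (intro chain.kac_measurable[OF T' c'_cont c'_bound]) auto
  have bd: "\<bar>W \<omega>\<bar> \<le> exp (C * (t - s))" if "\<omega> \<in> space (P i)" for \<omega>
    using chain.kac_bounds(2)[OF T' c'_cont c'_bound that, of 0 "t - s"] st by (simp add: W_def kac_def)
  have E: "kac_expect (P i) c' Y (\<lambda>_. 1) 0 v j = kac_expect (P i) c' Y W (t - s) v j" if "t - s \<le> v" "v \<le> T - s" for v j
    unfolding kac_expect_def W_def
    by (intro Bochner_Integration.integral_cong refl, subst chain.kac_mult[OF T' c'_cont c'_bound, of _ i 0 "t - s" v])
      (use that st in auto)
  have "kac_kernel P c Y s u i j = kac_expect (P i) c' Y W (t - s) (u - s) j"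
    unfolding kac_kernel_def c'_def[symmetric] using st by (intro E) auto
  also have "\<dots> = (\<Sum>k\<in>UNIV. kac_expect (P i) c' Y W (t - s) (t - s) k * kac_kernel P c' Y (t - s) (u - s) k j)"
    using st by (intro kac_expect_markov[OF T' c'_cont c'_bound W bd]) auto
  also have "\<dots> = (\<Sum>k\<in>UNIV. kac_kernel P c Y s t i k * kac_kernel P c Y t u k j)"
  proof (intro sum.cong refl arg_cong2[where f = "(*)"])
    fix k
    show "kac_expect (P i) c' Y W (t - s) (t - s) k = kac_kernel P c Y s t i k"
      unfolding kac_kernel_def c'_def[symmetric] using st by (intro E[symmetric]) auto
    show "kac_kernel P c' Y (t - s) (u - s) k j = kac_kernel P c Y t u k j"
      by (simp add: kac_kernel_def c'_def)
  qed
  finally show ?thesis .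
qed

section \<open>Change of measure\<close>

text \<open>The density is prescribed on the right-continuous filtration. The natural filtration at
  \<open>t\<close> lies in every later one, hence in their intersection, so \<open>Q\<close> is
  determined on it; the Markov property to be proved conditions on nothing larger.\<close>

lemma density_process_measure:
  assumes D: "has_density_process I (P x) Y D Q" and t: "t \<in> I" "0 \<le> t"
    and nn: "\<And>\<omega>. \<omega> \<in> space (P x) \<Longrightarrow> 0 \<le> D t \<omega>"
    and A: "A \<in> sets (natural_filt (space (P x)) Y (count_space UNIV) t)"
  shows "space Q = space (P x)" "A \<in> sets Q" "measure Q A = (LINT \<omega>|P x. indicator A \<omega> * D t \<omega>)"
proof -
  define R where "R = natural_rc_filt (space (P x)) Y t"
  have sub: "subalgebra Q R" and Dm: "D t \<in> borel_measurable R"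
    and dens: "restr_to_subalg Q R = density (restr_to_subalg (P x) R) (\<lambda>\<omega>. ennreal (D t \<omega>))"
    using D t unfolding has_density_process_def R_def Let_def by auto
  let ?G = "\<Inter>s\<in>{t<..}. sets (natural_filt (space (P x)) Y (count_space UNIV) s)"
  \<comment> \<open>A single later time, \<open>t + 1\<close>, suffices to place the
    right-continuous filtration inside the events of \<open>P x\<close>.\<close>
  have "?G \<subseteq> sets (natural_filt (space (P x)) Y (count_space UNIV) (t + 1))"
    by (rule INF_lower) simp
  then have G_sets: "?G \<subseteq> sets (P x)" using chain.sets_F_subset[of x "t + 1"] by (rule order_trans)
  then have G: "?G \<subseteq> Pow (space (P x))" using sets.space_closed by (rule order_trans)
  have setsR: "sets R = sigma_sets (space (P x)) ?G"
    unfolding R_def natural_rc_filt_def using G by (rule sets_measure_of)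
  have spaceR: "space R = space (P x)"
    unfolding R_def natural_rc_filt_def using G by (rule space_measure_of)
  have "sets R \<subseteq> sets (P x)" unfolding setsR using G_sets by (rule sets.sigma_sets_subset)
  then have subP: "subalgebra (P x) R" using spaceR by (simp add: subalgebra_def)
  show "space Q = space (P x)" using sub spaceR by (simp add: subalgebra_def)
  have AR: "A \<in> sets R"
    unfolding setsR
  proof (intro sigma_sets.Basic INT_I)
    fix s assume "s \<in> {t<..}"
    then have "t \<le> s" by simp
    from chain.sets_F_mono[OF this] A show "A \<in> sets (natural_filt (space (P x)) Y (count_space UNIV) s)" by (rule subsetD)
  qed
  then show "A \<in> sets Q" using sub by (auto simp: subalgebra_def)
  have [measurable]: "A \<in> sets (P x)" using AR subP by (auto simp: subalgebra_def)
  have [measurable]: "D t \<in> borel_measurable (P x)" by (rule measurable_from_subalg[OF subP Dm])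
  have "emeasure Q A = emeasure (restr_to_subalg Q R) A"
    by (rule emeasure_restr_to_subalg[OF sub AR, symmetric])
  also have "\<dots> = (\<integral>\<^sup>+ \<omega>. ennreal (D t \<omega>) * indicator A \<omega> \<partial>restr_to_subalg (P x) R)"
    unfolding dens using AR Dm by (intro emeasure_density) (auto simp: sets_restr_to_subalg[OF subP] measurable_in_subalg[OF subP])
  also have "\<dots> = (\<integral>\<^sup>+ \<omega>. ennreal (D t \<omega>) * indicator A \<omega> \<partial>P x)"
    using AR Dm by (intro nn_integral_subalgebra2[OF subP]) auto
  also have "\<dots> = (\<integral>\<^sup>+ \<omega>. ennreal (indicator A \<omega> * D t \<omega>) \<partial>P x)"
    by (intro nn_integral_cong) (auto simp: indicator_def)
  finally show "measure Q A = (LINT \<omega>|P x. indicator A \<omega> * D t \<omega>)"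
    using nn by (subst integral_eq_nn_integral) (auto simp: measure_def intro!: AE_I2)
qed

text \<open>The index set is abstract to cover \<open>[0, h)\<close> and
  \<open>[0, \<infinity>)\<close>. Having no last element, it leaves room to the right of each
  \<open>t\<close> for the rate over \<open>[t, t + e]\<close>.\<close>

theorem doob_transform:
  assumes I: "0 \<in> I" "\<And>t. t \<in> I \<Longrightarrow> 0 \<le> t" "\<And>s t. t \<in> I \<Longrightarrow> 0 \<le> s \<Longrightarrow> s \<le> t \<Longrightarrow> s \<in> I" "\<And>t. t \<in> I \<Longrightarrow> \<exists>u\<in>I. t < u"
    and c_cont: "\<And>j. continuous_on I (\<lambda>r. c r j)"
    and \<theta>_pos: "\<And>t i. t \<in> I \<Longrightarrow> 0 < \<theta> t i"
    and \<theta>: "\<And>T t i. T \<in> I \<Longrightarrow> t \<in> {0..T} \<Longrightarrow> ((\<lambda>t. \<theta> t i) has_real_derivative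
      - ((\<Sum>j\<in>UNIV. L $ i $ j * \<theta> t j) - c t i * \<theta> t i)) (at t within {0..T})"
    and D: "has_density_process I (P x) Y D Q"
    and D_eq: "\<And>t \<omega>. t \<in> I \<Longrightarrow> \<omega> \<in> space (P x) \<Longrightarrow> D t \<omega> = \<theta> t (Y t \<omega>) / \<theta> 0 x * kac c Y 0 t \<omega>"
  shows "markov_chain_with I Q Y x (\<lambda>s t i j. kac_kernel P c Y s t i j * \<theta> t j / \<theta> s i)"
    and "has_transition_rates I (\<lambda>s t i j. kac_kernel P c Y s t i j * \<theta> t j / \<theta> s i)
      (\<lambda>t i j. \<theta> t j / \<theta> t i * L $ i $ j)"
proof -
  let ?q = "\<lambda>s t i j. kac_kernel P c Y s t i j * \<theta> t j / \<theta> s i"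
  let ?F = "natural_filt (space (P x)) Y (count_space UNIV)"
  have sub: "{0..T} \<subseteq> I" if "T \<in> I" for T using I(3)[OF that] by auto
  have c_cont': "continuous_on {0..T} (\<lambda>r. c r j)" if "T \<in> I" for T j
    using c_cont sub[OF that] by (rule continuous_on_subset)
  \<comment> \<open>The potential need not be bounded on all of \<open>I\<close>, for instance near
    a finite horizon, so the bound depends on \<open>T\<close>.\<close>
  have ex_bound: "\<exists>C. \<forall>r j. 0 \<le> r \<longrightarrow> r \<le> T \<longrightarrow> \<bar>c r j\<bar> \<le> C" if "T \<in> I" for T
  proof -
    have "\<exists>C. \<forall>r\<in>{0..T}. \<bar>c r j\<bar> \<le> C" for j
      using compact_imp_bounded[OF compact_continuous_image[OF c_cont'[OF that, of j]]]
      by (auto simp: bounded_iff)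
    then obtain C where C: "\<And>(j::'k) r. r \<in> {0..T} \<Longrightarrow> \<bar>c r j\<bar> \<le> C j" by metis
    have "\<bar>c r j\<bar> \<le> Max (range C)" if "0 \<le> r" "r \<le> T" for r j
      using C[of r j] that by (intro order_trans[OF _ Max_ge[of _ "C j"]]) auto
    then show ?thesis by blast
  qed
  define C where "C T = (SOME C. \<forall>r j. 0 \<le> r \<longrightarrow> r \<le> T \<longrightarrow> \<bar>c r j\<bar> \<le> C)" for T
  have C: "\<bar>c r j\<bar> \<le> C T" if "T \<in> I" "0 \<le> r" "r \<le> T" for T r j
    using someI_ex[OF ex_bound[OF that(1)]] that(2,3) unfolding C_def by blast
  have pQ: "prob_space Q" using D by (simp add: has_density_process_def)
  interpret Q: prob_space Q by (rule pQ)
  have D_nonneg: "0 \<le> D t \<omega>" if "t \<in> I" "\<omega> \<in> space (P x)" for t \<omega>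
    using that \<theta>_pos[OF that(1)] \<theta>_pos[OF I(1)] by (simp add: D_eq kac_def less_imp_le)
  note dens = density_process_measure[OF D _ I(2) D_nonneg]
  have spQ: "space Q = space (P x)" using dens(1)[of 0 "{}"] I(1) by simp
  have setsQ: "sets (?F t) \<subseteq> sets Q" if "t \<in> I" for t using dens(2)[of t] that by auto
  have YQ: "Y t \<in> measurable Q (count_space UNIV)" if "t \<in> I" for t
    using chain.Y_adapted[of t t x] I(2)[OF that] setsQ[OF that] spQ chain.space_F[of x t]
    unfolding measurable_def by auto
  have FQ: "natural_filt (space Q) Y (count_space UNIV) = ?F" by (simp add: spQ)
  have level: "A \<inter> {\<omega> \<in> space (P x). Y t \<omega> = j} \<in> sets (?F t)" if "0 \<le> t" "s \<le> t" "A \<in> sets (?F s)" for A s t j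
  proof -
    have "{\<omega> \<in> space (P x). Y t \<omega> = j} = Y t -` {j} \<inter> space (?F t)"
      by (auto simp: chain.space_F)
    also have "\<dots> \<in> sets (?F t)" using chain.Y_adapted[of t t x] that by (intro measurable_sets) auto
    finally show ?thesis using chain.sets_F_mono[of s t x] that by auto
  qed
  \<comment> \<open>The Markov property under \<open>Q\<close>, tested on an event \<open>A\<close>
    of the past; the conditional expectation is read off from it at the end.\<close>
  have key: "measure Q (A \<inter> {\<omega> \<in> space (P x). Y t \<omega> = j}) =
      (\<Sum>i\<in>UNIV. ?q s t i j * measure Q (A \<inter> {\<omega> \<in> space (P x). Y s \<omega> = i}))"
    if st: "s \<in> I" "t \<in> I" "s \<le> t" and A: "A \<in> sets (?F s)" for s t A j
  proof -
    note ct = I(2)[OF st(2)] c_cont'[OF st(2)] C[OF st(2)]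
    have s0: "0 \<le> s" using I(2) st by auto
    define W where "W \<omega> = indicator A \<omega> * kac c Y 0 s \<omega>" for \<omega>
    have W: "W \<in> borel_measurable (?F s)"
      unfolding W_def using A st s0 by (intro borel_measurable_times borel_measurable_indicator chain.kac_measurable[where c = c, OF ct]) auto
    have bd: "\<bar>W \<omega>\<bar> \<le> exp (C t * (s - 0))" if "\<omega> \<in> space (P x)" for \<omega>
      using chain.kac_bounds(2)[where c = c, OF ct that, of 0 s] st s0 by (auto simp: W_def kac_def indicator_def)
    \<comment> \<open>On \<open>Y u = i\<close> the density is a constant times the weight up to
      \<open>u\<close>, which splits at \<open>s\<close>; the part before \<open>s\<close> and the
      indicator of \<open>A\<close> form \<open>W\<close>.\<close>
    have M: "measure Q (A \<inter> {\<omega> \<in> space (P x). Y u \<omega> = i}) = \<theta> u i / \<theta> 0 x * kac_expect (P x) c Y W s u i"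
      if u: "u \<in> I" "s \<le> u" "u \<le> t" for u i
    proof -
      have "measure Q (A \<inter> {\<omega> \<in> space (P x). Y u \<omega> = i}) =
          (LINT \<omega>|P x. indicator (A \<inter> {\<omega> \<in> space (P x). Y u \<omega> = i}) \<omega> * D u \<omega>)"
        using level[of u s A i] u I(2) A by (intro dens(3)) auto
      also have "\<dots> = (LINT \<omega>|P x. \<theta> u i / \<theta> 0 x * (W \<omega> * of_bool (Y u \<omega> = i) * kac c Y s u \<omega>))"
      proof (intro Bochner_Integration.integral_cong refl)
        fix \<omega> assume \<omega>: "\<omega> \<in> space (P x)"
        show "indicator (A \<inter> {\<omega> \<in> space (P x). Y u \<omega> = i}) \<omega> * D u \<omega> =
            \<theta> u i / \<theta> 0 x * (W \<omega> * of_bool (Y u \<omega> = i) * kac c Y s u \<omega>)"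
          using \<omega> u s0 chain.kac_mult[where c = c, OF ct \<omega>, of 0 s u] by (simp add: D_eq W_def indicator_def)
      qed
      finally show ?thesis by (simp add: kac_expect_def)
    qed
    have "measure Q (A \<inter> {\<omega> \<in> space (P x). Y t \<omega> = j}) =
        \<theta> t j / \<theta> 0 x * (\<Sum>i\<in>UNIV. kac_expect (P x) c Y W s s i * kac_kernel P c Y s t i j)"
      using st s0 M[of t j] kac_expect_markov[where c = c and W = W, OF ct W bd, of t j] by auto
    also have "\<dots> = (\<Sum>i\<in>UNIV. ?q s t i j * (\<theta> s i / \<theta> 0 x * kac_expect (P x) c Y W s s i))"
    proof -
      have "\<theta> s i \<noteq> 0" for i using \<theta>_pos[OF st(1), of i] by simp
      then show ?thesis by (simp add: sum_distrib_left mult_ac)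
    qed
    finally show ?thesis using M[of s] st by simp
  qed
  show "markov_chain_with I Q Y x ?q"
    unfolding markov_chain_with_def FQ
  proof (intro conjI ballI allI impI)
    show "prob_space Q" by (rule pQ)
    show "Y t \<in> measurable Q (count_space UNIV)" if "t \<in> I" for t using that by (rule YQ)
    show "jump_path_on I (\<lambda>t. Y t \<omega>)" if "\<omega> \<in> space Q" for \<omega>
      using chain.Y_path[of \<omega> x] that I(2) unfolding spQ jump_path_on_def by auto
    show "AE \<omega> in Q. Y 0 \<omega> = x"
    proof -
      have S: "{\<omega> \<in> space (P x). Y 0 \<omega> \<noteq> x} = Y 0 -` (- {x}) \<inter> space (?F 0)" by (auto simp: chain.space_F)
      have "Y 0 -` (- {x}) \<inter> space (?F 0) \<in> sets (?F 0)"
        using chain.Y_adapted[of 0 0 x] by (intro measurable_sets) auto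
      then have S': "{\<omega> \<in> space (P x). Y 0 \<omega> \<noteq> x} \<in> sets (?F 0)" by (simp add: S)
      have "measure Q {\<omega> \<in> space (P x). Y 0 \<omega> \<noteq> x} =
          (LINT \<omega>|P x. indicator {\<omega> \<in> space (P x). Y 0 \<omega> \<noteq> x} \<omega> * D 0 \<omega>)"
        using S' I(1) by (intro dens(3)) auto
      also have "\<dots> = 0"
        using chain.AE_start[of x] by (intro integral_eq_zero_AE) (auto simp: indicator_def)
      finally have "emeasure Q {\<omega> \<in> space Q. \<not> (Y 0 \<omega> = x)} = 0"
        by (simp add: Q.emeasure_eq_measure spQ)
      then show ?thesis using S' setsQ[OF I(1)] by (intro AE_I[OF subset_refl]) (auto simp: spQ)
    qed
    show "transition_function I ?q"
      unfolding transition_function_def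
    proof (intro conjI ballI allI impI)
      fix s t i assume st: "s \<in> I" "t \<in> I" "s \<le> t"
      note ct = I(2)[OF st(2)] c_cont'[OF st(2)] C[OF st(2)]
      show "0 \<le> ?q s t i j" for j
        using \<theta>_pos[OF st(1), of i] \<theta>_pos[OF st(2), of j] kac_kernel_nonneg[where c = c, OF ct, of s t i j] by simp
      have "(\<Sum>j\<in>UNIV. kac_kernel P c Y s t i j * \<theta> t j) = \<theta> s i"
        using st I(2) by (intro kac_kernel_harmonic[where c = c, OF ct \<theta>]) auto
      then show "(\<Sum>j\<in>UNIV. ?q s t i j) = 1"
        using \<theta>_pos[OF st(1), of i] by (simp flip: sum_divide_distrib)
    next
      fix s i j assume s: "s \<in> I"
      show "?q s s i j = (if i = j then 1 else 0)"
        using \<theta>_pos[OF s, of i] kac_kernel_self[where c = c, OF I(2)[OF s] c_cont'[OF s] C[OF s], of s i j] I(2)[OF s] by auto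
    next
      fix s t u i j assume st: "s \<in> I" "t \<in> I" "u \<in> I" "s \<le> t \<and> t \<le> u"
      have "\<theta> t k \<noteq> 0" for k using \<theta>_pos[OF st(2), of k] by simp
      moreover have "kac_kernel P c Y s u i j = (\<Sum>k\<in>UNIV. kac_kernel P c Y s t i k * kac_kernel P c Y t u k j)"
        using st I(2) by (intro kac_kernel_chapman_kolmogorov[where c = c, OF I(2)[OF st(3)] c_cont'[OF st(3)] C[OF st(3)]]) auto
      ultimately show "?q s u i j = (\<Sum>k\<in>UNIV. ?q s t i k * ?q t u k j)"
        by (simp add: sum_distrib_right sum_divide_distrib) (simp add: mult_ac)
    qed
    fix s t j assume st: "s \<in> I" "t \<in> I" "s \<le> t"
    have s0: "0 \<le> s" using st I(2) by auto
    have sub: "subalgebra Q (?F s)"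
      using setsQ[OF st(1)] by (simp add: subalgebra_def chain.space_F spQ)
    have sfs: "sigma_finite_subalgebra Q (?F s)"
      by (rule finite_measure_subalgebra_is_sigma_finite)
        (rule finite_measure_subalgebra.intro[OF Q.finite_measure_axioms finite_measure_subalgebra_axioms.intro[OF sub]])
    have Ys: "(\<lambda>\<omega>. ?q s t (Y s \<omega>) j) \<in> borel_measurable (?F s)"
      using measurable_compose[OF chain.Y_adapted[OF s0 order_refl], where g = "\<lambda>i. ?q s t i j" and L = borel] by simp
    have YsQ: "(\<lambda>\<omega>. ?q s t (Y s \<omega>) j) \<in> borel_measurable Q"
      by (rule measurable_from_subalg[OF sub Ys])
    have lev: "{\<omega> \<in> space (P x). Y u \<omega> = i} \<in> sets Q" if "u \<in> I" for u i
    proof -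
      have "space (P x) \<in> sets (?F u)" using sets.top[of "?F u"] by (simp only: chain.space_F)
      then have "space (P x) \<inter> {\<omega> \<in> space (P x). Y u \<omega> = i} \<in> sets (?F u)"
        using I(2)[OF that] by (intro level[of u u]) auto
      then show ?thesis using setsQ[OF that] by (auto simp: Int_def)
    qed
    show "AE \<omega> in Q. real_cond_exp Q (?F s) (indicator {\<omega>'\<in>space Q. Y t \<omega>' = j}) \<omega> = ?q s t (Y s \<omega>) j"
    proof (rule sigma_finite_subalgebra.real_cond_exp_charact[OF sfs])
      fix A assume A: "A \<in> sets (?F s)"
      have AQ: "A \<in> sets Q" using A setsQ[OF st(1)] by auto
      have "(LINT \<omega>:A|Q. indicator {\<omega>'\<in>space Q. Y t \<omega>' = j} \<omega>) = (LINT \<omega>|Q. indicator (A \<inter> {\<omega>\<in>space (P x). Y t \<omega> = j}) \<omega>)"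
        unfolding set_lebesgue_integral_def by (intro Bochner_Integration.integral_cong) (auto simp: indicator_def spQ)
      also have "\<dots> = measure Q (A \<inter> {\<omega>\<in>space (P x). Y t \<omega> = j})"
        using AQ lev[OF st(2)] sets.sets_into_space[OF AQ] by (simp add: Int_absorb2)
      also have "\<dots> = (\<Sum>i\<in>UNIV. ?q s t i j * measure Q (A \<inter> {\<omega> \<in> space (P x). Y s \<omega> = i}))"
        using st A by (intro key)
      also have "\<dots> = (\<Sum>i\<in>UNIV. (LINT \<omega>|Q. ?q s t i j * indicator (A \<inter> {\<omega> \<in> space (P x). Y s \<omega> = i}) \<omega>))"
        using AQ lev[OF st(1)] sets.sets_into_space[OF AQ] by (simp add: Int_absorb2)
      also have "\<dots> = (LINT \<omega>|Q. (\<Sum>i\<in>UNIV. ?q s t i j * indicator (A \<inter> {\<omega> \<in> space (P x). Y s \<omega> = i}) \<omega>))"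
        using AQ lev[OF st(1)]
        by (intro Bochner_Integration.integral_sum[symmetric] integrable_mult_right integrable_real_indicator)
          (auto simp: Q.emeasure_eq_measure)
      also have "\<dots> = (LINT \<omega>:A|Q. ?q s t (Y s \<omega>) j)"
        unfolding set_lebesgue_integral_def
      proof (intro Bochner_Integration.integral_cong refl)
        fix \<omega> assume \<omega>: "\<omega> \<in> space Q"
        have "(\<Sum>i\<in>UNIV. ?q s t i j * indicator (A \<inter> {\<omega> \<in> space (P x). Y s \<omega> = i}) \<omega>) =
            (\<Sum>i\<in>UNIV. if i = Y s \<omega> then indicator A \<omega> * ?q s t i j else 0)"
          using \<omega> by (intro sum.cong) (auto simp: indicator_def spQ)
        then show "(\<Sum>i\<in>UNIV. ?q s t i j * indicator (A \<inter> {\<omega> \<in> space (P x). Y s \<omega> = i}) \<omega>) =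
            indicator A \<omega> *\<^sub>R ?q s t (Y s \<omega>) j" by simp
      qed
      finally show "(LINT \<omega>:A|Q. indicator {\<omega>'\<in>space Q. Y t \<omega>' = j} \<omega>) = (LINT \<omega>:A|Q. ?q s t (Y s \<omega>) j)" .
    next
      show "integrable Q (indicator {\<omega>'\<in>space Q. Y t \<omega>' = j} :: 'a \<Rightarrow> real)"
        using lev[OF st(2)] by (intro integrable_real_indicator) (auto simp: spQ Q.emeasure_eq_measure)
      have "\<bar>?q s t i j\<bar> \<le> (\<Sum>i\<in>UNIV. \<bar>?q s t i j\<bar>)" for i by (rule member_le_sum) auto
      then show "integrable Q (\<lambda>\<omega>. ?q s t (Y s \<omega>) j)"
        using YsQ by (intro Q.integrable_const_bound[where B = "\<Sum>i\<in>UNIV. \<bar>?q s t i j\<bar>"]) auto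
    qed (rule Ys)
  qed
  show "has_transition_rates I ?q (\<lambda>t i j. \<theta> t j / \<theta> t i * L $ i $ j)"
    unfolding has_transition_rates_def
  proof (intro ballI allI impI conjI)
    fix t and i j :: 'k assume t: "t \<in> I" and ij: "i \<noteq> j"
    have t0: "0 \<le> t" using I(2)[OF t] .
    obtain u where u: "u \<in> I" "t < u" using I(4)[OF t] by auto
    note cu = I(2)[OF u(1)] c_cont'[OF u(1)] C[OF u(1)]
    have p_lim: "((\<lambda>e. p e i j / e) \<longlongrightarrow> L $ i $ j) (at_right 0)"
      using chain.p_deriv[of i j] ij by simp
    have lo: "((\<lambda>e. p e i j / e * exp (- C u * e)) \<longlongrightarrow> L $ i $ j * exp (- C u * 0)) (at_right 0)"
      and hi: "((\<lambda>e. p e i j / e * exp (C u * e)) \<longlongrightarrow> L $ i $ j * exp (C u * 0)) (at_right 0)"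
      by (intro tendsto_intros p_lim)+
    have \<theta>_cont: "continuous_on {0..u} (\<lambda>t. \<theta> t k)" for k
      by (rule DERIV_continuous_on) (rule \<theta>[OF u(1)])
    have \<theta>_lim: "((\<lambda>t. \<theta> t k) \<longlongrightarrow> \<theta> t k) (at t within {0..u})" for k
      using \<theta>_cont[of k] t0 u by (auto simp: continuous_on_def)
    \<comment> \<open>The bounds on the kernel depend only on the duration \<open>e\<close>, so the
      start may vary with \<open>e\<close>. The choices \<open>t\<close> and \<open>t - e\<close>
      give the rates on both sides of \<open>t\<close>.\<close>
    have K: "((\<lambda>e. kac_kernel P c Y (a e) (a e + e) i j / e) \<longlongrightarrow> L $ i $ j) (at_right 0)"
      if a: "\<forall>\<^sub>F e in at_right 0. 0 \<le> a e \<and> a e + e \<le> u" for a :: "real \<Rightarrow> real"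
    proof (rule tendsto_sandwich)
      have pos: "\<forall>\<^sub>F e in at_right 0. 0 < (e::real)" by (simp add: eventually_at_right_less)
      show "\<forall>\<^sub>F e in at_right 0. p e i j / e * exp (- C u * e) \<le> kac_kernel P c Y (a e) (a e + e) i j / e"
        using a pos
      proof eventually_elim
        case (elim e)
        then show ?case using kac_kernel_bounds(1)[where c = c, OF cu, of "a e" "a e + e" i j] by (simp add: divide_right_mono)
      qed
      show "\<forall>\<^sub>F e in at_right 0. kac_kernel P c Y (a e) (a e + e) i j / e \<le> p e i j / e * exp (C u * e)"
        using a pos
      proof eventually_elim
        case (elim e)
        then show ?case using kac_kernel_bounds(2)[where c = c, OF cu, of "a e" "a e + e" i j] by (simp add: divide_right_mono)
      qed
    qed (use lo hi in simp_all)
    have small: "\<forall>\<^sub>F e in at_right 0. e < d" if "0 < d" for d :: real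
      using that by (auto simp: eventually_at_right_field)
    have posr: "\<forall>\<^sub>F e in at_right 0. 0 < (e::real)" by (simp add: eventually_at_right_less)
    have nz: "\<theta> t i \<noteq> 0" using \<theta>_pos[OF t, of i] by simp
    show "((\<lambda>e. ?q t (t + e) i j / e) \<longlongrightarrow> \<theta> t j / \<theta> t i * L $ i $ j) (at_right 0)"
    proof -
      have "\<forall>\<^sub>F e in at_right 0. 0 \<le> t \<and> t + e \<le> u"
        using small[of "u - t"] u t0 by (auto elim: eventually_mono)
      then have 1: "((\<lambda>e. kac_kernel P c Y t (t + e) i j / e) \<longlongrightarrow> L $ i $ j) (at_right 0)" by (rule K)
      have "filterlim (\<lambda>e. t + e) (at t within {0..u}) (at_right 0)"
        unfolding filterlim_at
      proof
        show "\<forall>\<^sub>F e in at_right 0. t + e \<in> {0..u} \<and> t + e \<noteq> t"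
          using small[of "u - t", unfolded] u posr t0 by (auto elim: eventually_elim2)
        show "((\<lambda>e. t + e) \<longlongrightarrow> t) (at_right 0)" by (auto intro!: tendsto_eq_intros)
      qed
      then have 2: "((\<lambda>e. \<theta> (t + e) j) \<longlongrightarrow> \<theta> t j) (at_right 0)"
        by (rule filterlim_compose[OF \<theta>_lim])
      have "((\<lambda>e. \<theta> (t + e) j / \<theta> t i * (kac_kernel P c Y t (t + e) i j / e)) \<longlongrightarrow> \<theta> t j / \<theta> t i * L $ i $ j) (at_right 0)"
        by (intro tendsto_intros 1 2 nz)
      then show ?thesis by (simp add: mult_ac)
    qed
    show "((\<lambda>e. ?q (t - e) t i j / e) \<longlongrightarrow> \<theta> t j / \<theta> t i * L $ i $ j) (at_right 0)" if t1: "0 < t"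
    proof -
      have "\<forall>\<^sub>F e in at_right 0. 0 \<le> t - e \<and> t - e + e \<le> u"
        using small[of t] u t1 by (auto elim: eventually_mono)
      then have 1: "((\<lambda>e. kac_kernel P c Y (t - e) t i j / e) \<longlongrightarrow> L $ i $ j) (at_right 0)"
        using K[of "\<lambda>e. t - e"] by simp
      have "filterlim (\<lambda>e. t - e) (at t within {0..u}) (at_right 0)"
        unfolding filterlim_at
      proof
        show "\<forall>\<^sub>F e in at_right 0. t - e \<in> {0..u} \<and> t - e \<noteq> t"
          using small[of t] u posr t1 by (auto elim: eventually_elim2)
        show "((\<lambda>e. t - e) \<longlongrightarrow> t) (at_right 0)" by (auto intro!: tendsto_eq_intros)
      qed
      then have 2: "((\<lambda>e. \<theta> (t - e) i) \<longlongrightarrow> \<theta> t i) (at_right 0)"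
        by (rule filterlim_compose[OF \<theta>_lim])
      have "((\<lambda>e. \<theta> t j / \<theta> (t - e) i * (kac_kernel P c Y (t - e) t i j / e)) \<longlongrightarrow> \<theta> t j / \<theta> t i * L $ i $ j) (at_right 0)"
        by (intro tendsto_intros 1 2 nz)
      then show ?thesis by (simp add: mult_ac)
    qed
  qed
qed

end

section \<open>A common transition function for all starting points\<close>

text \<open>The hypothesis provides a possibly different transition function for each starting
  point. They have the same rates, hence coincide at nonnegative times.\<close>

lemma markov_jump_process_imp_jump_chains:
  fixes L :: "real^'k::finite^'k" and P :: "'k \<Rightarrow> 'a measure" and Y :: "real \<Rightarrow> 'a \<Rightarrow> 'k"
  assumes "generator_matrix L" and mjp: "markov_jump_process L P Y"
  shows "\<exists>p. jump_chains p L P Y"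
proof -
  have "\<forall>x. \<exists>p. jump_chain p L (P x) Y x"
  proof
    fix x
    obtain p where p: "markov_chain_with {0..} (P x) Y x (\<lambda>s t. p (t - s))"
      "has_transition_rates {0..} (\<lambda>s t. p (t - s)) (\<lambda>_ i j. L $ i $ j)"
      using mjp unfolding markov_jump_process_def homogeneous_markov_chain_def by blast
    have "jump_chain p L (P x) Y x"
    proof
      show "transition_function {0..} (\<lambda>s t. p (t - s))"
        using p(1) unfolding markov_chain_with_def by blast
    qed (use assms p in auto)
    then show "\<exists>p. jump_chain p L (P x) Y x" by blast
  qed
  then obtain q where q: "\<And>x. jump_chain (q x) L (P x) Y x" by metis
  have q_semi: "markov_semigroup (q x) L" for x
    using q by (simp add: jump_chain_def)
  \<comment> \<open>Any starting point would do, since all the functions \<open>q x\<close> agree on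
    \<open>[0, \<infinity>)\<close>.\<close>
  define p where "p = q undefined"
  have eq: "q x t = p t" if "0 \<le> t" for x t
    unfolding p_def using markov_semigroup_unique[OF q_semi q_semi that] .
  have "jump_chain p L (P x) Y x" for x
  proof (rule jump_chain.intro)
    show "markov_semigroup p L" unfolding p_def by (rule q_semi)
    then interpret markov_semigroup p L .
    have "markov_chain_with {0..} (P x) Y x (\<lambda>s t. q x (t - s))"
      using q[of x] by (simp add: jump_chain_def jump_chain_axioms_def)
    then show "jump_chain_axioms p (P x) Y x"
      using tf eq[of _ x] unfolding jump_chain_axioms_def markov_chain_with_def by auto
  qed
  then show ?thesis by (intro exI[of _ p] jump_chains.intro)
qed

lemma psi_bound:
  fixes \<alpha> \<beta> :: "'k::finite \<Rightarrow> real"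
  assumes "0 \<le> l" "l \<le> B"
  shows "\<bar>psi \<beta> \<alpha> j l\<bar> \<le> (\<Sum>j\<in>UNIV. \<bar>\<beta> j\<bar> * \<bar>B\<bar> + \<bar>\<alpha> j\<bar> * B\<^sup>2)"
proof -
  have "\<bar>psi \<beta> \<alpha> j l\<bar> \<le> \<bar>\<beta> j\<bar> * \<bar>l\<bar> + \<bar>\<alpha> j\<bar> * l\<^sup>2"
    unfolding psi_def by (rule order_trans[OF abs_triangle_ineq]) (simp add: abs_mult)
  also have "\<dots> \<le> \<bar>\<beta> j\<bar> * \<bar>B\<bar> + \<bar>\<alpha> j\<bar> * B\<^sup>2"
    using assms by (intro add_mono mult_left_mono power_mono) auto
  also have "\<dots> \<le> (\<Sum>j\<in>UNIV. \<bar>\<beta> j\<bar> * \<bar>B\<bar> + \<bar>\<alpha> j\<bar> * B\<^sup>2)" by (rule member_le_sum) auto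
  finally show ?thesis .
qed

lemma mild_solutionD:
  assumes "mild_solution P Y \<beta> \<alpha> f \<phi> u"
  shows "(\<lambda>t. indicator {0..} t *\<^sub>R u t x) \<in> borel_measurable borel"
    and "0 \<le> t \<Longrightarrow> 0 \<le> u t x"
    and "\<exists>B. \<forall>t\<in>{0..T}. \<forall>x. u t x \<le> B"
    and "0 \<le> t \<Longrightarrow> u t x + (LINT \<omega>|P x. (LINT s:{0..t}|lborel. psi \<beta> \<alpha> (Y s \<omega>) (u (t - s) (Y s \<omega>)))) =
        (LINT \<omega>|P x. f (Y t \<omega>) + (LINT s:{0..t}|lborel. \<phi> (Y s \<omega>)))"
proof -
  note * = assms[unfolded mild_solution_def set_borel_measurable_def]
  show "(\<lambda>t. indicator {0..} t *\<^sub>R u t x) \<in> borel_measurable borel"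
    using *[THEN conjunct1] by (rule spec)
  show "0 \<le> t \<Longrightarrow> 0 \<le> u t x"
    using *[THEN conjunct2, THEN conjunct1] by simp
  show "\<exists>B. \<forall>t\<in>{0..T}. \<forall>x. u t x \<le> B"
    using *[THEN conjunct2, THEN conjunct2, THEN conjunct1] by (rule spec)
  show "u t x + (LINT \<omega>|P x. (LINT s:{0..t}|lborel. psi \<beta> \<alpha> (Y s \<omega>) (u (t - s) (Y s \<omega>)))) =
        (LINT \<omega>|P x. f (Y t \<omega>) + (LINT s:{0..t}|lborel. \<phi> (Y s \<omega>)))" if "0 \<le> t"
    using *[THEN conjunct2, THEN conjunct2, THEN conjunct2, rule_format, OF that] .
qed

context jump_chains
begin

section \<open>The cumulant equation\<close>

text \<open>Fubini turns the expectation along paths into the transition function, which eliminates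
  the process from the mild equation.\<close>

lemma mild_solution_duhamel:
  assumes mild: "mild_solution P Y \<beta> \<alpha> (\<lambda>_. \<theta>) (\<lambda>_. 0) u" and t: "0 \<le> t"
  shows "u t i = \<theta> - (LINT r:{0..t}|lborel. \<Sum>j\<in>UNIV. p (t - r) i j * psi \<beta> \<alpha> j (u r j))"
proof -
  define g where "g r j = psi \<beta> \<alpha> j (u r j)" for r j
  obtain B where B: "\<And>r j. r \<in> {0..t} \<Longrightarrow> u r j \<le> B" and nn: "\<And>r j. 0 \<le> r \<Longrightarrow> 0 \<le> u r j"
    using mild_solutionD(2,3)[OF mild] by meson
  define C where "C = (\<Sum>j\<in>UNIV. \<bar>\<beta> j\<bar> * \<bar>B\<bar> + \<bar>\<alpha> j\<bar> * B\<^sup>2)"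
  have g_bd: "\<bar>g r j\<bar> \<le> C" if r: "r \<in> {0..t}" for r j
    unfolding g_def C_def using nn[of r j] B[of r j] r by (intro psi_bound) auto
  have g_meas: "(\<lambda>q. indicator {0..} q * g q j) \<in> borel_measurable borel" for j
  proof -
    have [measurable]: "(\<lambda>q. indicator {0..} q *\<^sub>R u q j) \<in> borel_measurable borel"
      by (rule mild_solutionD(1)[OF mild])
    have "(\<lambda>q. psi \<beta> \<alpha> j (indicator {0..} q *\<^sub>R u q j)) \<in> borel_measurable borel"
      unfolding psi_def by measurable
    also have "(\<lambda>q. psi \<beta> \<alpha> j (indicator {0..} q *\<^sub>R u q j)) = (\<lambda>q. indicator {0..} q * g q j)"
      by (auto simp: g_def psi_def indicator_def)
    finally show ?thesis .
  qed
  let ?m = "\<lambda>s. max 0 (min t s)"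
  have \<phi>: "(\<lambda>s. g (t - ?m s) j) \<in> borel_measurable borel" for j
  proof -
    have "(\<lambda>s. indicator {0..} (t - ?m s) * g (t - ?m s) j) \<in> borel_measurable borel"
      by (rule measurable_compose[OF _ g_meas]) simp
    then show ?thesis using t by simp
  qed
  have joint: "(\<lambda>(s, \<omega>). g (t - ?m s) (Y (?m s) \<omega>)) \<in> borel_measurable (lborel \<Otimes>\<^sub>M P i)"
    by (rule chain.measurable_lborel_M[OF chain.Y_functional_jointly_measurable[OF t, where \<phi> = "\<lambda>s. g (t - s)", OF \<phi>]])
  have EM: "emeasure (lborel \<Otimes>\<^sub>M P i) ({0..t} \<times> space (P i)) = emeasure lborel {0..t} * emeasure (P i) (space (P i))"
    by (rule chain.emeasure_pair_measure_Times) auto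
  interpret pair_sigma_finite lborel "P i" ..
  have int: "integrable (lborel \<Otimes>\<^sub>M P i) (\<lambda>(s, \<omega>). indicator {0..t} s *\<^sub>R g (t - s) (Y s \<omega>))"
  proof (rule integrableI_bounded_set[where A = "{0..t} \<times> space (P i)" and B = C])
    have "(\<lambda>z. indicator {0..t} (fst z) * (case z of (s, \<omega>) \<Rightarrow> g (t - ?m s) (Y (?m s) \<omega>))) \<in> borel_measurable (lborel \<Otimes>\<^sub>M P i)"
      by (intro borel_measurable_times joint measurable_compose[OF measurable_fst]) auto
    also have "(\<lambda>z. indicator {0..t} (fst z) * (case z of (s, \<omega>) \<Rightarrow> g (t - ?m s) (Y (?m s) \<omega>))) =
        (\<lambda>(s, \<omega>). indicator {0..t} s *\<^sub>R g (t - s) (Y s \<omega>))"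
      by (auto simp: fun_eq_iff indicator_def max_def min_def)
    finally show "(\<lambda>(s, \<omega>). indicator {0..t} s *\<^sub>R g (t - s) (Y s \<omega>)) \<in> borel_measurable (lborel \<Otimes>\<^sub>M P i)" .
    show "{0..t} \<times> space (P i) \<in> sets (lborel \<Otimes>\<^sub>M P i)" by (intro pair_measureI) auto
    show "emeasure (lborel \<Otimes>\<^sub>M P i) ({0..t} \<times> space (P i)) < \<infinity>"
      using t unfolding EM by (simp add: chain.emeasure_space_1)
    show "AE z\<in>{0..t} \<times> space (P i) in lborel \<Otimes>\<^sub>M P i. norm (case z of (s, \<omega>) \<Rightarrow> indicator {0..t} s *\<^sub>R g (t - s) (Y s \<omega>)) \<le> C"
      by (intro AE_I2 impI) (auto intro!: g_bd)
    show "AE z in lborel \<Otimes>\<^sub>M P i. z \<notin> {0..t} \<times> space (P i) \<longrightarrow> (case z of (s, \<omega>) \<Rightarrow> indicator {0..t} s *\<^sub>R g (t - s) (Y s \<omega>)) = 0"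
      by (rule AE_I2) (auto simp: space_pair_measure indicator_def)
  qed
  have inner: "(LINT \<omega>|P i. g (t - s) (Y s \<omega>)) = (\<Sum>j\<in>UNIV. p s i j * g (t - s) j)" if s: "0 \<le> s" for s
  proof -
    have [measurable]: "(\<lambda>\<omega>. of_bool (Y s \<omega> = j) :: real) \<in> borel_measurable (P i)" for j
      by (rule measurable_compose[OF chain.Y_measurable[OF s]]) simp
    have "(LINT \<omega>|P i. g (t - s) (Y s \<omega>)) = (LINT \<omega>|P i. (\<Sum>j\<in>UNIV. g (t - s) j * of_bool (Y s \<omega> = j)))"
      by (simp add: of_bool_def if_distrib cong: if_cong)
    also have "\<dots> = (\<Sum>j\<in>UNIV. (LINT \<omega>|P i. g (t - s) j * of_bool (Y s \<omega> = j)))"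
      by (intro Bochner_Integration.integral_sum integrable_mult_right chain.integrable_const_bound[where B = 1]) auto
    finally show ?thesis using chain.prob_Y[OF s] by (simp add: mult.commute)
  qed
  have "(LINT \<omega>|P i. (LINT s:{0..t}|lborel. g (t - s) (Y s \<omega>))) =
      (LINT s|lborel. (LINT \<omega>|P i. indicator {0..t} s *\<^sub>R g (t - s) (Y s \<omega>)))"
    unfolding set_lebesgue_integral_def by (rule Fubini_integral[OF int])
  also have "\<dots> = (LINT s|lborel. indicator {0..t} s *\<^sub>R (\<Sum>j\<in>UNIV. p s i j * g (t - s) j))"
    using inner by (intro Bochner_Integration.integral_cong) (auto simp: indicator_def)
  \<comment> \<open>The reversal \<open>s = t - r\<close> evaluates the nonlinearity at
    \<open>r\<close> and leaves the kernel with duration \<open>t - r\<close>.\<close>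
  also have "\<dots> = (LINT r|lborel. indicator {0..t} (t + - 1 * r) *\<^sub>R (\<Sum>j\<in>UNIV. p (t + - 1 * r) i j * g (t - (t + - 1 * r)) j))"
    by (subst lborel_integral_real_affine[where c = "-1" and t = t]) auto
  also have "\<dots> = (LINT r:{0..t}|lborel. \<Sum>j\<in>UNIV. p (t - r) i j * g r j)"
    unfolding set_lebesgue_integral_def by (intro Bochner_Integration.integral_cong) (auto simp: indicator_def)
  finally have I: "(LINT \<omega>|P i. (LINT s:{0..t}|lborel. g (t - s) (Y s \<omega>))) = (LINT r:{0..t}|lborel. \<Sum>j\<in>UNIV. p (t - r) i j * g r j)" .
  have "u t i + (LINT \<omega>|P i. (LINT s:{0..t}|lborel. g (t - s) (Y s \<omega>))) = (LINT \<omega>|P i. \<theta> + (LINT s:{0..t}|lborel. 0))"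
    unfolding g_def by (rule mild_solutionD(4)[OF mild t])
  also have "\<dots> = \<theta>" by (simp add: set_lebesgue_integral_def chain.prob_space)
  finally show ?thesis unfolding I by (simp add: g_def)
qed

text \<open>The formula from time 0 is restarted at an arbitrary \<open>t\<close> by the semigroup
  property. The solution then becomes continuous, hence so does \<open>psi\<close> of it, and
  differentiable in turn.\<close>

lemma mild_solution_has_derivative:
  assumes mild: "mild_solution P Y \<beta> \<alpha> (\<lambda>_. \<theta>) (\<lambda>_. 0) u" and t: "t \<in> {0..T}"
  shows "((\<lambda>t. u t i) has_real_derivative ((\<Sum>j\<in>UNIV. L $ i $ j * u t j) - psi \<beta> \<alpha> i (u t i))) (at t within {0..T})"
proof -
  define g where "g r j = psi \<beta> \<alpha> j (u r j)" for r j
  obtain B where B: "\<And>r j. r \<in> {0..T} \<Longrightarrow> u r j \<le> B" and nn: "\<And>r j. 0 \<le> r \<Longrightarrow> 0 \<le> u r j"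
    using mild_solutionD(2,3)[OF mild] by meson
  define C where "C = (\<Sum>j\<in>UNIV. \<bar>\<beta> j\<bar> * \<bar>B\<bar> + \<bar>\<alpha> j\<bar> * B\<^sup>2)"
  have u_bd: "\<bar>u r j\<bar> \<le> B" if "0 \<le> r" "r \<le> T" for r j
    using nn[of r j] B[of r j] that by auto
  have g_bd: "\<bar>g r j\<bar> \<le> C" if r: "0 \<le> r" "r \<le> T" for r j
    unfolding g_def C_def using nn[of r j] u_bd[OF r, of j] r by (intro psi_bound) auto
  have g_meas: "set_borel_measurable borel {0..T} (\<lambda>r. g r j)" for j
  proof -
    have [measurable]: "(\<lambda>q. indicator {0..} q *\<^sub>R u q j) \<in> borel_measurable borel"
      by (rule mild_solutionD(1)[OF mild])
    have "(\<lambda>q. indicator {0..T} q *\<^sub>R psi \<beta> \<alpha> j (indicator {0..} q *\<^sub>R u q j)) \<in> borel_measurable borel"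
      unfolding psi_def by measurable
    also have "(\<lambda>q. indicator {0..T} q *\<^sub>R psi \<beta> \<alpha> j (indicator {0..} q *\<^sub>R u q j)) = (\<lambda>q. indicator {0..T} q *\<^sub>R g q j)"
      by (auto simp: g_def indicator_def)
    finally show ?thesis by (simp add: set_borel_measurable_def)
  qed
  note bk = chain.backward_kernel
  have duh: "u (t + h) i = (\<Sum>j\<in>UNIV. p h i j * u t j) -
      (LINT r:{t..t+h}|lborel. \<Sum>j\<in>UNIV. p (t + h - r) i j * g r j)"
    if th: "0 \<le> t" "0 \<le> h" "t + h \<le> T" for t h i
  proof -
    define f where "f r = (\<Sum>k\<in>UNIV. p (t + h - r) i k * g r k)" for r
    have f_int: "set_integrable lborel {a..b} f" if ab: "0 \<le> a" "b \<le> t + h" for a b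
    proof (rule set_integrable_subset)
      show "set_integrable lborel {0..t + h} f"
        unfolding f_def
      proof (rule kernel_at_zero.duhamel_integrable(1)[OF bk])
        show "set_borel_measurable borel {0..t + h} (\<lambda>r. g r j)" for j
          using g_meas[of j] by (rule set_borel_measurable_subset) (use th in auto)
        show "\<bar>g r j\<bar> \<le> C" if "0 \<le> r" "r \<le> t + h" for r j using that th by (intro g_bd) auto
      qed
    qed (use ab in auto)
    have g_int: "set_integrable lborel {0..t} (\<lambda>r. \<Sum>k\<in>UNIV. p (t - r) j k * g r k)" for j
    proof (rule kernel_at_zero.duhamel_integrable(1)[OF bk])
      show "set_borel_measurable borel {0..t} (\<lambda>r. g r j)" for j
        using g_meas[of j] by (rule set_borel_measurable_subset) (use th in auto)
      show "\<bar>g r j\<bar> \<le> C" if "0 \<le> r" "r \<le> t" for r j using that th by (intro g_bd) auto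
    qed
    have split: "(LINT r:{0..t+h}|lborel. f r) = (LINT r:{0..t}|lborel. f r) + (LINT r:{t..t+h}|lborel. f r)"
      using th Henstock_Kurzweil_Integration.integral_combine[of 0 t "t + h" f] set_borel_integral_eq_integral(1)[OF f_int[of 0 "t+h"]]
      by (simp add: set_borel_integral_eq_integral(2)[OF f_int])
    \<comment> \<open>Over \<open>[0, t]\<close> the kernel to time \<open>t + h\<close> factors
      through \<open>p h\<close>; what remains is the integral up to \<open>t\<close>, that is
      \<open>\<theta> - u t\<close>.\<close>
    have "(LINT r:{0..t}|lborel. f r) = (LINT r:{0..t}|lborel. \<Sum>j\<in>UNIV. p h i j * (\<Sum>k\<in>UNIV. p (t - r) j k * g r k))"
      unfolding set_lebesgue_integral_def
    proof (intro Bochner_Integration.integral_cong refl)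
      fix r
      show "indicator {0..t} r *\<^sub>R f r = indicator {0..t} r *\<^sub>R (\<Sum>j\<in>UNIV. p h i j * (\<Sum>k\<in>UNIV. p (t - r) j k * g r k))"
      proof (cases "r \<in> {0..t}")
        case True
        have "p (t + h - r) i k = (\<Sum>j\<in>UNIV. p h i j * p (t - r) j k)" for k
          using chain.p_add[of h "t - r" i k] True th by (simp add: algebra_simps)
        then have "f r = (\<Sum>k\<in>UNIV. \<Sum>j\<in>UNIV. p h i j * (p (t - r) j k * g r k))"
          unfolding f_def by (simp add: sum_distrib_right mult.assoc)
        also have "\<dots> = (\<Sum>j\<in>UNIV. p h i j * (\<Sum>k\<in>UNIV. p (t - r) j k * g r k))"
          by (subst sum.swap) (simp add: sum_distrib_left)
        finally show ?thesis by simp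
      qed simp
    qed
    also have "\<dots> = (\<Sum>j\<in>UNIV. p h i j * (LINT r:{0..t}|lborel. \<Sum>k\<in>UNIV. p (t - r) j k * g r k))"
    proof -
      define H where "H j r = (\<Sum>k\<in>UNIV. p (t - r) j k * g r k)" for j r
      have "(LINT r:{0..t}|lborel. \<Sum>j\<in>UNIV. p h i j * H j r) =
          (LINT r|lborel. (\<Sum>j\<in>UNIV. p h i j * (indicator {0..t} r *\<^sub>R H j r)))"
        unfolding set_lebesgue_integral_def
        by (intro Bochner_Integration.integral_cong refl) (simp add: sum_distrib_left mult_ac)
      also have "\<dots> = (\<Sum>j\<in>UNIV. (LINT r|lborel. p h i j * (indicator {0..t} r *\<^sub>R H j r)))"
        using g_int unfolding set_integrable_def H_def
        by (intro Bochner_Integration.integral_sum integrable_mult_right)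
      finally show ?thesis by (simp add: H_def set_lebesgue_integral_def)
    qed
    also have "\<dots> = (\<Sum>j\<in>UNIV. p h i j * (\<theta> - u t j))"
      using mild_solution_duhamel[OF mild th(1)] by (simp add: g_def)
    also have "\<dots> = \<theta> - (\<Sum>j\<in>UNIV. p h i j * u t j)"
      using chain.p_sum[OF th(2), of i] by (simp add: right_diff_distrib sum_subtractf flip: sum_distrib_right)
    finally have "(LINT r:{0..t+h}|lborel. f r) = \<theta> - (\<Sum>j\<in>UNIV. p h i j * u t j) + (LINT r:{t..t+h}|lborel. f r)"
      using split by simp
    moreover have "u (t + h) i = \<theta> - (LINT r:{0..t+h}|lborel. f r)"
      using mild_solution_duhamel[OF mild, of "t + h" i] th by (simp add: f_def g_def)
    ultimately show ?thesis by (simp add: f_def)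
  qed
  have cont: "continuous_on {0..T} (\<lambda>t. u t i)" for i
    by (rule kernel_at_zero.duhamel_continuous[OF bk u_bd g_bd g_meas duh])
  have "continuous_on {0..T} (\<lambda>t. g t i)" for i
    unfolding g_def psi_def by (intro continuous_intros cont)
  from kernel_at_zero.duhamel_has_derivative[OF bk u_bd g_bd g_meas duh this t]
  show ?thesis by (simp add: g_def)
qed

lemma mild_solution_initial:
  assumes "mild_solution P Y \<beta> \<alpha> (\<lambda>_. \<theta>) (\<lambda>_. 0) u"
  shows "u 0 i = \<theta>"
proof -
  have "(LINT r:{0..0}|lborel. \<Sum>j\<in>UNIV. p (0 - r) i j * psi \<beta> \<alpha> j (u r j)) =
      (LINT r|lborel. indicator {0::real} r *\<^sub>R (\<Sum>j\<in>UNIV. p 0 i j * psi \<beta> \<alpha> j (u 0 j)))"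
    unfolding set_lebesgue_integral_def by (intro Bochner_Integration.integral_cong) (auto simp: indicator_def)
  then show ?thesis using mild_solution_duhamel[OF assms, of 0 i] by simp
qed

text \<open>The supersolution \<open>2 / (a t) + b / a\<close> comes from \<open>y' = - a y\<^sup>2 / 2\<close>, whose solution started
  from infinity is \<open>2 / (a t)\<close>.\<close>

lemma mild_solution_bound:
  assumes mild: "mild_solution P Y \<beta> \<alpha> (\<lambda>_. \<theta>) (\<lambda>_. 0) u"
    and a: "0 < a" "\<And>i. a \<le> \<alpha> i" and b: "\<And>i. \<bar>\<beta> i\<bar> \<le> b" and t: "0 < t"
  shows "u t i \<le> 2 / (a * t) + b / a"
proof -
  define y where "y t = 2 / (a * t) + b / a" for t
  have b0: "0 \<le> b" using b[of undefined] by linarith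
  have ucont: "continuous_on {0..t} (\<lambda>t. u t i)" for i
    by (rule DERIV_continuous_on) (rule mild_solution_has_derivative[OF mild])
  obtain B where B: "\<And>r j. r \<in> {0..t} \<Longrightarrow> u r j \<le> B"
    using mild_solutionD(3)[OF mild] by meson
  \<comment> \<open>Up to time \<open>d\<close> the singular term \<open>2 / (a * r)\<close> is at
    least \<open>\<bar>B\<bar> + 1\<close>, so \<open>u\<close> starts strictly below
    \<open>y\<close>.\<close>
  define d where "d = min t (2 / (a * (\<bar>B\<bar> + 1)))"
  have d: "0 < d" "d \<le> t" using a t by (auto simp: d_def)
  have early: "u r j < y r" if r: "0 < r" "r \<le> d" for r j
  proof -
    have "r \<le> 2 / (a * (\<bar>B\<bar> + 1))" using r by (simp add: d_def)
    moreover have "0 < a * (\<bar>B\<bar> + 1)" "0 < a * r" using a r by auto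
    ultimately have "\<bar>B\<bar> + 1 \<le> 2 / (a * r)" by (simp add: pos_le_divide_eq mult_ac)
    moreover have "u r j \<le> B" using r d by (intro B) auto
    moreover have "0 \<le> b / a" using a b0 by simp
    ultimately show ?thesis unfolding y_def by linarith
  qed
  \<comment> \<open>The times at which some component has reached \<open>y\<close>. Finiteness of
    the state space makes \<open>S\<close> closed, so a first such time exists.\<close>
  define S where "S = (\<Union>j. {r\<in>{d..t}. y r \<le> u r j})"
  have "S = {}"
  proof (rule ccontr)
    assume ne: "S \<noteq> {}"
    have ycont: "continuous_on {d..t} y"
      unfolding y_def using a d by (intro continuous_intros) auto
    have "closed ({d..t} \<inter> (\<lambda>r. u r j - y r) -` {0..})" for j
      using ycont continuous_on_subset[OF ucont, of "{d..t}"] d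
      by (intro continuous_closed_preimage continuous_intros) auto
    moreover have "{r\<in>{d..t}. y r \<le> u r j} = {d..t} \<inter> (\<lambda>r. u r j - y r) -` {0..}" for j by auto
    ultimately have "closed S" unfolding S_def by (intro closed_UN) auto
    moreover have "bounded S" by (rule bounded_subset[of "{d..t}"]) (auto simp: S_def)
    ultimately have "compact S" by (simp add: compact_eq_bounded_closed)
    then obtain s where s: "s \<in> S" "\<And>r. r \<in> S \<Longrightarrow> s \<le> r"
      using compact_attains_inf[OF _ ne] by auto
    then obtain j where j: "s \<in> {d..t}" "y s \<le> u s j" by (auto simp: S_def)
    have ds: "d < s" using early[of s j] j d by fastforce
    have before: "u r k < y r" if "0 < r" "r < s" for r k
    proof (cases "r \<le> d")
      case False
      then have "r \<notin> S" using s(2)[of r] that by auto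
      moreover have "r \<in> {d..t}" using False that j by auto
      ultimately show ?thesis unfolding S_def by (auto simp: not_le)
    qed (use that early in auto)
    have at_s: "u s k \<le> y s" for k
    proof (rule tendsto_le[of "at_left s"])
      have "continuous (at s within {0..t}) (\<lambda>r. u r k)"
        using ucont[of k] j d by (simp add: continuous_on_eq_continuous_within)
      then have "((\<lambda>r. u r k) \<longlongrightarrow> u s k) (at s within {0..s})"
        unfolding continuous_within by (rule tendsto_within_subset) (use j in auto)
      then show "((\<lambda>r. u r k) \<longlongrightarrow> u s k) (at_left s)"
        using at_within_Icc_at_left[of 0 s] ds d by simp
      have "isCont y s" unfolding y_def using a ds d by (intro continuous_intros) auto
      then show "(y \<longlongrightarrow> y s) (at_left s)"
        unfolding isCont_def by (rule tendsto_within_subset) auto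
      have "\<forall>\<^sub>F r in at_left s. 0 < r \<and> r < s"
        unfolding eventually_at_left_field using ds d by (intro exI[of _ 0]) auto
      then show "\<forall>\<^sub>F r in at_left s. u r k \<le> y r"
        by eventually_elim (use before in \<open>auto intro: less_imp_le\<close>)
    qed simp
    have us: "u s j = y s" using j at_s[of j] by simp
    define D where "D = (\<Sum>k\<in>UNIV. L $ j $ k * u s k) - psi \<beta> \<alpha> j (u s j) - (- 2 / (a * s\<^sup>2))"
    have D: "((\<lambda>r. u r j - y r) has_real_derivative D) (at s within {0..t})"
      unfolding D_def
    proof (intro DERIV_diff mild_solution_has_derivative[OF mild])
      show "s \<in> {0..t}" using j d by auto
      show "(y has_real_derivative - 2 / (a * s\<^sup>2)) (at s within {0..t})"
        unfolding y_def using a ds d by (auto intro!: derivative_eq_intros simp: power2_eq_square)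
    qed
    have "D < 0"
    proof -
      \<comment> \<open>Maximum principle: since rows of \<open>L\<close> sum to 0,
        \<open>y s\<close> may be subtracted; the differences are nonpositive and the one at
        \<open>j\<close> vanishes.\<close>
      have "(\<Sum>k\<in>UNIV. L $ j $ k * u s k) = (\<Sum>k\<in>UNIV. L $ j $ k * (u s k - y s))"
        using chain.L_sum[of j] by (simp add: right_diff_distrib sum_subtractf flip: sum_distrib_right)
      also have "\<dots> \<le> 0"
      proof (rule sum_nonpos)
        fix k show "L $ j $ k * (u s k - y s) \<le> 0"
          using chain.L_nonneg[of j k] at_s[of k] us by (cases "j = k") (auto simp: mult_le_0_iff)
      qed
      finally have 1: "(\<Sum>k\<in>UNIV. L $ j $ k * u s k) \<le> 0" .
      \<comment> \<open>Since \<open>a * y s - b = 2 / s\<close>, the nonlinearity at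
        \<open>y s\<close> is at least \<open>4 / (a * s\<^sup>2)\<close>, twice the rate at which
        \<open>y\<close> decreases; this factor makes \<open>D\<close> strictly negative.\<close>
      have y0: "2 / (a * s) \<le> y s" "0 < 2 / (a * s)" using a b0 ds d by (auto simp: y_def)
      have y00: "0 \<le> y s" using y0 by linarith
      have "2 / (a * s\<^sup>2) < 2 / (a * s) * (2 / s)" using a ds d by (simp add: field_simps power2_eq_square)
      also have "\<dots> \<le> y s * (2 / s)" using y0 ds d by (intro mult_right_mono) auto
      also have "\<dots> = y s * (a * y s - b)" using a by (simp add: y_def field_simps)
      also have "\<dots> = - b * y s + a * (y s)\<^sup>2" by (simp add: power2_eq_square algebra_simps)
      also have "\<dots> \<le> \<beta> j * y s + \<alpha> j * (y s)\<^sup>2"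
        using y00 b[of j] a(2)[of j] by (intro add_mono mult_right_mono) auto
      finally show ?thesis using 1 by (simp add: D_def us psi_def)
    qed
    \<comment> \<open>A negative slope at the first contact would make \<open>u - y\<close> positive
      just before it, where it is negative.\<close>
    from has_real_derivative_neg_dec_left[OF D this] obtain e where e: "0 < e"
      "\<And>h. 0 < h \<Longrightarrow> s - h \<in> {0..t} \<Longrightarrow> h < e \<Longrightarrow> u s j - y s < u (s - h) j - y (s - h)" by blast
    define h where "h = min (e / 2) (s / 2)"
    have h: "0 < h" "h < e" "h < s" "s - h \<in> {0..t}" using e ds d j by (auto simp: h_def)
    have "u (s - h) j < y (s - h)" using h by (intro before) auto
    then show False using e(2)[OF h(1,4,2)] us by simp
  qed
  then have "t \<notin> {r\<in>{d..t}. y r \<le> u r i}" unfolding S_def by blast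
  then have "u t i < y t" using d by (simp add: not_le)
  then show ?thesis by (simp add: y_def)
qed

end

section \<open>Evaluation of paths and pairing with constants\<close>

lemma borel_measurable_path_eval: "0 \<le> t \<Longrightarrow> (\<lambda>X. X t) \<in> borel_measurable path_space"
  unfolding path_space_def by (intro measurable_restrict_space1 measurable_component_singleton) auto

lemma sets_path_event: "0 \<le> t \<Longrightarrow> B \<in> sets borel \<Longrightarrow> {X \<in> space path_space. X t \<in> B} \<in> sets path_space"
  using measurable_sets[OF borel_measurable_path_eval, of t B] by (simp add: vimage_def Int_def conj_commute)

lemma path_spaceD:
  assumes "X \<in> space path_space"
  shows "continuous_on {0..} X" "0 \<le> t \<Longrightarrow> X t \<in> fin_meas"
  using assms by (auto simp: path_space_def space_restrict_space)

lemma axis_fin_meas: "axis i 1 \<in> fin_meas"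
  by (simp add: fin_meas_def axis_def)

lemma pairing_axis: "pairing (axis i 1) f = f i"
proof -
  have "axis i 1 $ j * f j = (if j = i then f j else 0)" for j by (simp add: axis_def)
  then show ?thesis by (simp add: pairing_def)
qed

lemma pairing_measurable: "(\<lambda>m. pairing m f) \<in> borel_measurable borel"
  unfolding pairing_def by (intro borel_measurable_continuous_onI continuous_intros)

lemma pairing_const_nonneg: "m \<in> fin_meas \<Longrightarrow> 0 \<le> c \<Longrightarrow> 0 \<le> pairing m (\<lambda>_. c)"
  by (simp add: pairing_def fin_meas_def sum_nonneg)

lemma pairing_const_pos: "m \<in> fin_meas \<Longrightarrow> m \<noteq> 0 \<Longrightarrow> 0 < pairing m (\<lambda>_. 1)"
  by (auto simp: pairing_def fin_meas_def vec_eq_iff sum_nonneg_eq_0_iff less_le intro!: sum_nonneg)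

section \<open>Extinction probabilities of the superprocess and the equation for
  \<open>v\<close>\<close>

locale feller_superprocess = jump_chains p L P Y
  for p :: "real \<Rightarrow> 'k::finite \<Rightarrow> 'k \<Rightarrow> real" and L :: "real^'k^'k"
    and P :: "'k \<Rightarrow> 'a measure" and Y :: "real \<Rightarrow> 'a \<Rightarrow> 'k" +
  fixes \<alpha> \<beta> :: "'k \<Rightarrow> real" and PX :: "real^'k \<Rightarrow> (real \<Rightarrow> real^'k) measure"
  assumes \<alpha>_pos: "\<And>i. 0 < \<alpha> i" and super: "superprocess P Y \<beta> \<alpha> PX"
begin

lemma PX_prob: "\<nu> \<in> fin_meas \<Longrightarrow> prob_space (PX \<nu>)"
  and sets_PX: "\<nu> \<in> fin_meas \<Longrightarrow> sets (PX \<nu>) = sets path_space"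
  using super[unfolded superprocess_def, THEN conjunct1] by auto

lemma space_PX: "\<nu> \<in> fin_meas \<Longrightarrow> space (PX \<nu>) = space path_space"
  using sets_PX sets_eq_imp_space_eq by blast

lemma PX_eval: "\<nu> \<in> fin_meas \<Longrightarrow> 0 \<le> t \<Longrightarrow> (\<lambda>X. X t) \<in> borel_measurable (PX \<nu>)"
  using borel_measurable_path_eval[of t] measurable_cong_sets[OF sets_PX refl] by blast

lemma cumulant_exists:
  assumes "0 \<le> \<theta>"
  shows "\<exists>u. mild_solution P Y \<beta> \<alpha> (\<lambda>_. \<theta>) (\<lambda>_. 0) u \<and>
    (\<forall>\<nu>\<in>fin_meas. \<forall>t\<ge>0. (LINT X|PX \<nu>. exp (- pairing (X t) (\<lambda>_. \<theta>))) = exp (- pairing \<nu> (u t)))"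
proof -
  note * = super[unfolded superprocess_def, THEN conjunct2, THEN conjunct1, THEN spec[of _ "\<lambda>_. \<theta>"], THEN spec[of _ "\<lambda>_. 0"]]
  have Z: "pairing m (\<lambda>_. 0) = 0" for m :: "real^'k" by (simp add: pairing_def)
  show ?thesis using * assms by (simp add: Z set_lebesgue_integral_def)
qed

text \<open>The log-Laplace functional of the superprocess at the constant test function
  \<open>\<theta>\<close>, chosen together with its equation and its Laplace formula.\<close>

definition cumulant :: "real \<Rightarrow> real \<Rightarrow> 'k \<Rightarrow> real" where
  "cumulant \<theta> = (SOME u. mild_solution P Y \<beta> \<alpha> (\<lambda>_. \<theta>) (\<lambda>_. 0) u \<and>
    (\<forall>\<nu>\<in>fin_meas. \<forall>t\<ge>0. (LINT X|PX \<nu>. exp (- pairing (X t) (\<lambda>_. \<theta>))) = exp (- pairing \<nu> (u t))))"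

lemma cumulant:
  assumes "0 \<le> \<theta>"
  shows "mild_solution P Y \<beta> \<alpha> (\<lambda>_. \<theta>) (\<lambda>_. 0) (cumulant \<theta>)"
    and "\<nu> \<in> fin_meas \<Longrightarrow> 0 \<le> t \<Longrightarrow>
      (LINT X|PX \<nu>. exp (- pairing (X t) (\<lambda>_. \<theta>))) = exp (- pairing \<nu> (cumulant \<theta> t))"
  using someI_ex[OF cumulant_exists[OF assms]] unfolding cumulant_def[symmetric] by auto

text \<open>The supersolution with \<open>a\<close> the least value of \<open>\<alpha>\<close> and
  \<open>b\<close> the sum of the \<open>\<bar>\<beta> i\<bar>\<close>; it does not depend on the
  initial value of the cumulant.\<close>

definition bound_fun :: "real \<Rightarrow> real" where
  "bound_fun t = 2 / (Min (range \<alpha>) * t) + (\<Sum>i\<in>UNIV. \<bar>\<beta> i\<bar>) / Min (range \<alpha>)"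

lemma Min_\<alpha>_pos: "0 < Min (range \<alpha>)"
  using \<alpha>_pos by (subst Min_gr_iff) auto

lemma bound_fun_antimono: "0 < s \<Longrightarrow> s \<le> t \<Longrightarrow> bound_fun t \<le> bound_fun s"
  unfolding bound_fun_def using Min_\<alpha>_pos
  by (intro add_right_mono divide_left_mono mult_left_mono mult_pos_pos less_imp_le[OF Min_\<alpha>_pos]) simp_all

lemma cumulant_bound: "0 \<le> \<theta> \<Longrightarrow> 0 < t \<Longrightarrow> cumulant \<theta> t i \<le> bound_fun t"
  unfolding bound_fun_def
proof (rule mild_solution_bound[OF cumulant(1)])
  show "\<bar>\<beta> i\<bar> \<le> (\<Sum>i\<in>UNIV. \<bar>\<beta> i\<bar>)" for i by (rule member_le_sum) auto
qed (use Min_\<alpha>_pos in auto)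

lemma cumulant_nonneg: "0 \<le> \<theta> \<Longrightarrow> 0 \<le> t \<Longrightarrow> 0 \<le> cumulant \<theta> t i"
  using mild_solutionD(2)[OF cumulant(1)] .

text \<open>Taken from the extinction probability started from a unit mass at \<open>i\<close>; the
  agreement with \<open>v_ext\<close> at positive times is established through the Poisson
  clusters.\<close>

definition v :: "real \<Rightarrow> 'k \<Rightarrow> real" where
  "v t i = - ln (measure (PX (axis i 1)) {X \<in> space path_space. X t = 0})"

text \<open>With a constant test function tending to infinity, the exponential of the total mass
  tends to the indicator of \<open>X t = 0\<close>, dominated by 1.\<close>

lemma laplace_tendsto:
  assumes \<nu>: "\<nu> \<in> fin_meas" and t: "0 \<le> t"
  shows "(\<lambda>n. exp (- pairing \<nu> (cumulant (real n) t))) \<longlonglongrightarrow> measure (PX \<nu>) {X \<in> space path_space. X t = 0}"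
proof -
  interpret prob_space "PX \<nu>" by (rule PX_prob[OF \<nu>])
  have [measurable]: "(\<lambda>X. X t) \<in> borel_measurable (PX \<nu>)" by (rule PX_eval[OF \<nu> t])
  have pm: "(\<lambda>X. pairing (X t) (\<lambda>_. c)) \<in> borel_measurable (PX \<nu>)" for c
    by (rule measurable_compose[OF PX_eval[OF \<nu> t] pairing_measurable])
  have "(\<lambda>n. LINT X|PX \<nu>. exp (- pairing (X t) (\<lambda>_. real n))) \<longlonglongrightarrow>
      (LINT X|PX \<nu>. indicator {X \<in> space path_space. X t = 0} X)"
  proof (rule integral_dominated_convergence[where w = "\<lambda>_. 1"])
    show "(indicator {X \<in> space path_space. X t = 0} :: _ \<Rightarrow> real) \<in> borel_measurable (PX \<nu>)"
      using sets_path_event[of t "{0}"] t sets_PX[OF \<nu>] by (intro borel_measurable_indicator) auto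
    show "(\<lambda>X. exp (- pairing (X t) (\<lambda>_. real n))) \<in> borel_measurable (PX \<nu>)" for n
      using pm[of "real n"] by measurable
    show "AE X in PX \<nu>. (\<lambda>n. exp (- pairing (X t) (\<lambda>_. real n))) \<longlonglongrightarrow> indicator {X \<in> space path_space. X t = 0} X"
    proof (rule AE_I2)
      fix X assume X: "X \<in> space (PX \<nu>)"
      then have Xs: "X \<in> space path_space" by (simp add: space_PX[OF \<nu>])
      have pe: "pairing (X t) (\<lambda>_. real n) = real n * pairing (X t) (\<lambda>_. 1)" for n
        by (simp add: pairing_def sum_distrib_left mult_ac)
      show "(\<lambda>n. exp (- pairing (X t) (\<lambda>_. real n))) \<longlonglongrightarrow> indicator {X \<in> space path_space. X t = 0} X"
      proof (cases "X t = 0")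
        case True
        then show ?thesis using Xs by (simp add: pairing_def)
      next
        case False
        then have "0 < pairing (X t) (\<lambda>_. 1)" using path_spaceD(2)[OF Xs t] by (intro pairing_const_pos)
        then have "(\<lambda>n. exp (- pairing (X t) (\<lambda>_. 1)) ^ n) \<longlonglongrightarrow> 0" by (intro LIMSEQ_power_zero) simp
        moreover have "exp (- pairing (X t) (\<lambda>_. 1)) ^ n = exp (- pairing (X t) (\<lambda>_. real n))" for n
          unfolding pe[of n] exp_of_nat_mult[symmetric] by simp
        ultimately show ?thesis using False by simp
      qed
    qed
    show "AE X in PX \<nu>. norm (exp (- pairing (X t) (\<lambda>_. real n))) \<le> 1" for n
      using path_spaceD(2)[OF _ t] by (intro AE_I2) (auto simp: space_PX[OF \<nu>] intro!: pairing_const_nonneg)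
  qed simp
  moreover have "(LINT X|PX \<nu>. indicator {X \<in> space path_space. X t = 0} X) = measure (PX \<nu>) {X \<in> space path_space. X t = 0}"
  proof -
    have "{X \<in> space path_space. X t = 0} \<inter> space (PX \<nu>) = {X \<in> space path_space. X t = 0}"
      by (auto simp: space_PX[OF \<nu>])
    then show ?thesis by simp
  qed
  ultimately show ?thesis using cumulant(2)[OF _ \<nu> t] by simp
qed

text \<open>The bound on the cumulants is uniform in \<open>n\<close> and survives the limit.
  Positivity makes the logarithm in \<open>v\<close> meaningful.\<close>

lemma extinction_prob_pos:
  assumes t: "0 < t"
  shows "exp (- bound_fun t) \<le> measure (PX (axis i 1)) {X \<in> space path_space. X t = 0}"
proof (rule LIMSEQ_le_const[OF laplace_tendsto[OF axis_fin_meas]])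
  show "\<exists>N. \<forall>n\<ge>N. exp (- bound_fun t) \<le> exp (- pairing (axis i 1) (cumulant (real n) t))"
    using cumulant_bound[OF _ t, of _ i] by (simp add: pairing_axis)
qed (use t in auto)

lemma cumulant_tendsto_v:
  assumes t: "0 < t"
  shows "(\<lambda>n. cumulant (real n) t i) \<longlonglongrightarrow> v t i"
proof -
  let ?q = "measure (PX (axis i 1)) {X \<in> space path_space. X t = 0}"
  have q: "0 < ?q" using extinction_prob_pos[OF t, of i] exp_gt_zero less_le_trans by blast
  have "(\<lambda>n. exp (- cumulant (real n) t i)) \<longlonglongrightarrow> ?q"
    using laplace_tendsto[OF axis_fin_meas, of t i] t by (simp add: pairing_axis)
  then have "(\<lambda>n. - ln (exp (- cumulant (real n) t i))) \<longlonglongrightarrow> - ln ?q"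
    using q by (intro tendsto_minus tendsto_ln) auto
  then show ?thesis by (simp add: v_def)
qed

lemma v_bounds:
  assumes t: "0 < t"
  shows "0 \<le> v t i" "v t i \<le> bound_fun t"
  using LIMSEQ_le_const[OF cumulant_tendsto_v[OF t]] LIMSEQ_le_const2[OF cumulant_tendsto_v[OF t]]
    cumulant_bound[OF _ t] cumulant_nonneg[OF _ less_imp_le[OF t]] by auto

text \<open>The branching property: the pairing is linear in the initial mass, so the limit is
  governed by unit masses.\<close>

lemma extinction_prob:
  assumes \<nu>: "\<nu> \<in> fin_meas" and t: "0 < t"
  shows "measure (PX \<nu>) {X \<in> space path_space. X t = 0} = exp (- pairing \<nu> (v t))"
proof (rule LIMSEQ_unique[OF laplace_tendsto[OF \<nu> less_imp_le[OF t]]])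
  show "(\<lambda>n. exp (- pairing \<nu> (cumulant (real n) t))) \<longlonglongrightarrow> exp (- pairing \<nu> (v t))"
    unfolding pairing_def by (intro tendsto_intros cumulant_tendsto_v t)
qed

text \<open>The indicator of \<open>X t = 0\<close> is below the Laplace functional. As \<theta> is
  arbitrary, \<open>v\<close> must blow up at time 0.\<close>

lemma cumulant_le_v:
  assumes t: "0 < t" and \<theta>: "0 \<le> \<theta>"
  shows "cumulant \<theta> t i \<le> v t i"
proof -
  let ?\<nu> = "axis i 1 :: real^'k" and ?Z = "{X \<in> space path_space. X t = (0::real^'k)}"
  interpret prob_space "PX ?\<nu>" by (rule PX_prob[OF axis_fin_meas])
  have Z: "?Z \<in> sets (PX ?\<nu>)"
    using sets_path_event[of t "{0}"] t sets_PX[OF axis_fin_meas] by auto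
  have pm: "(\<lambda>X. pairing (X t) (\<lambda>_. \<theta>)) \<in> borel_measurable (PX ?\<nu>)"
    by (rule measurable_compose[OF PX_eval[OF axis_fin_meas less_imp_le[OF t]] pairing_measurable])
  have nn: "0 \<le> pairing (X t) (\<lambda>_. \<theta>)" if "X \<in> space (PX ?\<nu>)" for X
    using that path_spaceD(2)[of X t] t \<theta> by (intro pairing_const_nonneg) (auto simp: space_PX[OF axis_fin_meas])
  have "exp (- v t i) = measure (PX ?\<nu>) ?Z"
    using extinction_prob[OF axis_fin_meas t, of i] by (simp add: pairing_axis)
  also have "\<dots> = (LINT X|PX ?\<nu>. indicator ?Z X)"
    using Z sets.sets_into_space[OF Z] by (simp add: Int_absorb2)
  also have "\<dots> \<le> (LINT X|PX ?\<nu>. exp (- pairing (X t) (\<lambda>_. \<theta>)))"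
  proof (rule Bochner_Integration.integral_mono)
    show "integrable (PX ?\<nu>) (indicator ?Z :: _ \<Rightarrow> real)"
      using Z by (intro integrable_real_indicator) (auto simp: emeasure_eq_measure)
    show "integrable (PX ?\<nu>) (\<lambda>X. exp (- pairing (X t) (\<lambda>_. \<theta>)))"
      using pm nn by (intro integrable_const_bound[where B = 1]) auto
    show "indicator ?Z X \<le> exp (- pairing (X t) (\<lambda>_. \<theta>))" for X :: "real \<Rightarrow> real^'k"
      by (auto simp: indicator_def pairing_def)
  qed
  also have "\<dots> = exp (- cumulant \<theta> t i)"
    using cumulant(2)[OF \<theta> axis_fin_meas, of t i] t by (simp add: pairing_axis)
  finally show ?thesis by simp
qed

definition dv :: "real \<Rightarrow> 'k \<Rightarrow> real" where
  "dv t i = (\<Sum>j\<in>UNIV. L $ i $ j * v t j) - psi \<beta> \<alpha> i (v t i)"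

lemma drift_bound:
  assumes "\<And>j. \<bar>w j\<bar> \<le> B"
  shows "\<bar>(\<Sum>j\<in>UNIV. L $ i $ j * w j) - psi \<beta> \<alpha> i (w i)\<bar> \<le> (\<Sum>j\<in>UNIV. \<bar>L $ i $ j\<bar> * B) + (\<bar>\<beta> i\<bar> * B + \<alpha> i * B\<^sup>2)"
proof -
  have "\<bar>\<Sum>j\<in>UNIV. L $ i $ j * w j\<bar> \<le> (\<Sum>j\<in>UNIV. \<bar>L $ i $ j * w j\<bar>)" by (rule sum_abs)
  also have "\<dots> \<le> (\<Sum>j\<in>UNIV. \<bar>L $ i $ j\<bar> * B)"
    using assms by (intro sum_mono) (auto simp: abs_mult intro!: mult_left_mono)
  finally have 1: "\<bar>\<Sum>j\<in>UNIV. L $ i $ j * w j\<bar> \<le> (\<Sum>j\<in>UNIV. \<bar>L $ i $ j\<bar> * B)" .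
  have "\<bar>psi \<beta> \<alpha> i (w i)\<bar> \<le> \<bar>\<beta> i\<bar> * \<bar>w i\<bar> + \<alpha> i * \<bar>w i\<bar>\<^sup>2"
    unfolding psi_def using \<alpha>_pos[of i] by (intro order_trans[OF abs_triangle_ineq]) (simp add: abs_mult)
  also have "\<dots> \<le> \<bar>\<beta> i\<bar> * B + \<alpha> i * B\<^sup>2"
    using assms[of i] \<alpha>_pos[of i] by (intro add_mono mult_left_mono power_mono) auto
  finally show ?thesis using 1 by linarith
qed

text \<open>The integrated equation passes to the limit by dominated convergence, since on
  \<open>[s, t]\<close> all cumulants are bounded by \<open>bound_fun s\<close>; no convergence of
  derivatives is required.\<close>

lemma v_increment:
  assumes st: "0 < s" "s \<le> t"
  shows "set_integrable lborel {s..t} (\<lambda>r. dv r i)"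
    and "v t i - v s i = (LINT r:{s..t}|lborel. dv r i)"
proof -
  define F where "F n r = (\<Sum>j\<in>UNIV. L $ i $ j * cumulant (real n) r j) - psi \<beta> \<alpha> i (cumulant (real n) r i)" for n r
  define K where "K = (\<Sum>j\<in>UNIV. \<bar>L $ i $ j\<bar> * bound_fun s) + (\<bar>\<beta> i\<bar> * bound_fun s + \<alpha> i * (bound_fun s)\<^sup>2)"
  have der: "((\<lambda>t. cumulant (real n) t j) has_real_derivative ((\<Sum>k\<in>UNIV. L $ j $ k * cumulant (real n) r k) - psi \<beta> \<alpha> j (cumulant (real n) r j))) (at r within {s..t})"
    if "r \<in> {s..t}" for r n j
    by (rule DERIV_subset[OF mild_solution_has_derivative[OF cumulant(1), of "real n" r t]]) (use that st in auto)
  have cc: "continuous_on {s..t} (\<lambda>r. cumulant (real n) r j)" for n j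
    by (rule DERIV_continuous_on) (rule der)
  have F_cont: "continuous_on {s..t} (F n)" for n
    unfolding F_def psi_def by (intro continuous_intros cc)
  have F_int: "set_integrable lborel {s..t} (F n)" for n
    by (rule borel_integrable_atLeastAtMost'[OF F_cont])
  have F_eq: "cumulant (real n) t i - cumulant (real n) s i = (LINT r|lborel. indicator {s..t} r *\<^sub>R F n r)" for n
  proof -
    have "(F n has_integral (cumulant (real n) t i - cumulant (real n) s i)) {s..t}"
      using st der unfolding F_def by (intro fundamental_theorem_of_calculus) (auto simp: has_real_derivative_iff_has_vector_derivative[symmetric])
    then show ?thesis
      using set_borel_integral_eq_integral(2)[OF F_int[of n]] by (simp add: set_lebesgue_integral_def integral_unique)
  qed
  have F_lim: "(\<lambda>n. indicator {s..t} r *\<^sub>R F n r) \<longlonglongrightarrow> indicator {s..t} r *\<^sub>R dv r i" for r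
  proof (cases "r \<in> {s..t}")
    case True
    then have "0 < r" using st by auto
    then have "(\<lambda>n. F n r) \<longlonglongrightarrow> dv r i"
      unfolding F_def dv_def psi_def by (intro tendsto_intros cumulant_tendsto_v)
    then show ?thesis by (intro tendsto_intros)
  qed simp
  have F_bd: "norm (indicator {s..t} r *\<^sub>R F n r) \<le> indicator {s..t} r *\<^sub>R K" for n r
  proof (cases "r \<in> {s..t}")
    case True
    then have r: "0 < r" "s \<le> r" using st by auto
    have "\<bar>cumulant (real n) r j\<bar> \<le> bound_fun s" for j
      using cumulant_bound[of "real n" r j] cumulant_nonneg[of "real n" r j] bound_fun_antimono[OF st(1) r(2)] r by auto
    then show ?thesis using True drift_bound[of "cumulant (real n) r" "bound_fun s" i] by (simp add: F_def K_def)
  qed simp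
  have meas: "(\<lambda>r. indicator {s..t} r *\<^sub>R F n r) \<in> borel_measurable lborel" for n
    using F_int[of n] unfolding set_integrable_def by (rule borel_measurable_integrable)
  have meas': "(\<lambda>r. indicator {s..t} r *\<^sub>R dv r i) \<in> borel_measurable lborel"
    by (rule borel_measurable_LIMSEQ_real[OF F_lim meas])
  have K_int: "integrable lborel (\<lambda>r. indicator {s..t} r *\<^sub>R K)"
    by (intro integrable_scaleR_left integrable_real_indicator) (auto simp: emeasure_lborel_Icc_eq)
  show "set_integrable lborel {s..t} (\<lambda>r. dv r i)"
    unfolding set_integrable_def
    by (rule integrable_dominated_convergence[where s = "\<lambda>n r. indicator {s..t} r *\<^sub>R F n r", OF meas' meas K_int]) (use F_lim F_bd in auto)
  have "(\<lambda>n. LINT r|lborel. indicator {s..t} r *\<^sub>R F n r) \<longlonglongrightarrow> (LINT r|lborel. indicator {s..t} r *\<^sub>R dv r i)"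
    by (rule integral_dominated_convergence[where s = "\<lambda>n r. indicator {s..t} r *\<^sub>R F n r", OF meas' meas K_int]) (use F_lim F_bd in auto)
  moreover have "(\<lambda>n. cumulant (real n) t i - cumulant (real n) s i) \<longlonglongrightarrow> v t i - v s i"
    using st by (intro tendsto_intros cumulant_tendsto_v) auto
  ultimately show "v t i - v s i = (LINT r:{s..t}|lborel. dv r i)"
    unfolding F_eq set_lebesgue_integral_def by (rule LIMSEQ_unique[symmetric])
qed

lemma v_continuous_on:
  assumes a: "0 < a"
  shows "continuous_on {a..b} (\<lambda>t. v t i)"
proof (rule continuous_on_forwardI)
  fix e :: real assume e: "0 < e"
  define K where "K = (\<Sum>j\<in>UNIV. \<bar>L $ i $ j\<bar> * bound_fun a) + (\<bar>\<beta> i\<bar> * bound_fun a + \<alpha> i * (bound_fun a)\<^sup>2)"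
  have "0 \<le> bound_fun a" using v_bounds[OF a, of i] by linarith
  then have K: "0 \<le> K" unfolding K_def using \<alpha>_pos[of i] by (intro add_nonneg_nonneg sum_nonneg) auto
  have "\<bar>v (t + h) i - v t i\<bar> \<le> e" if th: "a \<le> t" "0 < h" "h < e / (K + 1)" for t h
  proof -
    have "\<bar>(LINT r:{t..t+h}|lborel. dv r i) - h * 0\<bar> \<le> K * h"
    proof (rule set_integral_average_bound)
      show "set_integrable lborel {t..t+h} (\<lambda>r. dv r i)" using th a by (intro v_increment) auto
      fix r assume r: "t \<le> r"
      have "\<bar>v r j\<bar> \<le> bound_fun a" for j
        using v_bounds[of r j] bound_fun_antimono[OF a, of r] r th a by auto
      then show "\<bar>dv r i - 0\<bar> \<le> K" unfolding dv_def K_def using drift_bound[of "v r" "bound_fun a" i] by simp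
    qed (use th in auto)
    moreover have "K * h \<le> (K + 1) * h" using th by (simp add: mult_right_mono)
    moreover have "(K + 1) * h \<le> e" using th K by (simp add: field_simps)
    ultimately have "\<bar>LINT r:{t..t+h}|lborel. dv r i\<bar> \<le> e" by linarith
    then show ?thesis using v_increment(2)[of t "t + h" i] th a by simp
  qed
  then show "\<exists>d>0. \<forall>t h. a \<le> t \<longrightarrow> 0 < h \<longrightarrow> h < d \<longrightarrow> t + h \<le> b \<longrightarrow> \<bar>v (t + h) i - v t i\<bar> \<le> e"
    using e K by (intro exI[of _ "e / (K + 1)"]) auto
qed

lemma v_has_derivative:
  assumes t: "0 < t"
  shows "((\<lambda>t. v t i) has_real_derivative dv t i) (at t)"
proof -
  let ?I = "{t / 2..t + 1}"
  have dvc: "continuous_on ?I (\<lambda>r. dv r i)"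
    unfolding dv_def psi_def using t by (intro continuous_intros v_continuous_on) auto
  have "((\<lambda>u. integral {t / 2..u} (\<lambda>r. dv r i)) has_vector_derivative dv t i) (at t within ?I)"
    using t by (intro integral_has_vector_derivative[OF dvc]) auto
  then have "((\<lambda>u. v (t / 2) i + integral {t / 2..u} (\<lambda>r. dv r i)) has_real_derivative dv t i) (at t within ?I)"
    unfolding has_real_derivative_iff_has_vector_derivative by (auto intro!: derivative_eq_intros)
  then have "((\<lambda>u. v u i) has_real_derivative dv t i) (at t within ?I)"
  proof (rule has_field_derivative_transform_within[OF _ zero_less_one])
    show "t \<in> ?I" using t by auto
    fix u assume "u \<in> ?I"
    then show "v (t / 2) i + integral {t / 2..u} (\<lambda>r. dv r i) = v u i"
      using v_increment[of "t / 2" u i] t by (simp add: set_borel_integral_eq_integral(2))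
  qed
  moreover have "at t within ?I = at t" using t by (intro at_within_interior) auto
  ultimately show ?thesis by simp
qed

lemma dv_has_derivative:
  assumes t: "0 < t"
  shows "((\<lambda>t. dv t i) has_real_derivative ((\<Sum>j\<in>UNIV. L $ i $ j * dv t j) - (\<beta> i + 2 * \<alpha> i * v t i) * dv t i)) (at t)"
proof -
  have "((\<lambda>t. dv t i) has_real_derivative ((\<Sum>j\<in>UNIV. L $ i $ j * dv t j) - (\<beta> i * dv t i + \<alpha> i * (2 * v t i * dv t i)))) (at t)"
  proof -
    have f: "(\<lambda>t. dv t i) = (\<lambda>t. (\<Sum>j\<in>UNIV. L $ i $ j * v t j) - (\<beta> i * v t i + \<alpha> i * (v t i)\<^sup>2))"
      by (simp add: dv_def psi_def fun_eq_iff)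
    show ?thesis unfolding f
      by ((rule derivative_eq_intros v_has_derivative[OF t] refl | simp)+) (simp add: mult.commute)
  qed
  then show ?thesis by (simp add: algebra_simps)
qed

section \<open>Absorption at zero\<close>

abbreviation XF :: "real \<Rightarrow> (real \<Rightarrow> real^'k) measure" where
  "XF \<equiv> natural_filt (space path_space) (\<lambda>u X. X u) borel"

lemma sets_XF: "sets (XF t) = sigma_sets (space path_space) {(\<lambda>X. X u) -` A \<inter> space path_space | u A. 0 \<le> u \<and> u \<le> t \<and> A \<in> sets borel}"
  unfolding natural_filt_def by (rule sets_measure_of) auto

lemma XF_eval: "0 \<le> u \<Longrightarrow> u \<le> t \<Longrightarrow> B \<in> sets borel \<Longrightarrow> {X \<in> space path_space. X u \<in> B} \<in> sets (XF t)"
proof -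
  assume "0 \<le> u" "u \<le> t" "B \<in> sets borel"
  then have "(\<lambda>X. X u) -` B \<inter> space path_space \<in> sets (XF t)"
    unfolding sets_XF by (intro sigma_sets.Basic) auto
  then show ?thesis by (simp add: vimage_def Int_def conj_commute)
qed

lemma subalgebra_XF: "subalgebra path_space (XF t)"
proof -
  have "sets (XF t) \<subseteq> sets path_space"
    unfolding sets_XF by (intro sets.sigma_sets_subset) (auto intro: measurable_sets[OF borel_measurable_path_eval])
  moreover have "space (XF t) = space path_space"
    unfolding natural_filt_def by (rule space_measure_of) auto
  ultimately show ?thesis by (simp add: subalgebra_def)
qed

text \<open>The simple Markov property at \<open>s\<close>, applied to the event of being 0 after a
  further time \<open>t\<close>, whose probability from \<open>X s\<close> is explicit.\<close>

lemma extinction_markov: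
  assumes \<nu>: "\<nu> \<in> fin_meas" and st: "0 \<le> s" "0 < t" and A: "A \<in> sets (XF s)"
  shows "measure (PX \<nu>) (A \<inter> {X \<in> space path_space. X (s + t) = 0}) = (LINT X|PX \<nu>. indicator A X * exp (- pairing (X s) (v t)))"
proof -
  interpret prob_space "PX \<nu>" by (rule PX_prob[OF \<nu>])
  have sub: "subalgebra (PX \<nu>) (XF s)"
    using subalgebra_XF[of s] by (simp add: subalgebra_def space_PX[OF \<nu>] sets_PX[OF \<nu>])
  have sfs: "sigma_finite_subalgebra (PX \<nu>) (XF s)"
    by (rule finite_measure_subalgebra_is_sigma_finite)
      (rule finite_measure_subalgebra.intro[OF finite_measure_axioms finite_measure_subalgebra_axioms.intro[OF sub]])
  let ?Z = "{X \<in> space path_space. X (s + t) = (0::real^'k)}"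
  have Z: "?Z \<in> sets (PX \<nu>)" using sets_path_event[of "s + t" "{0}"] st sets_PX[OF \<nu>] by auto
  have A': "A \<in> sets (PX \<nu>)" using A sub by (auto simp: subalgebra_def)
  have int: "integrable (PX \<nu>) (indicator ?Z :: _ \<Rightarrow> real)"
    using Z by (intro integrable_real_indicator) (auto simp: emeasure_eq_measure)
  have "AE X in PX \<nu>. real_cond_exp (PX \<nu>) (XF s) (indicator {X'\<in>space path_space. X' (s + t) \<in> {0}}) X =
          measure (PX (X s)) {X'\<in>space path_space. X' t \<in> {0}}"
    using super[unfolded superprocess_def, THEN conjunct2, THEN conjunct2, rule_format, OF \<nu> st(1) less_imp_le[OF st(2)], of "{0}"] by simp
  then have ae: "AE X in PX \<nu>. real_cond_exp (PX \<nu>) (XF s) (indicator ?Z) X = exp (- pairing (X s) (v t))"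
  proof (rule AE_mp, intro AE_I2 impI)
    fix X assume X: "X \<in> space (PX \<nu>)"
      and eq: "real_cond_exp (PX \<nu>) (XF s) (indicator {X'\<in>space path_space. X' (s + t) \<in> {0}}) X =
          measure (PX (X s)) {X'\<in>space path_space. X' t \<in> {0}}"
    have "X s \<in> fin_meas" using X path_spaceD(2)[OF _ st(1)] by (simp add: space_PX[OF \<nu>])
    from extinction_prob[OF this st(2)] eq
    show "real_cond_exp (PX \<nu>) (XF s) (indicator ?Z) X = exp (- pairing (X s) (v t))" by simp
  qed
  have pm: "(\<lambda>X. exp (- pairing (X s) (v t))) \<in> borel_measurable (PX \<nu>)"
    using measurable_compose[OF PX_eval[OF \<nu> st(1)] pairing_measurable[of "v t"]] by measurable
  have "A \<inter> ?Z \<inter> space (PX \<nu>) = A \<inter> ?Z" using sets.sets_into_space[OF A'] by auto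
  then have "measure (PX \<nu>) (A \<inter> ?Z) = (LINT X|PX \<nu>. indicator (A \<inter> ?Z) X)" by simp
  also have "\<dots> = (LINT X:A|PX \<nu>. indicator ?Z X)"
    unfolding set_lebesgue_integral_def by (intro Bochner_Integration.integral_cong) (auto simp: indicator_def)
  also have "\<dots> = (LINT X:A|PX \<nu>. real_cond_exp (PX \<nu>) (XF s) (indicator ?Z) X)"
    by (rule sigma_finite_subalgebra.real_cond_exp_intA[OF sfs int A])
  also have "\<dots> = (LINT X:A|PX \<nu>. exp (- pairing (X s) (v t)))"
    using ae pm A' unfolding set_lebesgue_integral_def by (intro integral_cong_AE) auto
  finally show ?thesis by (simp add: set_lebesgue_integral_def)
qed

text \<open>On \<open>X s = 0\<close> the conditional extinction probability is
  \<open>exp 0 = 1\<close>. The exceptional set depends on \<open>s\<close> and \<open>t\<close>, so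
  visits to 0 at random times require a separate argument.\<close>

lemma absorbed:
  assumes \<nu>: "\<nu> \<in> fin_meas" and st: "0 \<le> s" "s < t"
  shows "measure (PX \<nu>) {X \<in> space path_space. X s = 0 \<and> X t \<noteq> 0} = 0"
proof -
  interpret prob_space "PX \<nu>" by (rule PX_prob[OF \<nu>])
  let ?A = "{X \<in> space path_space. X s = (0::real^'k)}" and ?Z = "{X \<in> space path_space. X t = (0::real^'k)}"
  have A: "?A \<in> sets (XF s)" using XF_eval[of s s "{0}"] st by simp
  have A': "?A \<in> sets (PX \<nu>)" "?Z \<in> sets (PX \<nu>)"
    using sets_path_event[of s "{0}"] sets_path_event[of t "{0}"] st sets_PX[OF \<nu>] by auto
  have "measure (PX \<nu>) (?A \<inter> ?Z) = (LINT X|PX \<nu>. indicator ?A X * exp (- pairing (X s) (v (t - s))))"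
    using extinction_markov[OF \<nu> st(1) _ A, of "t - s"] st by simp
  also have "\<dots> = (LINT X|PX \<nu>. indicator ?A X)"
    by (intro Bochner_Integration.integral_cong) (auto simp: indicator_def pairing_def)
  also have "\<dots> = measure (PX \<nu>) ?A" using sets.sets_into_space[OF A'(1)] by (simp add: Int_absorb2)
  finally have "measure (PX \<nu>) (?A - ?Z) = 0"
    using finite_measure_Diff'[OF A'] by simp
  moreover have "?A - ?Z = {X \<in> space path_space. X s = 0 \<and> X t \<noteq> 0}" by auto
  ultimately show ?thesis by simp
qed

lemma v_antimono:
  assumes st: "0 < s" "s \<le> t"
  shows "v t i \<le> v s i"
proof (cases "s = t")
  case False
  let ?\<nu> = "axis i 1 :: real^'k"
  interpret prob_space "PX ?\<nu>" by (rule PX_prob[OF axis_fin_meas])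
  let ?A = "{X \<in> space path_space. X s = (0::real^'k)}" and ?Z = "{X \<in> space path_space. X t = (0::real^'k)}"
  have A': "?A \<in> events" "?Z \<in> events"
    using sets_path_event[of s "{0}"] sets_path_event[of t "{0}"] st sets_PX[OF axis_fin_meas] by auto
  have "?A - ?Z = {X \<in> space path_space. X s = 0 \<and> X t \<noteq> 0}" by auto
  then have "prob (?A - ?Z) = 0" using absorbed[OF axis_fin_meas, of s t i] st False by simp
  then have "prob ?A = prob (?A \<inter> ?Z)" using finite_measure_Diff'[OF A'] by simp
  also have "\<dots> \<le> prob ?Z" using A' by (intro finite_measure_mono) auto
  finally show ?thesis
    using st extinction_prob[OF axis_fin_meas, of s i] extinction_prob[OF axis_fin_meas, of t i]
    by (simp add: pairing_axis)
qed simp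

end

section \<open>Cluster intensity of a unit mass and measurability of visits to zero\<close>

lemma cluster_intensity_axis:
  fixes N :: "'k::finite \<Rightarrow> (real \<Rightarrow> real^'k) measure"
  assumes N: "\<And>y. sets (N y) = sets path_space"
  shows "cluster_intensity (axis x 1) N = distr (N x) (count_space UNIV \<Otimes>\<^sub>M path_space) (Pair x)"
proof -
  have ax: "ennreal (axis x 1 $ y) * c = (if y = x then c else 0)" for y c
    by (simp add: axis_def)
  show ?thesis
    unfolding cluster_intensity_def distr_def ax
  proof (rule measure_of_eq)
    show "sets (count_space UNIV \<Otimes>\<^sub>M path_space) \<subseteq> Pow (space (count_space UNIV \<Otimes>\<^sub>M path_space))"
      by (rule sets.space_closed)
    fix A :: "('k \<times> (real \<Rightarrow> real^'k)) set" assume "A \<in> sigma_sets (space (count_space UNIV \<Otimes>\<^sub>M path_space)) (sets (count_space UNIV \<Otimes>\<^sub>M path_space))"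
    then have "A \<in> sets (count_space UNIV \<Otimes>\<^sub>M path_space)" by (simp only: sets.sigma_sets_eq)
    then have "Pair x -` A \<in> sets (N x)" using sets_Pair1[of A "count_space UNIV" path_space x] N by simp
    from sets.sets_into_space[OF this] have "Pair x -` A \<inter> space (N x) = Pair x -` A" by blast
    then show "(\<Sum>y\<in>UNIV. if y = x then emeasure (N y) (Pair y -` A) else 0) = emeasure (N x) (Pair x -` A \<inter> space (N x))"
      by simp
  qed
qed

text \<open>A continuous path has a zero on a compact interval exactly when it comes arbitrarily
  close to 0 at rational times: the norm attains its minimum. This describes the visit by countably
  many events.\<close>

lemma path_zero_open_iff:
  assumes X: "X \<in> space path_space" and ab: "0 < a" "a < b"
  shows "(\<exists>r\<in>{a..b}. X r = 0) \<longleftrightarrow> (\<forall>m. \<exists>r\<in>\<rat> \<inter> {a..b}. norm (X r) < 1 / real (Suc m))"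
proof
  have cont: "continuous_on {a..b} (\<lambda>r. norm (X r))"
    by (intro continuous_on_norm continuous_on_subset[OF path_spaceD(1)[OF X]]) (use ab in auto)
  show "\<forall>m. \<exists>r\<in>\<rat> \<inter> {a..b}. norm (X r) < 1 / real (Suc m)" if ex: "\<exists>r\<in>{a..b}. X r = 0"
  proof
    fix m
    obtain r where r: "r \<in> {a..b}" "X r = 0" using ex by auto
    have pos: "0 < 1 / real (Suc m)" by simp
    obtain d where d: "0 < d" "\<And>q. q \<in> {a..b} \<Longrightarrow> \<bar>q - r\<bar> < d \<Longrightarrow> \<bar>norm (X q) - norm (X r)\<bar> < 1 / real (Suc m)"
      using cont[unfolded continuous_on_iff dist_real_def, rule_format, OF r(1) pos] by blast
    have "max a (r - d / 2) < min b (r + d / 2)" using r ab d by auto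
    then obtain q where q: "q \<in> \<rat>" "max a (r - d / 2) < q" "q < min b (r + d / 2)" using Rats_dense_in_real by blast
    then have "\<bar>norm (X q) - norm (X r)\<bar> < 1 / real (Suc m)" using d(1) by (intro d(2)) (auto simp: abs_less_iff)
    then have "norm (X q) < 1 / real (Suc m)" using r by simp
    then show "\<exists>r\<in>\<rat> \<inter> {a..b}. norm (X r) < 1 / real (Suc m)" using q by (intro bexI[of _ q]) auto
  qed
  show "\<exists>r\<in>{a..b}. X r = 0" if *: "\<forall>m. \<exists>r\<in>\<rat> \<inter> {a..b}. norm (X r) < 1 / real (Suc m)"
  proof -
    obtain r where r: "r \<in> {a..b}" "\<And>q. q \<in> {a..b} \<Longrightarrow> norm (X r) \<le> norm (X q)"
      using continuous_attains_inf[OF compact_Icc _ cont] ab by auto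
    have "norm (X r) \<le> 0"
    proof (rule ccontr)
      assume "\<not> norm (X r) \<le> 0"
      then obtain m where "inverse (real (Suc m)) < norm (X r)" using reals_Archimedean[of "norm (X r)"] by auto
      moreover obtain q where "q \<in> {a..b}" "norm (X q) < 1 / real (Suc m)" using *[rule_format, of m] by auto
      ultimately show False using r(2)[of q] by (simp add: inverse_eq_divide)
    qed
    then show ?thesis using r by auto
  qed
qed

definition near_zero :: "real set \<Rightarrow> real \<Rightarrow> (real \<Rightarrow> real^'k::finite) set" where
  "near_zero R \<epsilon> = {X \<in> space path_space. \<exists>r\<in>R. norm (X r) < \<epsilon>}"

definition hits_zero :: "real \<Rightarrow> real \<Rightarrow> (real \<Rightarrow> real^'k::finite) set" where
  "hits_zero a b = {X \<in> space path_space. \<exists>r\<in>{a..b}. X r = 0}"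

lemma near_zero_sets: "countable R \<Longrightarrow> R \<subseteq> {0..} \<Longrightarrow> near_zero R \<epsilon> \<in> sets path_space"
proof -
  assume R: "countable R" "R \<subseteq> {0..}"
  have "near_zero R \<epsilon> = (\<Union>r\<in>R. {X \<in> space path_space. X r \<in> ball 0 \<epsilon>})" by (auto simp: near_zero_def)
  also have "\<dots> \<in> sets path_space"
    using R(2) by (intro sets.countable_UN'[OF R(1)] image_subsetI sets_path_event) auto
  finally show ?thesis .
qed

lemma hits_zero_eq: "0 < a \<Longrightarrow> a < b \<Longrightarrow> hits_zero a b = (\<Inter>m. near_zero (\<rat> \<inter> {a..b}) (1 / real (Suc m)))"
  using path_zero_open_iff[of _ a b] by (auto simp: hits_zero_def near_zero_def)

lemma hits_zero_sets: "0 < a \<Longrightarrow> a < b \<Longrightarrow> hits_zero a b \<in> sets path_space"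
  unfolding hits_zero_eq
  by (intro sets.countable_INT' image_subsetI near_zero_sets countable_Int1 countable_rat) auto

context feller_superprocess
begin

lemma near_zero_XF:
  assumes "finite R" "R \<subseteq> {0..t}"
  shows "near_zero R \<epsilon> \<in> sets (XF t)"
proof -
  have "near_zero R \<epsilon> = (\<Union>r\<in>R. {X \<in> space path_space. X r \<in> ball 0 \<epsilon>})" by (auto simp: near_zero_def)
  also have "\<dots> \<in> sets (XF t)" using assms by (intro sets.finite_UN XF_eval) auto
  finally show ?thesis .
qed

text \<open>Decomposing according to the first time of \<open>R\<close> at which the process is small replaces the
  strong Markov property.\<close>

lemma near_zero_survival_finite:
  assumes \<nu>: "\<nu> \<in> fin_meas" and R: "finite R" "R \<subseteq> {0..b}" and b: "0 \<le> b" "b < t" and \<epsilon>: "0 \<le> \<epsilon>"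
  shows "measure (PX \<nu>) (near_zero R \<epsilon> - {X \<in> space path_space. X t = 0}) \<le>
    (1 - exp (- (real CARD('k) * bound_fun (t - b) * \<epsilon>))) * measure (PX \<nu>) (near_zero R \<epsilon>)"
  using R
proof (induction R rule: finite_linorder_max_induct)
  case empty
  then show ?case by (simp add: near_zero_def)
next
  case (insert r R)
  interpret prob_space "PX \<nu>" by (rule PX_prob[OF \<nu>])
  let ?Z = "{X \<in> space path_space. X t = (0::real^'k)}"
  let ?\<delta> = "1 - exp (- (real CARD('k) * bound_fun (t - b) * \<epsilon>))"
  \<comment> \<open>The induction adds the largest time \<open>r\<close>, so \<open>D\<close> is the
    event that \<open>r\<close> is the first time in the set at which the path is small; it is known
    at time \<open>r\<close>.\<close>
  define D :: "(real \<Rightarrow> real^'k) set" where "D = {X \<in> space path_space. X r \<in> ball 0 \<epsilon>} - near_zero R \<epsilon>"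
  have r: "0 \<le> r" "r \<le> b" using insert by auto
  have Rr: "R \<subseteq> {0..r}"
  proof
    fix q assume "q \<in> R"
    then show "q \<in> {0..r}" using insert.hyps(2) insert.prems by (auto simp: less_imp_le subset_iff)
  qed
  have D: "D \<in> sets (XF r)"
    unfolding D_def using insert.hyps(1) Rr r by (intro sets.Diff XF_eval near_zero_XF) auto
  have Zev: "?Z \<in> events" using sets_path_event[of t "{0}"] b sets_PX[OF \<nu>] by auto
  have Dev: "D \<in> events" using D subalgebra_XF[of r] by (auto simp: subalgebra_def sets_PX[OF \<nu>])
  have Nev: "near_zero R \<epsilon> \<in> events"
    using Rr unfolding sets_PX[OF \<nu>] by (intro near_zero_sets countable_finite insert.hyps) auto
  have split: "near_zero (insert r R) \<epsilon> = near_zero R \<epsilon> \<union> D" "near_zero R \<epsilon> \<inter> D = {}"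
    by (auto simp: near_zero_def D_def)
  have "prob (D \<inter> ?Z) \<ge> (LINT X|PX \<nu>. indicator D X * exp (- (real CARD('k) * bound_fun (t - b) * \<epsilon>)))"
  proof -
    have tr: "0 < t - r" using r b by simp
    have pm: "(\<lambda>X. exp (- pairing (X r) (v (t - r)))) \<in> borel_measurable (PX \<nu>)"
      using measurable_compose[OF PX_eval[OF \<nu> r(1)] pairing_measurable[of "v (t - r)"]] by measurable
    have "prob (D \<inter> ?Z) = (LINT X|PX \<nu>. indicator D X * exp (- pairing (X r) (v (t - r))))"
      using extinction_markov[OF \<nu> r(1) tr D] by simp
    also have "\<dots> \<ge> (LINT X|PX \<nu>. indicator D X * exp (- (real CARD('k) * bound_fun (t - b) * \<epsilon>)))"
    proof (rule Bochner_Integration.integral_mono)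
      show "integrable (PX \<nu>) (\<lambda>X. indicator D X * exp (- (real CARD('k) * bound_fun (t - b) * \<epsilon>)))"
        using Dev by (intro integrable_mult_left integrable_real_indicator) (auto simp: emeasure_eq_measure)
      have "0 \<le> pairing (X r) (v (t - r))" if "X \<in> space (PX \<nu>)" for X
        using path_spaceD(2)[of X r] that r v_bounds(1)[OF tr]
        by (auto simp: pairing_def fin_meas_def space_PX[OF \<nu>] intro!: sum_nonneg)
      then show "integrable (PX \<nu>) (\<lambda>X. indicator D X * exp (- pairing (X r) (v (t - r))))"
        using pm Dev by (intro integrable_const_bound[where B = 1]) (auto simp: indicator_def)
      fix X assume X: "X \<in> space (PX \<nu>)"
      show "indicator D X * exp (- (real CARD('k) * bound_fun (t - b) * \<epsilon>)) \<le> indicator D X * exp (- pairing (X r) (v (t - r)))"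
      proof (cases "X \<in> D")
        case True
        then have nX: "norm (X r) < \<epsilon>" by (auto simp: D_def)
        have "pairing (X r) (v (t - r)) \<le> (\<Sum>i\<in>(UNIV::'k set). \<epsilon> * bound_fun (t - b))"
          unfolding pairing_def
        proof (intro sum_mono mult_mono)
          fix i
          show "X r $ i \<le> \<epsilon>" using component_le_norm_cart[of "X r" i] nX by linarith
          \<comment> \<open>Whatever the visit time \<open>r \<le> b\<close>, at least
            \<open>t - b\<close> remains until \<open>t\<close>, so the bound does not depend on
            \<open>r\<close>.\<close>
          show "v (t - r) i \<le> bound_fun (t - b)"
            using v_bounds(2)[OF tr, of i] bound_fun_antimono[of "t - b" "t - r"] r b by auto
          show "0 \<le> v (t - r) i" by (rule v_bounds[OF tr])
        qed (rule \<epsilon>)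
        then have "pairing (X r) (v (t - r)) \<le> real CARD('k) * bound_fun (t - b) * \<epsilon>" by (simp add: mult_ac)
        then show ?thesis by (intro mult_left_mono) auto
      qed simp
    qed
    finally show ?thesis .
  qed
  then have "prob (D \<inter> ?Z) \<ge> prob D * exp (- (real CARD('k) * bound_fun (t - b) * \<epsilon>))"
    using sets.sets_into_space[OF Dev] by (simp add: Int_absorb2)
  then have D_le: "prob (D - ?Z) \<le> ?\<delta> * prob D"
    using finite_measure_Diff'[OF Dev Zev] by (simp add: algebra_simps)
  have "near_zero (insert r R) \<epsilon> - ?Z = (near_zero R \<epsilon> - ?Z) \<union> (D - ?Z)" using split by auto
  then have "prob (near_zero (insert r R) \<epsilon> - ?Z) = prob (near_zero R \<epsilon> - ?Z) + prob (D - ?Z)"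
    using split Nev Dev Zev by (simp, subst finite_measure_Union) auto
  also have "\<dots> \<le> ?\<delta> * prob (near_zero R \<epsilon>) + ?\<delta> * prob D"
    using insert D_le by (intro add_mono) auto
  also have "\<dots> = ?\<delta> * prob (near_zero (insert r R) \<epsilon>)"
    using split Nev Dev by (simp add: finite_measure_Union distrib_left)
  finally show ?case .
qed

text \<open>Finite initial segments of an enumeration of \<open>R\<close> exhaust the event, and the
  bound does not see how many times they contain.\<close>

lemma near_zero_survival:
  assumes \<nu>: "\<nu> \<in> fin_meas" and R: "countable R" "R \<subseteq> {0..b}" and b: "0 \<le> b" "b < t" and \<epsilon>: "0 \<le> \<epsilon>"
  shows "measure (PX \<nu>) (near_zero R \<epsilon> - {X \<in> space path_space. X t = 0}) \<le>
    1 - exp (- (real CARD('k) * bound_fun (t - b) * \<epsilon>))"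
proof (cases "R = {}")
  case True
  have "0 \<le> bound_fun (t - b)" using v_bounds[of "t - b" undefined] b by auto
  then show ?thesis using True \<epsilon> by (simp add: near_zero_def)
next
  case False
  interpret prob_space "PX \<nu>" by (rule PX_prob[OF \<nu>])
  let ?Z = "{X \<in> space path_space. X t = (0::real^'k)}"
  let ?\<delta> = "1 - exp (- (real CARD('k) * bound_fun (t - b) * \<epsilon>))"
  define E where "E n = near_zero (from_nat_into R ` {..n}) \<epsilon> - ?Z" for n :: nat
  have sub: "from_nat_into R ` {..n} \<subseteq> {0..b}" for n using from_nat_into[OF False] R(2) by auto
  have Zev: "?Z \<in> events" using sets_path_event[of t "{0}"] b sets_PX[OF \<nu>] by auto
  have Eev: "range E \<subseteq> events"
    unfolding E_def using sub Zev
    by (auto simp: sets_PX[OF \<nu>] intro!: sets.Diff near_zero_sets) (meson atLeastAtMost_iff image_subset_iff atMost_iff)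
  have "incseq E" unfolding E_def incseq_def near_zero_def by fastforce
  then have lim: "(\<lambda>n. prob (E n)) \<longlonglongrightarrow> prob (\<Union>n. E n)" by (rule finite_Lim_measure_incseq[OF Eev])
  have "(\<Union>n. E n) = near_zero R \<epsilon> - ?Z"
  proof -
    have "near_zero R \<epsilon> \<subseteq> (\<Union>n. near_zero (from_nat_into R ` {..n}) \<epsilon>)"
    proof
      fix X assume "X \<in> near_zero R \<epsilon>"
      then obtain r where r: "X \<in> space path_space" "r \<in> R" "norm (X r) < \<epsilon>" by (auto simp: near_zero_def)
      obtain n where "from_nat_into R n = r" using from_nat_into_surj[OF R(1) r(2)] by auto
      then show "X \<in> (\<Union>n. near_zero (from_nat_into R ` {..n}) \<epsilon>)" using r by (auto simp: near_zero_def)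
    qed
    moreover have "near_zero (from_nat_into R ` {..n}) \<epsilon> \<subseteq> near_zero R \<epsilon>" for n
      using from_nat_into[OF False] by (auto simp: near_zero_def)
    ultimately show ?thesis unfolding E_def by auto
  qed
  with lim have lim: "(\<lambda>n. prob (E n)) \<longlonglongrightarrow> prob (near_zero R \<epsilon> - ?Z)" by simp
  have "prob (E n) \<le> ?\<delta>" for n
  proof -
    have "0 \<le> bound_fun (t - b)" using v_bounds[of "t - b" undefined] b by auto
    then have "0 \<le> ?\<delta>" using \<epsilon> by simp
    then have "?\<delta> * prob (near_zero (from_nat_into R ` {..n}) \<epsilon>) \<le> ?\<delta>" by (intro mult_left_le) auto
    then show ?thesis unfolding E_def
      using near_zero_survival_finite[OF \<nu> _ sub[of n] b \<epsilon>] by fastforce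
  qed
  then show ?thesis by (intro LIMSEQ_le_const2[OF lim]) auto
qed

text \<open>A path with a zero in \<open>[a, b]\<close> is within \<open>1 / Suc m\<close> of 0 at
  some rational time, for every \<open>m\<close>; the resulting survival bounds tend to 0. The gap
  \<open>t - b > 0\<close> keeps \<open>bound_fun\<close> away from its singularity.\<close>

lemma no_return:
  assumes \<nu>: "\<nu> \<in> fin_meas" and ab: "0 < a" "a < b" "b < t"
  shows "measure (PX \<nu>) (hits_zero a b - {X \<in> space path_space. X t = 0}) = 0"
proof -
  interpret prob_space "PX \<nu>" by (rule PX_prob[OF \<nu>])
  let ?Z = "{X \<in> space path_space. X t = (0::real^'k)}"
  let ?k = "real CARD('k) * bound_fun (t - b)"
  have Zev: "?Z \<in> events" using sets_path_event[of t "{0}"] ab sets_PX[OF \<nu>] by auto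
  have R: "countable (\<rat> \<inter> {a..b})" "\<rat> \<inter> {a..b} \<subseteq> {0..b}" using ab by (auto intro: countable_Int1 countable_rat)
  have "prob (hits_zero a b - ?Z) \<le> 1 - exp (- (?k * (1 / real (Suc m))))" for m
  proof -
    have "near_zero (\<rat> \<inter> {a..b}) (1 / real (Suc m)) \<in> events"
      using R by (auto simp: sets_PX[OF \<nu>] intro!: near_zero_sets)
    then have "prob (hits_zero a b - ?Z) \<le> prob (near_zero (\<rat> \<inter> {a..b}) (1 / real (Suc m)) - ?Z)"
      using ab Zev by (intro finite_measure_mono) (auto simp: hits_zero_eq)
    also have "\<dots> \<le> 1 - exp (- (?k * (1 / real (Suc m))))"
      using ab by (intro near_zero_survival[OF \<nu> R]) auto
    finally show ?thesis .
  qed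
  moreover have "(\<lambda>m. 1 - exp (- (?k * (1 / real (Suc m))))) \<longlonglongrightarrow> 1 - exp (- (?k * 0))"
    using LIMSEQ_inverse_real_of_nat by (intro tendsto_intros) (simp add: inverse_eq_divide)
  ultimately have "prob (hits_zero a b - ?Z) \<le> 1 - exp (- (?k * 0))"
    by (intro LIMSEQ_le_const) auto
  then show ?thesis by (simp add: order_antisym)
qed

end

section \<open>Extinction times under the canonical measures\<close>

lemma point_count_eq_0_iff: "point_count Z A w = 0 \<longleftrightarrow> (\<forall>n. Z n w \<notin> Some ` A)"
  unfolding point_count_def by (subst suminf_eq_zero_iff) (auto simp: indicator_def)

lemma point_count_eq_1D:
  assumes "point_count Z A w = 1"
  obtains n a where "Z n w = Some a" "a \<in> A" "\<And>m. m \<noteq> n \<Longrightarrow> Z m w \<notin> Some ` A"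
proof -
  have "point_count Z A w \<noteq> 0" using assms by simp
  then obtain n where n: "Z n w \<in> Some ` A" unfolding point_count_eq_0_iff by auto
  have "Z m w \<notin> Some ` A" if "m \<noteq> n" for m
  proof
    assume m: "Z m w \<in> Some ` A"
    have "(\<Sum>k\<in>{m, n}. indicator (Some ` A) (Z k w)) \<le> point_count Z A w"
      unfolding point_count_def by (rule sum_le_suminf) auto
    then have "(2::ennreal) \<le> 1" using that m n assms by simp
    then show False by simp
  qed
  with n show thesis using that by auto
qed

lemma fin_meas_zero_iff: "m \<in> fin_meas \<Longrightarrow> m = 0 \<longleftrightarrow> (\<forall>i. ennreal (m $ i) = 0)"
  by (auto simp: vec_eq_iff fin_meas_def ennreal_eq_0_iff intro: antisym)

lemma path_nonzero_near:
  assumes X: "X \<in> space path_space" and r: "0 \<le> r" "X r \<noteq> 0"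
  obtains d where "0 < d" "\<And>q. 0 \<le> q \<Longrightarrow> dist q r < d \<Longrightarrow> X q \<noteq> 0"
proof -
  have "r \<in> {0..}" "0 < norm (X r)" using r by auto
  from path_spaceD(1)[OF X, unfolded continuous_on_iff, rule_format, OF this]
  obtain d where d: "0 < d" "\<And>q. q \<in> {0..} \<Longrightarrow> dist q r < d \<Longrightarrow> dist (X q) (X r) < norm (X r)" by blast
  have "X q \<noteq> 0" if "0 \<le> q" "dist q r < d" for q
  proof
    assume "X q = 0"
    with d(2)[of q] that show False by (simp add: dist_norm)
  qed
  with d(1) show thesis by (rule that)
qed

text \<open>A zero before \<open>t\<close> is enclosed in a rational interval ending before
  \<open>t\<close>, the form in which returns are excluded. If \<open>X t \<noteq> 0\<close>,
  continuity keeps the path off 0 shortly after \<open>t\<close>, which makes the inequality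
  strict.\<close>

lemma ereal_less_H_max_iff:
  assumes X: "X \<in> space path_space" and t: "0 < t"
  shows "ereal t < H_max X \<longleftrightarrow> X t \<noteq> 0 \<and> (\<forall>a\<in>\<rat>. \<forall>b\<in>\<rat>. 0 < a \<and> a < b \<and> b < t \<longrightarrow> X \<notin> hits_zero a b)"
proof
  assume H: "ereal t < H_max X"
  have nz: "X r \<noteq> 0" if "0 < r" "r \<le> t" for r
  proof
    assume "X r = 0"
    then have "H_max X \<le> ereal r" unfolding H_max_def using that by (intro Inf_lower) auto
    also have "\<dots> \<le> ereal t" using that by simp
    finally show False using H by simp
  qed
  show "X t \<noteq> 0 \<and> (\<forall>a\<in>\<rat>. \<forall>b\<in>\<rat>. 0 < a \<and> a < b \<and> b < t \<longrightarrow> X \<notin> hits_zero a b)"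
    using nz t by (auto simp: hits_zero_def)
next
  assume *: "X t \<noteq> 0 \<and> (\<forall>a\<in>\<rat>. \<forall>b\<in>\<rat>. 0 < a \<and> a < b \<and> b < t \<longrightarrow> X \<notin> hits_zero a b)"
  have nz: "X r \<noteq> 0" if r: "0 < r" "r < t" for r
  proof
    assume z: "X r = 0"
    obtain a where a: "a \<in> \<rat>" "0 < a" "a < r" using Rats_dense_in_real[OF r(1)] by auto
    obtain b where b: "b \<in> \<rat>" "r < b" "b < t" using Rats_dense_in_real[OF r(2)] by auto
    have "X \<in> hits_zero a b" using X z a b by (auto simp: hits_zero_def intro!: bexI[of _ r])
    then show False using * a b by auto
  qed
  obtain d where d: "0 < d" "\<And>r. 0 \<le> r \<Longrightarrow> dist r t < d \<Longrightarrow> X r \<noteq> 0"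
    using path_nonzero_near[OF X less_imp_le[OF t] *[THEN conjunct1]] by blast
  have "ereal (t + d) \<le> H_max X"
    unfolding H_max_def
  proof (rule Inf_greatest)
    fix e assume "e \<in> {ereal t |t. 0 < t \<and> X t = 0}"
    then obtain r where r: "e = ereal r" "0 < r" "X r = 0" by auto
    have "\<not> r < t" using nz[of r] r by auto
    moreover have "\<not> dist r t < d" using d(2)[of r] r by auto
    ultimately show "ereal (t + d) \<le> e" using r by (auto simp: dist_real_def)
  qed
  then show "ereal t < H_max X" using d by (meson ereal_less_ereal_Ex less_add_same_cancel1 less_ereal.simps(1) less_le_trans)
qed

section \<open>Clusters of the superprocess started from a unit mass\<close>

locale poisson_realisation = feller_superprocess p L P Y \<alpha> \<beta> PX
  for p :: "real \<Rightarrow> 'k::finite \<Rightarrow> 'k \<Rightarrow> real" and L :: "real^'k^'k"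
    and P :: "'k \<Rightarrow> 'a measure" and Y :: "real \<Rightarrow> 'a \<Rightarrow> 'k" and \<alpha> \<beta> PX +
  fixes Nx :: "(real \<Rightarrow> real^'k) measure" and x :: 'k and W :: "'w measure" and Z S
  assumes sets_Nx: "sets Nx = sets path_space" and Nx_sigma: "sigma_finite_measure Nx"
    and ppm: "poisson_point_measure W (distr Nx (count_space UNIV \<Otimes>\<^sub>M path_space) (Pair x)) Z"
    and soc: "sum_of_clusters W Z S" and dist: "distr W path_space S = PX (axis x 1)"
begin

abbreviation "\<mu> \<equiv> distr Nx (count_space UNIV \<Otimes>\<^sub>M path_space) (Pair x)"
abbreviation "cnt A \<equiv> point_count Z (UNIV \<times> A)"
abbreviation "alive t \<equiv> {X \<in> space path_space. X t \<noteq> (0::real^'k)}"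

sublocale W: prob_space W
  using ppm by (simp add: poisson_point_measure_def)

lemma space_Nx: "space Nx = space path_space"
  using sets_eq_imp_space_eq[OF sets_Nx] .

lemma cylinder: "A \<in> sets path_space \<Longrightarrow> UNIV \<times> A \<in> sets \<mu>"
  by (simp add: pair_measureI)

lemma emeasure_cylinder: "A \<in> sets path_space \<Longrightarrow> emeasure \<mu> (UNIV \<times> A) = emeasure Nx A"
proof -
  assume A: "A \<in> sets path_space"
  have "Pair x \<in> measurable Nx (count_space UNIV \<Otimes>\<^sub>M path_space)"
    by (simp add: measurable_cong_sets[OF sets_Nx refl] measurable_Pair1')
  then have "emeasure \<mu> (UNIV \<times> A) = emeasure Nx (Pair x -` (UNIV \<times> A) \<inter> space Nx)"
    using cylinder[OF A] by (intro emeasure_distr) auto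
  also have "Pair x -` (UNIV \<times> A) \<inter> space Nx = A" using sets.sets_into_space[OF A] by (auto simp: space_Nx)
  finally show ?thesis .
qed

lemma measure_cylinder: "A \<in> sets path_space \<Longrightarrow> measure \<mu> (UNIV \<times> A) = measure Nx A"
  using emeasure_cylinder by (simp add: measure_def)

lemma poisson_law:
  assumes "A \<in> sets path_space" "emeasure Nx A < \<infinity>"
  shows "measure W {w\<in>space W. cnt A w = of_nat n} = exp (- measure Nx A) * measure Nx A ^ n / fact n"
proof -
  have "\<forall>A\<in>sets \<mu>. emeasure \<mu> A < \<infinity> \<longrightarrow>
        (\<forall>n::nat. measure W {w\<in>space W. point_count Z A w = of_nat n} =
           exp (- measure \<mu> A) * measure \<mu> A ^ n / fact n)"
    using ppm unfolding poisson_point_measure_def by blast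
  from this[rule_format, OF cylinder[OF assms(1)], of n] show ?thesis
    using assms by (simp add: emeasure_cylinder measure_cylinder)
qed

lemma cnt_measurable: "A \<in> sets path_space \<Longrightarrow> cnt A \<in> borel_measurable W"
proof -
  assume A: "A \<in> sets path_space"
  have Zn: "{w \<in> space W. Z n w \<in> Some ` (UNIV \<times> A)} \<in> sets W" for n
    using ppm cylinder[OF A] unfolding poisson_point_measure_def by blast
  have "(\<lambda>w. indicator (Some ` (UNIV \<times> A)) (Z n w) :: ennreal) \<in> borel_measurable W" for n
  proof -
    have "(\<lambda>w. indicator {w \<in> space W. Z n w \<in> Some ` (UNIV \<times> A)} w :: ennreal) \<in> borel_measurable W"
      using Zn by (intro borel_measurable_indicator)
    then show ?thesis
      by (rule measurable_cong[THEN iffD1, rotated]) (auto simp: indicator_def)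
  qed
  then show ?thesis unfolding point_count_def[abs_def] by (intro borel_measurable_suminf_order)
qed

lemma cnt_event: "A \<in> sets path_space \<Longrightarrow> {w\<in>space W. cnt A w = c} \<in> W.events"
  using measurable_sets[OF cnt_measurable, of A "{c}"] by (simp add: vimage_def Int_def conj_commute)

lemma cnt_mono: "A \<subseteq> B \<Longrightarrow> cnt B w = 0 \<Longrightarrow> cnt A w = 0"
  unfolding point_count_eq_0_iff by auto

text \<open>The Poisson law is available only on sets of finite intensity. A positive void
  probability bounds the mass of every subset of finite mass, and \<sigma>-finiteness then excludes
  infinite mass.\<close>

lemma void_probability:
  assumes A: "A \<in> sets path_space" and pos: "0 < measure W {w\<in>space W. cnt A w = 0}"
  shows "emeasure Nx A < \<infinity>" "measure Nx A = - ln (measure W {w\<in>space W. cnt A w = 0})"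
proof -
  let ?q = "measure W {w\<in>space W. cnt A w = 0}"
  interpret Nx: sigma_finite_measure Nx by (rule Nx_sigma)
  have le: "measure Nx B \<le> - ln ?q" if B: "B \<in> sets path_space" "B \<subseteq> A" "emeasure Nx B < \<infinity>" for B
  proof -
    have "?q \<le> measure W {w\<in>space W. cnt B w = 0}"
      using cnt_mono[OF B(2)] cnt_event[OF B(1)] by (intro W.finite_measure_mono) auto
    also have "\<dots> = exp (- measure Nx B)" using poisson_law[OF B(1,3), of 0] by simp
    finally have "ln ?q \<le> - measure Nx B" using pos by (metis exp_gt_zero ln_exp ln_le_cancel_iff)
    then show ?thesis by simp
  qed
  show fin: "emeasure Nx A < \<infinity>"
  proof (rule ccontr)
    assume "\<not> emeasure Nx A < \<infinity>"
    then have inf: "emeasure Nx A = \<infinity>" by (metis infinity_ennreal_def top.not_eq_extremum)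
    obtain B where B: "B \<in> sets Nx" "B \<subseteq> A" "emeasure Nx B < \<infinity>" "emeasure Nx B > ennreal (- ln ?q)"
      using Nx.approx_PInf_emeasure_with_finite[OF A[folded sets_Nx] inf, of "- ln ?q"] by blast
    have "measure Nx B \<le> - ln ?q" using B sets_Nx by (intro le) auto
    then have "emeasure Nx B \<le> ennreal (- ln ?q)"
      using B(3) by (simp add: emeasure_eq_ennreal_measure less_top ennreal_leI)
    then show False using B(4) by simp
  qed
  show "measure Nx A = - ln ?q" using poisson_law[OF A fin, of 0] by simp
qed

lemma S_path: "w \<in> space W \<Longrightarrow> S w \<in> space path_space"
  using soc unfolding sum_of_clusters_def by (auto dest: measurable_space)

lemma AE_sum: "AE w in W. \<forall>t>0. \<forall>i. ennreal (S w t $ i) =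
        (\<Sum>n. case Z n w of None \<Rightarrow> 0 | Some (y, X) \<Rightarrow> ennreal (X t $ i))"
  using soc unfolding sum_of_clusters_def by blast

lemma Z_space: "w \<in> space W \<Longrightarrow> Z n w = Some (y, X) \<Longrightarrow> X \<in> space path_space"
proof -
  assume w: "w \<in> space W" "Z n w = Some (y, X)"
  have "Z n w \<in> insert None (Some ` space \<mu>)"
    using ppm w(1) unfolding poisson_point_measure_def by blast
  then show ?thesis using w(2) by (auto simp: space_pair_measure)
qed

lemma measure_distr_S: "B \<in> sets path_space \<Longrightarrow> measure (PX (axis x 1)) B = measure W {w \<in> space W. S w \<in> B}"
  using soc unfolding sum_of_clusters_def dist[symmetric]
  by (subst measure_distr) (auto simp: vimage_def Int_def conj_commute)

lemma alive_sets: "0 \<le> t \<Longrightarrow> alive t \<in> sets path_space"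
  using sets_path_event[of t "- {0}"] by simp

lemma dead_sets: "0 \<le> t \<Longrightarrow> {X \<in> space path_space. X t = (0::real^'k)} \<in> sets path_space"
  using sets_path_event[of t "{0}"] by simp

text \<open>A sum of nonnegative vectors vanishes only if all terms do. The exceptional set is the
  same for all times, since the superposition holds at all positive times at once.\<close>

lemma AE_sum_zero_iff: "AE w in W. \<forall>t>0. S w t = 0 \<longleftrightarrow> cnt (alive t) w = 0"
  using AE_sum
proof (rule AE_mp, intro AE_I2 impI allI)
  fix w t assume w: "w \<in> space W" and t: "(0::real) < t"
    and eq: "\<forall>t>0. \<forall>i. ennreal (S w t $ i) = (\<Sum>n. case Z n w of None \<Rightarrow> 0 | Some (y, X) \<Rightarrow> ennreal (X t $ i))"
  have "S w t = 0 \<longleftrightarrow> (\<forall>i. (\<Sum>n. case Z n w of None \<Rightarrow> 0 | Some (y, X) \<Rightarrow> ennreal (X t $ i)) = 0)"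
    using fin_meas_zero_iff[OF path_spaceD(2)[OF S_path[OF w] less_imp_le[OF t]]] eq t by simp
  also have "\<dots> \<longleftrightarrow> (\<forall>i n. (case Z n w of None \<Rightarrow> 0 | Some (y, X) \<Rightarrow> ennreal (X t $ i)) = 0)"
    by (subst suminf_eq_zero_iff) (auto intro: summableI split: option.split)
  also have "\<dots> \<longleftrightarrow> (\<forall>n y X. Z n w = Some (y, X) \<longrightarrow> X t = 0)"
  proof (intro iffI allI impI)
    fix n y X assume *: "\<forall>i n. (case Z n w of None \<Rightarrow> 0 | Some (y, X) \<Rightarrow> ennreal (X t $ i)) = 0" and n: "Z n w = Some (y, X)"
    have "ennreal (X t $ i) = 0" for i using *[rule_format, of i n] n by auto
    then show "X t = 0" using fin_meas_zero_iff[OF path_spaceD(2)[OF Z_space[OF w n] less_imp_le[OF t]]] by simp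
  next
    fix i n assume *: "\<forall>n y X. Z n w = Some (y, X) \<longrightarrow> X t = 0"
    show "(case Z n w of None \<Rightarrow> 0 | Some (y, X) \<Rightarrow> ennreal (X t $ i)) = 0"
    proof (cases "Z n w")
      case (Some z)
      obtain y X where z: "z = (y, X)" by (cases z)
      have "X t = 0" using *[rule_format, of n y X] Some z by simp
      then show ?thesis using Some z by simp
    qed simp
  qed
  also have "\<dots> \<longleftrightarrow> cnt (alive t) w = 0"
    unfolding point_count_eq_0_iff using Z_space[OF w] by fastforce
  finally show "S w t = 0 \<longleftrightarrow> cnt (alive t) w = 0" .
qed

lemma void_alive:
  assumes t: "0 < t"
  shows "measure W {w\<in>space W. cnt (alive t) w = 0} = exp (- v t x)"
proof -
  have "exp (- v t x) = measure W {w \<in> space W. S w \<in> {X \<in> space path_space. X t = 0}}"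
    using extinction_prob[OF axis_fin_meas t, of x] measure_distr_S[OF dead_sets, of t] t by (simp add: pairing_axis)
  also have "\<dots> = measure W {w\<in>space W. cnt (alive t) w = 0}"
  proof (rule W.finite_measure_eq_AE)
    show "AE w in W. w \<in> {w \<in> space W. S w \<in> {X \<in> space path_space. X t = 0}} \<longleftrightarrow> w \<in> {w\<in>space W. cnt (alive t) w = 0}"
      using AE_sum_zero_iff AE_space by eventually_elim (use t S_path in auto)
    show "{w \<in> space W. S w \<in> {X \<in> space path_space. X t = 0}} \<in> W.events"
      using soc measurable_sets[of S W path_space, OF _ dead_sets[of t]] t unfolding sum_of_clusters_def
      by (simp add: vimage_def Int_def conj_commute)
    show "{w\<in>space W. cnt (alive t) w = 0} \<in> W.events" using t by (intro cnt_event alive_sets) auto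
  qed
  finally show ?thesis ..
qed

lemma N_alive:
  assumes t: "0 < t"
  shows "emeasure Nx (alive t) < \<infinity>" "measure Nx (alive t) = v t x"
  using void_probability[OF alive_sets, of t] void_alive[OF t] t by auto

text \<open>By absorption the sum has the same chance of avoiding \<open>alive s\<close> as of
  avoiding \<open>alive s \<union> alive t\<close>. Void probabilities determine masses, so the two
  sets have equal mass, and finiteness allows the subtraction.\<close>

lemma N_absorbed:
  assumes st: "0 < s" "s < t"
  shows "emeasure Nx (alive t - alive s) = 0"
proof -
  let ?B = "alive s \<union> alive t"
  have B: "?B \<in> sets path_space" using st by (intro sets.Un alive_sets) auto
  have "measure W {w\<in>space W. cnt ?B w = 0} = measure W {w\<in>space W. cnt (alive s) w = 0}"
  proof (rule W.finite_measure_eq_AE)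
    have "emeasure (PX (axis x 1)) {X \<in> space path_space. X s = 0 \<and> X t \<noteq> 0} = 0"
      using absorbed[OF axis_fin_meas, of s t x] st prob_space.finite_measure[OF PX_prob[OF axis_fin_meas]]
      by (simp add: finite_measure.emeasure_eq_measure)
    moreover have "{X \<in> space path_space. X s = 0 \<and> X t \<noteq> (0::real^'k)} \<in> sets path_space"
    proof -
      have "{X \<in> space path_space. X s = 0 \<and> X t \<noteq> (0::real^'k)} = alive t - alive s" by auto
      then show ?thesis using st by (simp add: alive_sets sets.Diff)
    qed
    ultimately have "AE X in PX (axis x 1). \<not> (X s = 0 \<and> X t \<noteq> 0)"
      by (intro AE_I'[of "{X \<in> space path_space. X s = 0 \<and> X t \<noteq> 0}"])
        (auto simp: null_sets_def sets_PX[OF axis_fin_meas] space_PX[OF axis_fin_meas])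
    then have "AE w in W. \<not> (S w s = 0 \<and> S w t \<noteq> 0)"
      unfolding dist[symmetric] using soc unfolding sum_of_clusters_def
      by (intro AE_distrD[of S W path_space]) auto
    then show "AE w in W. w \<in> {w\<in>space W. cnt ?B w = 0} \<longleftrightarrow> w \<in> {w\<in>space W. cnt (alive s) w = 0}"
      using AE_sum_zero_iff
    proof eventually_elim
      case (elim w)
      have "cnt ?B w = 0 \<longleftrightarrow> cnt (alive s) w = 0 \<and> cnt (alive t) w = 0"
        unfolding point_count_eq_0_iff by auto
      then show ?case using elim st by auto
    qed
  qed (use B st in \<open>auto intro!: cnt_event alive_sets\<close>)
  then have "measure W {w\<in>space W. cnt ?B w = 0} = exp (- v s x)" using void_alive[OF st(1)] by simp
  then have mB: "emeasure Nx ?B < \<infinity>" "measure Nx ?B = v s x"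
    using void_probability[OF B] by auto
  have "emeasure Nx ?B = emeasure Nx (alive s)"
    using mB N_alive[OF st(1)] by (simp add: emeasure_eq_ennreal_measure less_top)
  moreover have "emeasure Nx ?B = emeasure Nx (alive s) + emeasure Nx (alive t - alive s)"
    using st by (subst plus_emeasure) (auto simp: sets_Nx alive_sets sets.Diff intro: arg_cong[where f = "emeasure Nx"])
  ultimately have "emeasure Nx (alive s) + emeasure Nx (alive t - alive s) = emeasure Nx (alive s) + 0" by simp
  then show ?thesis using N_alive(1)[OF st(1)] by (simp only: ennreal_add_left_cancel) auto
qed

text \<open>Let \<open>B\<close> be the set of returning paths and \<open>C\<close> the other paths
  alive at \<open>a\<close>. If there is one cluster in \<open>B\<close> and none in
  \<open>C\<close>, the sum equals that cluster from time \<open>a\<close> on and returns from 0,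
  which has probability 0. By independence this event has probability
  \<open>exp (- N B) * N B * exp (- N C)\<close>, with \<open>N\<close> the measure
  \<open>Nx\<close>; hence \<open>B\<close> is null.\<close>

lemma N_no_return:
  assumes ab: "0 < a" "a < b" "b < t"
  shows "emeasure Nx (alive a \<inter> alive t \<inter> hits_zero a b) = 0"
proof -
  define B where "B = alive a \<inter> alive t \<inter> hits_zero a b"
  define C where "C = alive a - B"
  have Bs: "B \<in> sets path_space" unfolding B_def using ab by (intro sets.Int alive_sets hits_zero_sets) auto
  have Cs: "C \<in> sets path_space" unfolding C_def using Bs ab by (intro sets.Diff alive_sets) auto
  have BC: "B \<inter> C = {}" "alive a = B \<union> C" by (auto simp: B_def C_def)
  have fin: "emeasure Nx B < \<infinity>" "emeasure Nx C < \<infinity>"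
    using emeasure_mono[of B "alive a" Nx] emeasure_mono[of C "alive a" Nx] BC N_alive(1)[OF ab(1)] alive_sets[of a] ab
    by (auto simp: sets_Nx intro: le_less_trans)
  \<comment> \<open>Independence is stated for sequences of disjoint sets, so \<open>B\<close> and
    \<open>C\<close> are padded with empty sets.\<close>
  define A :: "nat \<Rightarrow> ('k \<times> (real \<Rightarrow> real^'k)) set" where "A n = UNIV \<times> (if n = 0 then B else if n = 1 then C else {})" for n :: nat
  have "range A \<subseteq> sets \<mu>" unfolding A_def using Bs Cs by (auto intro!: cylinder)
  moreover have "disjoint_family A" unfolding A_def disjoint_family_on_def using BC by auto
  ultimately have ind: "W.indep_vars (\<lambda>_. borel) (\<lambda>i. point_count Z (A i)) UNIV"
    using ppm unfolding poisson_point_measure_def by blast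
  let ?E = "{w\<in>space W. cnt B w = 1} \<inter> {w\<in>space W. cnt C w = 0}"
  have "W.prob (\<Inter>i\<in>{0, 1}. point_count Z (A i) -` (if i = 0 then {1} else {0}) \<inter> space W) =
      (\<Prod>i\<in>{0, 1}. W.prob (point_count Z (A i) -` (if i = 0 then {1} else {0}) \<inter> space W))"
    by (rule W.indep_varsD[OF ind]) auto
  moreover have "point_count Z (A 0) -` {1} \<inter> space W = {w\<in>space W. cnt B w = 1}"
    "point_count Z (A 1) -` {0} \<inter> space W = {w\<in>space W. cnt C w = 0}"
    by (auto simp: A_def)
  ultimately have "W.prob ?E = W.prob {w\<in>space W. cnt B w = 1} * W.prob {w\<in>space W. cnt C w = 0}"
    by simp
  also have "\<dots> = (exp (- measure Nx B) * measure Nx B) * exp (- measure Nx C)"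
    using poisson_law[OF Bs fin(1), of 1] poisson_law[OF Cs fin(2), of 0] by simp
  finally have pE: "W.prob ?E = (exp (- measure Nx B) * measure Nx B) * exp (- measure Nx C)" .
  have "AE w in W. w \<notin> ?E"
  proof -
    have "emeasure (PX (axis x 1)) (hits_zero a b - {X \<in> space path_space. X t = 0}) = 0"
      using no_return[OF axis_fin_meas ab, of x] prob_space.finite_measure[OF PX_prob[OF axis_fin_meas]]
      by (simp add: finite_measure.emeasure_eq_measure)
    moreover have "hits_zero a b - {X \<in> space path_space. X t = (0::real^'k)} \<in> sets path_space"
      using ab by (intro sets.Diff hits_zero_sets dead_sets) auto
    ultimately have "AE X in PX (axis x 1). \<not> (X \<in> hits_zero a b \<and> X t \<noteq> 0)"
      by (intro AE_I'[of "hits_zero a b - {X \<in> space path_space. X t = 0}"])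
        (auto simp: null_sets_def sets_PX[OF axis_fin_meas] space_PX[OF axis_fin_meas])
    then have 1: "AE w in W. \<not> (S w \<in> hits_zero a b \<and> S w t \<noteq> 0)"
      unfolding dist[symmetric] using soc unfolding sum_of_clusters_def
      by (intro AE_distrD[of S W path_space]) auto
    \<comment> \<open>Clusters dead at \<open>a\<close> stay dead, first at countably many rational
      times so that one exceptional set suffices; continuity gives the remaining times.\<close>
    have "AE w in W. \<forall>r\<in>\<rat> \<inter> {a<..}. cnt (alive r - alive a) w = 0"
    proof (subst AE_ball_countable)
      show "countable (\<rat> \<inter> {a<..})" by (intro countable_Int1 countable_rat)
      show "\<forall>r\<in>\<rat> \<inter> {a<..}. AE w in W. cnt (alive r - alive a) w = 0"
      proof
        fix r assume r: "r \<in> \<rat> \<inter> {a<..}"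
        have D: "alive r - alive a \<in> sets path_space" using r ab by (intro sets.Diff alive_sets) auto
        have "emeasure Nx (alive r - alive a) = 0" using r ab by (intro N_absorbed) auto
        then have "W.prob {w\<in>space W. cnt (alive r - alive a) w = 0} = 1"
          using poisson_law[OF D, of 0] by (simp add: measure_def)
        then show "AE w in W. cnt (alive r - alive a) w = 0"
          using cnt_event[OF D, of 0] by (subst (asm) W.prob_Collect_eq_1) auto
      qed
    qed
    with 1 AE_sum AE_space show ?thesis
    proof eventually_elim
      case (elim w)
      show ?case
      proof
        assume E: "w \<in> ?E"
        then have "point_count Z (UNIV \<times> B) w = 1" by simp
        then obtain n z where n: "Z n w = Some z" "z \<in> UNIV \<times> B" "\<And>m. m \<noteq> n \<Longrightarrow> Z m w \<notin> Some ` (UNIV \<times> B)"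
          by (rule point_count_eq_1D) blast
        obtain y X where z: "z = (y, X)" by (cases z)
        have X: "X \<in> B" "X \<in> space path_space" using n z by (auto simp: B_def)
        have others: "X' r = 0" if m: "m \<noteq> n" "Z m w = Some (y', X')" and r: "a \<le> r" for m y' X' r
        proof -
          have X': "X' \<in> space path_space" using m elim by (intro Z_space) auto
          have "X' \<notin> B" using n(3)[OF m(1)] m(2) by auto
          moreover have "X' \<notin> C" using E m(2) unfolding point_count_eq_0_iff by auto
          ultimately have za: "X' a = 0" using X' BC(2) by auto
          have zq: "X' q = 0" if q: "q \<in> \<rat>" "a < q" for q
          proof -
            have "Z m w \<notin> Some ` (UNIV \<times> (alive q - alive a))"
              using elim q unfolding point_count_eq_0_iff by auto
            then show ?thesis using m(2) X' za by auto
          qed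
          show ?thesis
          proof (cases "r = a")
            case False
            then have ar: "a < r" using r by simp
            show ?thesis
            proof (rule ccontr)
              assume nz: "X' r \<noteq> 0"
              have r0: "0 \<le> r" using ar ab by simp
              obtain d where d: "0 < d" "\<And>q. 0 \<le> q \<Longrightarrow> dist q r < d \<Longrightarrow> X' q \<noteq> 0"
                using path_nonzero_near[OF X' r0 nz] by blast
              obtain q where q: "q \<in> \<rat>" "r < q" "q < r + d" using Rats_dense_in_real[of r "r + d"] d by auto
              then show False using zq[of q] d(2)[of q] ar ab by (auto simp: dist_real_def)
            qed
          qed (use za in simp)
        qed
        have Seq: "S w r = X r" if r: "a \<le> r" for r
        proof -
          have r0: "0 < r" using r ab by simp
          have "ennreal (S w r $ i) = ennreal (X r $ i)" for i
          proof -
            have "ennreal (S w r $ i) = (\<Sum>m. case Z m w of None \<Rightarrow> 0 | Some (y, X) \<Rightarrow> ennreal (X r $ i))"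
              using elim r0 by blast
            also have "\<dots> = (\<Sum>m\<in>{n}. case Z m w of None \<Rightarrow> 0 | Some (y, X) \<Rightarrow> ennreal (X r $ i))"
            proof (intro suminf_finite)
              fix m assume "m \<notin> {n}"
              then have m: "m \<noteq> n" by simp
              show "(case Z m w of None \<Rightarrow> 0 | Some (y, X) \<Rightarrow> ennreal (X r $ i)) = 0"
              proof (cases "Z m w")
                case (Some z')
                obtain y' X' where z': "z' = (y', X')" by (cases z')
                have "X' r = 0" using others[OF m _ r, of y' X'] Some z' by simp
                then show ?thesis using Some z' by simp
              qed simp
            qed simp
            finally show ?thesis using n(1) z by simp
          qed
          moreover have "0 \<le> S w r $ i" "0 \<le> X r $ i" for i
            using path_spaceD(2)[of "S w" r] path_spaceD(2)[OF X(2), of r] S_path[of w] elim r0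
            by (auto simp: fin_meas_def)
          ultimately show ?thesis by (simp add: vec_eq_iff)
        qed
        have "S w \<in> hits_zero a b"
        proof -
          obtain r where "r \<in> {a..b}" "X r = 0" using X(1) by (auto simp: B_def hits_zero_def)
          then show ?thesis using Seq[of r] S_path[of w] elim by (auto simp: hits_zero_def)
        qed
        moreover have "S w t \<noteq> 0" using Seq[of t] ab X(1) by (auto simp: B_def)
        ultimately show False using elim by auto
      qed
    qed
  qed
  moreover have "?E \<in> W.events" using Bs Cs by (intro sets.Int cnt_event)
  ultimately have "W.prob ?E = 0" using W.prob_eq_0 by blast
  then have "measure Nx B = 0" using pE by simp
  then show ?thesis using fin(1) unfolding B_def[symmetric] by (simp add: emeasure_eq_ennreal_measure less_top)
qed

text \<open>A path alive at \<open>t\<close> that has visited 0 on a rational interval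
  \<open>[a, b]\<close> was either dead at \<open>a\<close>, which contradicts absorption, or alive
  at \<open>a\<close>, which makes it a return. Both sets are null, and there are countably many
  intervals.\<close>

lemma N_survival:
  assumes t: "0 < t"
  shows "measure Nx {X \<in> space Nx. ereal t < H_max X} = v t x"
proof -
  define R where "R = {(a, b). a \<in> \<rat> \<and> b \<in> \<rat> \<and> 0 < a \<and> a < b \<and> b < t}"
  have cR: "countable R"
    by (rule countable_subset[of _ "\<rat> \<times> \<rat>"]) (auto simp: R_def countable_rat)
  define U :: "(real \<Rightarrow> real^'k) set" where "U = (\<Union>(a, b)\<in>R. hits_zero a b)"
  have H: "{X \<in> space Nx. ereal t < H_max X} = alive t - alive t \<inter> U"
    using ereal_less_H_max_iff[OF _ t] by (auto simp: space_Nx U_def R_def)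
  have "alive t \<inter> U = (\<Union>(a, b)\<in>R. alive t \<inter> hits_zero a b)" by (auto simp: U_def)
  also have "\<dots> \<in> null_sets Nx"
  proof (rule null_sets_UN'[OF cR], clarify)
    fix a b assume "(a, b) \<in> R"
    then have ab: "0 < a" "a < b" "b < t" by (auto simp: R_def)
    have 1: "alive t - alive a \<in> null_sets Nx"
      using N_absorbed[of a t] ab by (auto simp: null_sets_def sets_Nx alive_sets sets.Diff)
    have 2: "alive a \<inter> alive t \<inter> hits_zero a b \<in> null_sets Nx"
      using N_no_return[OF ab] ab by (auto simp: null_sets_def sets_Nx alive_sets hits_zero_sets sets.Int)
    have 3: "alive t \<inter> hits_zero a b \<in> sets Nx"
      using ab by (auto simp: sets_Nx alive_sets hits_zero_sets)
    show "alive t \<inter> hits_zero a b \<in> null_sets Nx"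
      by (rule null_sets_subset[OF null_sets.Un[OF 1 2] 3]) auto
  qed
  finally have "measure Nx (alive t - alive t \<inter> U) = measure Nx (alive t)"
    using t by (intro measure_Diff_null_set) (auto simp: sets_Nx alive_sets)
  then show ?thesis unfolding H using N_alive(2)[OF t] by simp
qed

end

lemma (in feller_superprocess) v_ext_eq:
  assumes N: "canonical_measures PX N" and t: "0 < t"
  shows "v_ext N t x = v t x"
proof -
  have sN: "sets (N y) = sets path_space" "sigma_finite_measure (N y)" for y
    using N unfolding canonical_measures_def by auto
  obtain W :: "(nat \<Rightarrow> ('k \<times> (real \<Rightarrow> real^'k)) option) measure" and Z S
    where W: "poisson_point_measure W (cluster_intensity (axis x 1) N) Z"
      "sum_of_clusters W Z S" "distr W path_space S = PX (axis x 1)"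
    using N axis_fin_meas[of x] unfolding canonical_measures_def by blast
  interpret poisson_realisation p L P Y \<alpha> \<beta> PX "N x" x W Z S
  proof (rule poisson_realisation.intro)
    show "feller_superprocess p L P Y \<alpha> \<beta> PX" by (rule feller_superprocess_axioms)
    show "poisson_realisation_axioms PX (N x) x W Z S"
      by (rule poisson_realisation_axioms.intro) (use W sN in \<open>simp_all add: cluster_intensity_axis\<close>)
  qed
  show ?thesis unfolding v_ext_def by (rule N_survival[OF t])
qed

section \<open>Long-time behaviour of the extinction rates\<close>

lemma finite_attains_min:
  fixes f :: "'k::finite \<Rightarrow> real"
  obtains k where "\<And>l. f k \<le> f l"
proof -
  have "Min (range f) \<in> range f" by (rule Min_in) auto
  then obtain k where "Min (range f) = f k" by (rule rangeE)
  then have "f k \<le> f l" for l using Min_le[of "range f" "f l"] by simp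
  then show thesis by (rule that)
qed

text \<open>For \<open>t \<ge> 1\<close> the successor of this index is the integer part of
  \<open>t\<close>. It carries limits along the positive integers, where \<open>v\<close> is
  controlled, over to real times.\<close>

lemma filterlim_pred_floor: "filterlim (\<lambda>t::real. nat \<lfloor>t\<rfloor> - 1) sequentially at_top"
proof (rule filterlim_at_top[THEN iffD2], rule allI)
  fix n :: nat
  show "\<forall>\<^sub>F t::real in at_top. n \<le> nat \<lfloor>t\<rfloor> - 1"
    using eventually_ge_at_top[of "real n + 2"] by eventually_elim linarith
qed

text \<open>From some index on, the recursion is dominated by one with a constant factor below 1 and
  a small constant error.\<close>

lemma contraction_tendsto_0:
  fixes r a b :: "nat \<Rightarrow> real"
  assumes r: "\<And>n. 0 \<le> r n" "\<And>n. r (Suc n) \<le> a n * r n + b n"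
    and a: "a \<longlonglongrightarrow> \<rho>" "\<rho> < 1" and b: "b \<longlonglongrightarrow> 0"
  shows "r \<longlonglongrightarrow> 0"
proof (rule LIMSEQ_I)
  fix e :: real assume e: "0 < e"
  define \<sigma> where "\<sigma> = (max \<rho> 0 + 1) / 2"
  have \<sigma>: "\<rho> < \<sigma>" "0 < \<sigma>" "\<sigma> < 1" using a(2) by (auto simp: \<sigma>_def)
  have "\<forall>\<^sub>F n in sequentially. a n < \<sigma>" using order_tendstoD(2)[OF a(1) \<sigma>(1)] .
  \<comment> \<open>The threshold makes \<open>e / 2\<close> the fixed point of
    \<open>z \<mapsto> \<sigma> * z + (e / 2) * (1 - \<sigma>)\<close>.\<close>
  moreover have "\<forall>\<^sub>F n in sequentially. b n < (e / 2) * (1 - \<sigma>)"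
    using e \<sigma> by (intro order_tendstoD(2)[OF b]) auto
  ultimately have "\<forall>\<^sub>F n in sequentially. a n < \<sigma> \<and> b n < (e / 2) * (1 - \<sigma>)" by eventually_elim auto
  then obtain k where k: "\<And>n. n \<ge> k \<Longrightarrow> a n < \<sigma> \<and> b n < (e / 2) * (1 - \<sigma>)"
    unfolding eventually_sequentially by auto
  have step: "r (k + n) \<le> e / 2 + \<sigma> ^ n * r k" for n
  proof (induction n)
    case 0
    then show ?case using e by simp
  next
    case (Suc n)
    have "r (k + Suc n) \<le> a (k + n) * r (k + n) + b (k + n)" using r(2)[of "k + n"] by simp
    also have "\<dots> \<le> \<sigma> * r (k + n) + (e / 2) * (1 - \<sigma>)"
      using k[of "k + n"] r(1)[of "k + n"] by (intro add_mono mult_right_mono) auto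
    also have "\<dots> \<le> \<sigma> * (e / 2 + \<sigma> ^ n * r k) + (e / 2) * (1 - \<sigma>)"
      using Suc \<sigma> by (intro add_right_mono mult_left_mono) auto
    also have "\<dots> = e / 2 + \<sigma> ^ Suc n * r k" by (simp add: field_simps)
    finally show ?case .
  qed
  have "(\<lambda>n. \<sigma> ^ n * r k) \<longlonglongrightarrow> 0 * r k" using \<sigma> by (intro tendsto_intros LIMSEQ_power_zero) auto
  then have "\<forall>\<^sub>F n in sequentially. \<sigma> ^ n * r k < e / 2" using e by (intro order_tendstoD(2)) auto
  then obtain l where l: "\<And>n. n \<ge> l \<Longrightarrow> \<sigma> ^ n * r k < e / 2" unfolding eventually_sequentially by auto
  show "\<exists>no. \<forall>n\<ge>no. norm (r n - 0) < e"
  proof (intro exI allI impI)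
    fix n assume n: "k + l \<le> n"
    have "l \<le> n - k" "k + (n - k) = n" using n by linarith+
    then have "r n < e" using step[of "n - k"] l[of "n - k"] by simp
    then show "norm (r n - 0) < e" using r(1)[of n] by simp
  qed
qed

section \<open>Comparison of potentials and positivity of the transition function\<close>

context jump_chain
begin

lemma kac_compare:
  assumes T: "0 \<le> T" and c: "\<And>j. continuous_on {0..T} (\<lambda>r. c r j)" "\<And>r j. 0 \<le> r \<Longrightarrow> r \<le> T \<Longrightarrow> \<bar>c r j\<bar> \<le> C"
    and d: "\<And>j. continuous_on {0..T} (\<lambda>r. d r j)" "\<And>r j. 0 \<le> r \<Longrightarrow> r \<le> T \<Longrightarrow> \<bar>d r j\<bar> \<le> D"
    and le: "\<And>r j. 0 \<le> r \<Longrightarrow> r \<le> T \<Longrightarrow> c r j \<le> d r j" "\<And>r j. 0 \<le> r \<Longrightarrow> r \<le> T \<Longrightarrow> d r j \<le> c r j + \<kappa>"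
    and \<omega>: "\<omega> \<in> space M" and st: "0 \<le> s" "s \<le> t" "t \<le> T"
  shows "kac d Y s t \<omega> \<le> kac c Y s t \<omega>" "exp (- \<kappa> * (t - s)) * kac c Y s t \<omega> \<le> kac d Y s t \<omega>"
proof -
  have ci: "set_integrable lborel {s..t} (\<lambda>r. c r (Y r \<omega>))"
    using c_along_path_integrable[where c = c, OF T c \<omega> st(1,3)] .
  have di: "set_integrable lborel {s..t} (\<lambda>r. d r (Y r \<omega>))"
    using c_along_path_integrable[where c = d, OF T d \<omega> st(1,3)] .
  have ki: "set_integrable lborel {s..t} (\<lambda>_. \<kappa>)"
    unfolding set_integrable_def by (intro integrable_scaleR_left integrable_real_indicator) (auto simp: emeasure_lborel_Icc_eq)
  have "(LINT r:{s..t}|lborel. c r (Y r \<omega>)) \<le> (LINT r:{s..t}|lborel. d r (Y r \<omega>))"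
    by (rule set_integral_mono[OF ci di]) (use le st in auto)
  then show "kac d Y s t \<omega> \<le> kac c Y s t \<omega>" by (simp add: kac_def)
  have "(LINT r:{s..t}|lborel. d r (Y r \<omega>)) \<le> (LINT r:{s..t}|lborel. c r (Y r \<omega>) + \<kappa>)"
    by (rule set_integral_mono[OF di set_integral_add(1)[OF ci ki]]) (use le st in auto)
  also have "\<dots> = (LINT r:{s..t}|lborel. c r (Y r \<omega>)) + \<kappa> * (t - s)"
    using st by (subst set_integral_add(2)[OF ci ki]) (simp add: set_lebesgue_integral_def)
  finally show "exp (- \<kappa> * (t - s)) * kac c Y s t \<omega> \<le> kac d Y s t \<omega>"
    by (simp add: kac_def flip: exp_add)
qed

end

context jump_chains
begin

text \<open>The comparison holds path by path. It will be applied to \<open>\<beta>\<close> and to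
  the potential of the derivative of \<open>v\<close>, whose difference vanishes for large remaining
  times.\<close>

lemma kac_kernel_compare:
  assumes T: "0 \<le> T" and c: "\<And>j. continuous_on {0..T} (\<lambda>r. c r j)" "\<And>r j. 0 \<le> r \<Longrightarrow> r \<le> T \<Longrightarrow> \<bar>c r j\<bar> \<le> C"
    and d: "\<And>j. continuous_on {0..T} (\<lambda>r. d r j)" "\<And>r j. 0 \<le> r \<Longrightarrow> r \<le> T \<Longrightarrow> \<bar>d r j\<bar> \<le> D"
    and le: "\<And>r j. 0 \<le> r \<Longrightarrow> r \<le> T \<Longrightarrow> c r j \<le> d r j" "\<And>r j. 0 \<le> r \<Longrightarrow> r \<le> T \<Longrightarrow> d r j \<le> c r j + \<kappa>"
  shows "kac_kernel P d Y 0 T i j \<le> kac_kernel P c Y 0 T i j"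
    "exp (- \<kappa> * T) * kac_kernel P c Y 0 T i j \<le> kac_kernel P d Y 0 T i j"
proof -
  have int: "integrable (P i) (\<lambda>\<omega>. of_bool (Y T \<omega> = j) * kac e Y 0 T \<omega>)"
    if e: "\<And>j. continuous_on {0..T} (\<lambda>r. e r j)" "\<And>r j. 0 \<le> r \<Longrightarrow> r \<le> T \<Longrightarrow> \<bar>e r j\<bar> \<le> E" for e E
  proof (rule chain.integrable_const_bound[where B = "exp (E * T)"])
    have Yt: "(\<lambda>\<omega>. of_bool (Y T \<omega> = j) :: real) \<in> borel_measurable (P i)"
      by (rule measurable_compose[OF chain.Y_measurable[OF T]]) simp
    have "kac e Y 0 T \<in> borel_measurable (P i)"
      by (rule chain.measurable_F[OF chain.kac_measurable[where c = e, OF T e order_refl T order_refl]])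
    with Yt show "(\<lambda>\<omega>. of_bool (Y T \<omega> = j) * kac e Y 0 T \<omega>) \<in> borel_measurable (P i)" by measurable
    show "AE \<omega> in P i. norm (of_bool (Y T \<omega> = j) * kac e Y 0 T \<omega>) \<le> exp (E * T)"
      using chain.kac_bounds(2)[where c = e, OF T e _ order_refl T order_refl] by (intro AE_I2) (auto simp: kac_def)
  qed
  have eq: "kac_kernel P e Y 0 T i j = (LINT \<omega>|P i. of_bool (Y T \<omega> = j) * kac e Y 0 T \<omega>)" for e
    by (simp add: kac_kernel_def kac_expect_def)
  note cmp = chain.kac_compare[where c = c and d = d, OF T c d le _ order_refl T order_refl]
  show "kac_kernel P d Y 0 T i j \<le> kac_kernel P c Y 0 T i j"
    unfolding eq using cmp(1) by (intro Bochner_Integration.integral_mono int[OF c] int[OF d] mult_left_mono) auto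
  have "(LINT \<omega>|P i. exp (- \<kappa> * T) * (of_bool (Y T \<omega> = j) * kac c Y 0 T \<omega>)) \<le> (LINT \<omega>|P i. of_bool (Y T \<omega> = j) * kac d Y 0 T \<omega>)"
    using cmp(2) by (intro Bochner_Integration.integral_mono integrable_mult_right int[OF c] int[OF d]) auto
  then show "exp (- \<kappa> * T) * kac_kernel P c Y 0 T i j \<le> kac_kernel P d Y 0 T i j" unfolding eq by simp
qed

text \<open>Positive near 0 by continuity; the probability of being at \<open>i\<close> at each of
  several intermediate times bounds the return probability from below.\<close>

lemma p_diag_pos:
  assumes t: "0 \<le> t"
  shows "0 < p t i i"
proof -
  have "((\<lambda>e. p e i i - 1) \<longlongrightarrow> 0) (at_right 0)" using chain.p_tendsto_0[of i i] by simp
  then have "\<forall>\<^sub>F e in at_right 0. - 1 < p e i i - 1" by (rule order_tendstoD(1)) simp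
  then obtain d where d: "0 < d" "\<And>e. 0 < e \<Longrightarrow> e < d \<Longrightarrow> 0 < p e i i"
    unfolding eventually_at_right_field by auto
  have small: "0 < p e i i" if "0 \<le> e" "e < d" for e
    using d(2)[of e] that chain.p_zero[of i i] by (cases "e = 0") auto
  obtain n :: nat where n: "t < real n * d" using reals_Archimedean3[OF d(1)] by blast
  have "0 \<le> s \<Longrightarrow> s < d \<Longrightarrow> 0 < p (real m * s) i i" for m s
  proof (induction m)
    case 0
    then show ?case using chain.p_zero[of i i] by simp
  next
    case (Suc m)
    have "0 < p s i i * p (real m * s) i i" using Suc small by auto
    also have "\<dots> \<le> (\<Sum>k\<in>UNIV. p s i k * p (real m * s) k i)"
      using Suc by (intro member_le_sum[of i UNIV "\<lambda>k. p s i k * p (real m * s) k i"]) (auto simp: chain.p_nonneg)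
    also have "\<dots> = p (real (Suc m) * s) i i"
      using Suc chain.p_add[of s "real m * s" i i] by (simp add: algebra_simps)
    finally show ?case .
  qed
  from this[of "t / real n" n] show ?thesis using n t d by (cases "n = 0") (auto simp: field_simps)
qed

text \<open>Along an edge, a jump in a short time is followed by a return to the endpoint for the
  remaining time. A longer chain of edges is handled by halving the time at each step.\<close>

lemma p_pos:
  assumes irr: "irreducible_generator L" and t: "0 < t"
  shows "0 < p t i j"
proof -
  have edge: "0 < p t i j" if ij: "i \<noteq> j" "0 < L $ i $ j" and t: "0 < t" for i j t
  proof -
    have "((\<lambda>e. p e i j / e) \<longlongrightarrow> L $ i $ j) (at_right 0)" using chain.p_deriv[of i j] ij by simp
    then have "\<forall>\<^sub>F e in at_right 0. 0 < p e i j / e" using ij by (intro order_tendstoD(1))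
    then obtain d where d: "0 < d" "\<And>e. 0 < e \<Longrightarrow> e < d \<Longrightarrow> 0 < p e i j / e"
      unfolding eventually_at_right_field by auto
    define e where "e = min (d / 2) t"
    have e: "0 < e" "e < d" "e \<le> t" using d t by (auto simp: e_def)
    have "0 < p e i j * p (t - e) j j" using d(2)[of e] e p_diag_pos[of "t - e" j] by (auto simp: zero_less_divide_iff)
    also have "\<dots> \<le> (\<Sum>k\<in>UNIV. p e i k * p (t - e) k j)"
      using e by (intro member_le_sum[of j UNIV "\<lambda>k. p e i k * p (t - e) k j"]) (auto simp: chain.p_nonneg)
    also have "\<dots> = p t i j" using chain.p_add[of e "t - e" i j] e by simp
    finally show ?thesis .
  qed
  have "(i, j) \<in> {(i, j). i \<noteq> j \<and> 0 < L $ i $ j}\<^sup>*" using irr unfolding irreducible_generator_def by blast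
  then have "\<forall>t>0. 0 < p t i j"
  proof (induction rule: rtrancl_induct)
    case base
    then show ?case using p_diag_pos by auto
  next
    case (step j k)
    show ?case
    proof (intro allI impI)
      fix t :: real assume t: "0 < t"
      have "0 < p (t / 2) i j * p (t / 2) j k" using step edge[of j k "t / 2"] t by auto
      also have "\<dots> \<le> (\<Sum>l\<in>UNIV. p (t / 2) i l * p (t / 2) l k)"
        using t by (intro member_le_sum[of j UNIV "\<lambda>l. p (t / 2) i l * p (t / 2) l k"]) (auto simp: chain.p_nonneg)
      also have "\<dots> = p t i k" using chain.p_add[of "t / 2" "t / 2" i k] t by simp
      finally show "0 < p t i k" .
    qed
  qed
  with t show ?thesis by blast
qed

end

section \<open>Sign of the derivative of the extinction rates\<close>

context feller_superprocess
begin

lemma dv_nonpos: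
  assumes t: "0 < t"
  shows "dv t i \<le> 0"
proof (rule ccontr)
  assume "\<not> dv t i \<le> 0"
  then obtain d where "0 < d" "\<And>h. 0 < h \<Longrightarrow> h < d \<Longrightarrow> v t i < v (t + h) i"
    using DERIV_pos_inc_right[OF v_has_derivative[OF t, of i]] by auto
  from this(2)[of "d / 2"] this(1) v_antimono[OF t, of "t + d / 2" i] show False by simp
qed

text \<open>The off-diagonal terms in the equation of \<open>- dv\<close> are nonnegative. After
  multiplication by an exponential that dominates the diagonal term, \<open>- dv\<close> at
  \<open>i\<close> is nondecreasing, and being nonnegative it vanishes before any of its
  zeros.\<close>

lemma dv_zero_before:
  assumes z: "dv t i = 0" and r: "0 < r" "r \<le> t"
  shows "dv r i = 0"
proof -
  \<comment> \<open>Dominates \<open>\<bar>L $ i $ i\<bar>\<close> plus the potential on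
    \<open>[r, t]\<close>, as \<open>v\<close> is at most \<open>bound_fun r\<close> there.\<close>
  define \<kappa> where "\<kappa> = \<bar>L $ i $ i\<bar> + \<bar>\<beta> i\<bar> + 2 * \<alpha> i * bound_fun r"
  define h where "h s = - dv s i * exp (\<kappa> * s)" for s
  have "h r \<le> h t"
  proof (rule DERIV_nonneg_imp_nondecreasing[OF r(2)])
    fix s assume s: "r \<le> s" "s \<le> t"
    then have s0: "0 < s" using r by simp
    let ?c = "\<beta> i + 2 * \<alpha> i * v s i"
    have "(h has_real_derivative (- ((\<Sum>j\<in>UNIV. L $ i $ j * dv s j) - ?c * dv s i) * exp (\<kappa> * s) + - dv s i * (exp (\<kappa> * s) * \<kappa>))) (at s)"
      unfolding h_def[abs_def] by (rule derivative_eq_intros dv_has_derivative[OF s0] refl | simp)+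
    moreover have "0 \<le> - ((\<Sum>j\<in>UNIV. L $ i $ j * dv s j) - ?c * dv s i) * exp (\<kappa> * s) + - dv s i * (exp (\<kappa> * s) * \<kappa>)"
    proof -
      have "(\<Sum>j\<in>UNIV. L $ i $ j * dv s j) = L $ i $ i * dv s i + (\<Sum>j\<in>UNIV - {i}. L $ i $ j * dv s j)"
        by (rule sum.remove) auto
      moreover have "(\<Sum>j\<in>UNIV - {i}. L $ i $ j * dv s j) \<le> 0"
        using dv_nonpos[OF s0] chain.L_nonneg[of i] by (intro sum_nonpos) (auto simp: mult_le_0_iff)
      ultimately have 1: "(\<Sum>j\<in>UNIV. L $ i $ j * dv s j) \<le> L $ i $ i * dv s i" by simp
      have "v s i \<le> bound_fun r" using v_bounds(2)[OF s0, of i] bound_fun_antimono[OF r(1) s(1)] by linarith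
      then have "2 * \<alpha> i * v s i \<le> 2 * \<alpha> i * bound_fun r" using \<alpha>_pos[of i] by (intro mult_left_mono) auto
      then have "L $ i $ i - ?c + \<kappa> \<ge> 0" unfolding \<kappa>_def by linarith
      then have "(L $ i $ i - ?c + \<kappa>) * dv s i \<le> 0" using dv_nonpos[OF s0, of i] by (simp add: mult_le_0_iff)
      then have "0 \<le> - ((\<Sum>j\<in>UNIV. L $ i $ j * dv s j) - ?c * dv s i) - dv s i * \<kappa>"
        using 1 by (simp add: algebra_simps)
      then have "0 \<le> (- ((\<Sum>j\<in>UNIV. L $ i $ j * dv s j) - ?c * dv s i) - dv s i * \<kappa>) * exp (\<kappa> * s)" by simp
      then show ?thesis by (simp add: algebra_simps)
    qed
    ultimately show "\<exists>y. DERIV h s :> y \<and> 0 \<le> y" by blast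
  qed
  then have "0 \<le> dv r i" using z by (simp add: h_def zero_le_mult_iff)
  then show ?thesis using dv_nonpos[OF r(1), of i] by simp
qed

text \<open>A zero of \<open>dv\<close> at \<open>i\<close> extends back to time 0, so
  \<open>v\<close> at \<open>i\<close> would be a constant \<open>m\<close> on
  \<open>(0, t)\<close>. This contradicts the blow-up of \<open>v\<close> at 0: it dominates the
  cumulant issued from \<open>m + 1\<close>, which is continuous at 0.\<close>

lemma dv_neg:
  assumes irr: "irreducible_generator L" and t: "0 < t"
  shows "dv t i < 0"
proof (rule ccontr)
  assume "\<not> dv t i < 0"
  then have z: "dv t i = 0" using dv_nonpos[OF t, of i] by simp
  \<comment> \<open>Where \<open>dv\<close> at \<open>j\<close> vanishes on an interval its
    derivative does too, and the equation reduces to a vanishing sum of terms of one sign; the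
    positive rate to \<open>k\<close> forces \<open>dv\<close> at \<open>k\<close> to
    vanish.\<close>
  have step: "\<forall>r\<in>{0<..<t}. dv r k = 0" if j: "\<forall>r\<in>{0<..<t}. dv r j = 0" and jk: "j \<noteq> k" "0 < L $ j $ k" for j k
  proof
    fix r assume r: "r \<in> {0<..<t}"
    have "((\<lambda>_. 0) has_real_derivative 0) (at r)" by simp
    then have "((\<lambda>t. dv t j) has_real_derivative 0) (at r)"
      by (rule has_field_derivative_transform_within_open[OF _ open_greaterThanLessThan r]) (use j in auto)
    moreover have "((\<lambda>t. dv t j) has_real_derivative ((\<Sum>k\<in>UNIV. L $ j $ k * dv r k) - (\<beta> j + 2 * \<alpha> j * v r j) * dv r j)) (at r)"
      using r by (intro dv_has_derivative) auto
    ultimately have "(\<Sum>k\<in>UNIV. L $ j $ k * dv r k) - (\<beta> j + 2 * \<alpha> j * v r j) * dv r j = 0" by (rule DERIV_unique[symmetric])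
    then have s0: "(\<Sum>k\<in>UNIV. - (L $ j $ k * dv r k)) = 0" using j r by (simp add: sum_negf)
    have "\<forall>k\<in>UNIV. - (L $ j $ k * dv r k) = 0"
    proof (rule sum_nonneg_eq_0_iff[THEN iffD1, OF _ _ s0])
      show "0 \<le> - (L $ j $ k * dv r k)" for k
        using dv_nonpos[of r k] chain.L_nonneg[of j k] j r by (cases "j = k") (auto simp: mult_le_0_iff)
    qed simp
    then show "dv r k = 0" using jk by (auto dest!: spec[of _ k])
  qed
  have all: "\<forall>r\<in>{0<..<t}. dv r j = 0" for j
  proof -
    have "(i, j) \<in> {(i, j). i \<noteq> j \<and> 0 < L $ i $ j}\<^sup>*" using irr unfolding irreducible_generator_def by blast
    then show ?thesis
    proof (induction rule: rtrancl_induct)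
      case base
      then show ?case using dv_zero_before[OF z] by auto
    next
      case (step j k)
      then show ?case using \<open>\<And>k j. \<lbrakk>\<forall>r\<in>{0<..<t}. dv r j = 0; j \<noteq> k; 0 < L $ j $ k\<rbrakk> \<Longrightarrow> \<forall>r\<in>{0<..<t}. dv r k = 0\<close>[of j k] by auto
    qed
  qed
  have "((\<lambda>r. v r i) has_real_derivative 0) (at r within {0<..<t})" if "r \<in> {0<..<t}" for r
    using v_has_derivative[of r i] all[of i] that by (auto intro: has_field_derivative_at_within)
  then obtain m where m: "\<And>r. r \<in> {0<..<t} \<Longrightarrow> v r i = m"
    using has_field_derivative_zero_constant[of "{0<..<t}" "\<lambda>r. v r i"] by auto
  have m0: "0 \<le> m" using m[of "t / 2"] v_bounds(1)[of "t / 2" i] t by simp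
  let ?u = "cumulant (m + 1)"
  have "continuous_on {0..t} (\<lambda>r. ?u r i)"
    by (rule DERIV_continuous_on) (rule mild_solution_has_derivative[OF cumulant(1)], use m0 in auto)
  moreover have "(0::real) \<in> {0..t}" "(0::real) < 1" using t by auto
  ultimately obtain d where d: "0 < d" "\<And>r. r \<in> {0..t} \<Longrightarrow> dist r 0 < d \<Longrightarrow> dist (?u r i) (?u 0 i) < 1"
    unfolding continuous_on_iff by blast
  define r where "r = min (d / 2) (t / 2)"
  have r: "0 < r" "r < d" "r < t" using d t by (auto simp: r_def)
  have "?u 0 i = m + 1" by (rule mild_solution_initial[OF cumulant(1)]) (use m0 in auto)
  then have "m < ?u r i" using d(2)[of r] r by (auto simp: dist_real_def)
  moreover have "?u r i \<le> v r i" using r m0 by (intro cumulant_le_v) auto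
  ultimately show False using m[of r] r by simp
qed

text \<open>A bound, uniform in the state, for the part \<open>2 * \<alpha> i * v t i\<close> of the
  potential; summing over states replaces a maximum.\<close>

definition gain :: "real \<Rightarrow> real" where
  "gain t = (\<Sum>i\<in>UNIV. 2 * \<alpha> i * v t i)"

lemma gain_term_nonneg: "0 < t \<Longrightarrow> 0 \<le> 2 * \<alpha> i * v t i"
  using less_imp_le[OF \<alpha>_pos[of i]] v_bounds(1)[of t i] by simp

lemma gain_nonneg: "0 < t \<Longrightarrow> 0 \<le> gain t"
  unfolding gain_def by (intro sum_nonneg gain_term_nonneg)

lemma gain_ge:
  assumes ts: "0 < t" "t \<le> s"
  shows "2 * \<alpha> i * v s i \<le> gain t"
proof -
  have "2 * \<alpha> i * v s i \<le> 2 * \<alpha> i * v t i" using ts \<alpha>_pos[of i] by (intro mult_left_mono v_antimono) auto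
  also have "\<dots> \<le> gain t"
    unfolding gain_def using gain_term_nonneg[OF ts(1)]
    by (intro member_le_sum[of i UNIV "\<lambda>i. 2 * \<alpha> i * v t i"]) auto
  finally show ?thesis .
qed

lemma \<beta>_bound: "\<bar>\<beta> j\<bar> \<le> (\<Sum>j\<in>UNIV. \<bar>\<beta> j\<bar>)"
  by (rule member_le_sum) auto

text \<open>The potential seen at time \<open>r\<close> by the chain started when the remaining time is \<open>h\<close>.\<close>

definition pot :: "real \<Rightarrow> real \<Rightarrow> 'k \<Rightarrow> real" where
  "pot h r j = \<beta> j + 2 * \<alpha> j * v (h - r) j"

lemma pot_props:
  assumes "0 \<le> T" "T < h"
  shows "continuous_on {0..T} (\<lambda>r. pot h r j)"
    and "0 \<le> r \<Longrightarrow> r \<le> T \<Longrightarrow> \<bar>pot h r j\<bar> \<le> (\<Sum>j\<in>UNIV. \<bar>\<beta> j\<bar>) + gain (h - T)"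
    and "0 \<le> r \<Longrightarrow> r \<le> T \<Longrightarrow> \<beta> j \<le> pot h r j"
    and "0 \<le> r \<Longrightarrow> r \<le> T \<Longrightarrow> pot h r j \<le> \<beta> j + gain (h - T)"
proof -
  have "continuous_on {0..T} (\<lambda>r. v (h - r) j)"
    by (rule continuous_on_compose2[OF v_continuous_on[of "h - T" h]]) (use assms in \<open>auto intro!: continuous_intros\<close>)
  then show "continuous_on {0..T} (\<lambda>r. pot h r j)" unfolding pot_def by (intro continuous_intros)
  show lo: "\<beta> j \<le> pot h r j" if "0 \<le> r" "r \<le> T" for r
    using v_bounds(1)[of "h - r" j] \<alpha>_pos[of j] that assms by (simp add: pot_def)
  show up: "pot h r j \<le> \<beta> j + gain (h - T)" if "0 \<le> r" "r \<le> T" for r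
    using gain_ge[of "h - T" "h - r" j] that assms by (simp add: pot_def)
  have "\<bar>\<beta> j\<bar> \<le> (\<Sum>j\<in>UNIV. \<bar>\<beta> j\<bar>)" by (rule member_le_sum) auto
  then show "\<bar>pot h r j\<bar> \<le> (\<Sum>j\<in>UNIV. \<bar>\<beta> j\<bar>) + gain (h - T)" if "0 \<le> r" "r \<le> T"
    using lo[OF that] up[OF that] gain_nonneg[of "h - T"] assms by linarith
qed

text \<open>In the elapsed time \<open>r\<close> the equation runs backwards and becomes harmonicity
  for \<open>pot h\<close>. The sign makes the function positive and disappears from all
  quotients.\<close>

lemma dv_backward_derivative:
  assumes "0 \<le> s" "s \<le> T" "T < h"
  shows "((\<lambda>r. - dv (h - r) i) has_real_derivative
    - ((\<Sum>j\<in>UNIV. L $ i $ j * - dv (h - s) j) - pot h s i * - dv (h - s) i)) (at s within {0..T})"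
proof -
  have "((\<lambda>t. dv t i) \<circ> (\<lambda>r. h - r) has_real_derivative ((\<Sum>j\<in>UNIV. L $ i $ j * dv (h - s) j) - (\<beta> i + 2 * \<alpha> i * v (h - s) i) * dv (h - s) i) * (- 1)) (at s)"
    by (rule DERIV_chain[OF dv_has_derivative]) (use assms in \<open>auto intro!: derivative_eq_intros\<close>)
  then have "((\<lambda>r. dv (h - r) i) has_real_derivative - ((\<Sum>j\<in>UNIV. L $ i $ j * dv (h - s) j) - pot h s i * dv (h - s) i)) (at s)"
    by (simp add: o_def pot_def)
  then have "((\<lambda>r. - dv (h - r) i) has_real_derivative - (- ((\<Sum>j\<in>UNIV. L $ i $ j * dv (h - s) j) - pot h s i * dv (h - s) i))) (at s within {0..T})"
    by (rule DERIV_minus[OF has_field_derivative_at_within])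
  then show ?thesis by (simp add: sum_negf)
qed

context
  fixes \<phi> :: "'k \<Rightarrow> real" and lam :: real
  assumes \<phi>_pos: "\<And>i. 0 < \<phi> i" and lam: "0 \<le> lam"
    and eig: "\<And>i. (\<Sum>j\<in>UNIV. L $ i $ j * \<phi> j) = (\<beta> i - lam) * \<phi> i"
begin

text \<open>The decreasing limit \<open>w\<close> is a stationary solution of the equation. At a
  state where the ratio to \<open>\<phi>\<close> is largest, the eigenvector equation gives
  \<open>\<alpha> k * (w k)\<^sup>2 \<le> - lam * w k\<close>; the sign of \<open>lam\<close> then
  forces \<open>w\<close> to vanish at that state, hence everywhere.\<close>

lemma v_tendsto_0: "((\<lambda>t. v t i) \<longlongrightarrow> 0) at_top"
proof -
  have "\<exists>l. (\<lambda>n. v (real (Suc n)) i) \<longlonglongrightarrow> l" for i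
  proof -
    have dec: "decseq (\<lambda>n. v (real (Suc n)) i)" unfolding decseq_def by (auto intro!: v_antimono)
    have nn: "0 \<le> v (real (Suc n)) i" for n by (rule v_bounds) simp
    show ?thesis using decseq_convergent[OF dec, of 0] nn by blast
  qed
  then obtain w where w: "\<And>i. (\<lambda>n. v (real (Suc n)) i) \<longlonglongrightarrow> w i" by metis
  have w0: "0 \<le> w i" for i by (rule LIMSEQ_le_const[OF w]) (auto intro!: exI[of _ 0] v_bounds(1))
  have v_lim: "((\<lambda>t. v t i) \<longlongrightarrow> w i) at_top" for i
  proof (rule tendsto_sandwich)
    have "w i \<le> v t i" if "0 < t" for t
    proof -
      obtain n where n: "t \<le> real n" using real_arch_simple by blast
      have "w i \<le> v (real (Suc n)) i"
        by (rule decseq_ge[OF _ w]) (auto simp: decseq_def intro!: v_antimono)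
      also have "\<dots> \<le> v t i" using n that by (intro v_antimono) auto
      finally show ?thesis .
    qed
    then show "\<forall>\<^sub>F t in at_top. w i \<le> v t i"
      by (intro eventually_mono[OF eventually_gt_at_top[of 0]])
    show "\<forall>\<^sub>F t in at_top. v t i \<le> v (real (Suc (nat \<lfloor>t\<rfloor> - 1))) i"
      using eventually_ge_at_top[of 2]
    proof eventually_elim
      case (elim t)
      then have "real (Suc (nat \<lfloor>t\<rfloor> - 1)) \<le> t" by linarith
      then show ?case by (intro v_antimono) auto
    qed
    show "((\<lambda>_::real. w i) \<longlongrightarrow> w i) at_top" by simp
    show "((\<lambda>t::real. v (real (Suc (nat \<lfloor>t\<rfloor> - 1))) i) \<longlongrightarrow> w i) at_top"
      by (rule filterlim_compose[OF w filterlim_pred_floor])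
  qed
  define l where "l i = (\<Sum>j\<in>UNIV. L $ i $ j * w j) - psi \<beta> \<alpha> i (w i)" for i
  have dv_lim: "((\<lambda>t. dv t i) \<longlongrightarrow> l i) at_top" for i
    unfolding dv_def l_def psi_def by (intro tendsto_intros v_lim)
  have l0: "l i = 0" for i
  proof -
    \<comment> \<open>The mean value theorem on unit intervals: the increments of \<open>v\<close>
      tend to 0 and are values of \<open>dv\<close> at times tending to infinity, so the limit of
      \<open>dv\<close> is 0.\<close>
    have "\<exists>z. real (Suc n) < z \<and> z < real (Suc n) + 1 \<and> v (real (Suc n) + 1) i - v (real (Suc n)) i = dv z i" for n
    proof -
      have "\<exists>z. real (Suc n) < z \<and> z < real (Suc n) + 1 \<and>
          v (real (Suc n) + 1) i - v (real (Suc n)) i = (real (Suc n) + 1 - real (Suc n)) * dv z i"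
        by (rule MVT2) (auto intro!: v_has_derivative)
      then show ?thesis by simp
    qed
    then obtain z where z: "\<And>n. real (Suc n) < z n" "\<And>n. v (real (Suc n) + 1) i - v (real (Suc n)) i = dv (z n) i" by metis
    have "filterlim z at_top sequentially"
    proof (rule filterlim_at_top_mono[OF filterlim_real_sequentially], rule always_eventually, rule allI)
      show "real n \<le> z n" for n using z(1)[of n] by simp
    qed
    then have "(\<lambda>n. dv (z n) i) \<longlonglongrightarrow> l i" by (rule filterlim_compose[OF dv_lim])
    moreover have "(\<lambda>n. v (real (Suc (Suc n))) i - v (real (Suc n)) i) \<longlonglongrightarrow> w i - w i"
      by (intro tendsto_diff w LIMSEQ_Suc[OF w])
    moreover have "(\<lambda>n. v (real (Suc (Suc n))) i - v (real (Suc n)) i) = (\<lambda>n. dv (z n) i)"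
      using z(2) by (simp add: add.commute)
    ultimately show ?thesis using LIMSEQ_unique by fastforce
  qed
  define \<rho> where "\<rho> = Max (range (\<lambda>i. w i / \<phi> i))"
  have w_le: "w j \<le> \<rho> * \<phi> j" for j
  proof -
    have "w j / \<phi> j \<le> \<rho>" unfolding \<rho>_def by (rule Max_ge) auto
    then show ?thesis using \<phi>_pos[of j] by (simp add: pos_divide_le_eq)
  qed
  have "\<rho> \<in> range (\<lambda>i. w i / \<phi> i)" unfolding \<rho>_def by (rule Max_in) auto
  then obtain k where k: "\<rho> = w k / \<phi> k" by auto
  have wk: "w k = \<rho> * \<phi> k" using k \<phi>_pos[of k] by simp
  have "(\<Sum>j\<in>UNIV. L $ k $ j * w j) \<le> (\<Sum>j\<in>UNIV. L $ k $ j * (\<rho> * \<phi> j))"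
  proof (rule sum_mono)
    fix j show "L $ k $ j * w j \<le> L $ k $ j * (\<rho> * \<phi> j)"
      using w_le[of j] chain.L_nonneg[of k j] wk by (cases "k = j") (auto intro!: mult_left_mono)
  qed
  also have "\<dots> = \<rho> * (\<Sum>j\<in>UNIV. L $ k $ j * \<phi> j)" by (simp add: sum_distrib_left mult_ac)
  also have "\<dots> = (\<beta> k - lam) * w k" by (simp add: eig wk)
  finally have "\<alpha> k * (w k)\<^sup>2 \<le> - (lam * w k)" using l0[of k] by (simp add: l_def psi_def algebra_simps)
  also have "\<dots> \<le> 0" using lam w0[of k] by simp
  finally have "w k = 0" using \<alpha>_pos[of k] by (simp add: mult_le_0_iff)
  then have "\<rho> = 0" using k by simp
  then have "w j = 0" for j using w_le[of j] w0[of j] by simp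
  then show ?thesis using v_lim[of i] by simp
qed

lemma kac_kernel_eigenvector:
  assumes t: "0 \<le> t"
  shows "(\<Sum>j\<in>UNIV. kac_kernel P (\<lambda>_. \<beta>) Y 0 t i j * (exp (lam * t) * \<phi> j)) = \<phi> i"
proof -
  have "(\<Sum>j\<in>UNIV. kac_kernel P (\<lambda>_. \<beta>) Y 0 t i j * (exp (lam * t) * \<phi> j)) = exp (lam * 0) * \<phi> i"
  proof (rule kac_kernel_harmonic[where c = "\<lambda>_. \<beta>" and \<theta> = "\<lambda>t j. exp (lam * t) * \<phi> j" and T = t and C = "\<Sum>j\<in>UNIV. \<bar>\<beta> j\<bar>"])
    show "\<bar>\<beta> j\<bar> \<le> (\<Sum>j\<in>UNIV. \<bar>\<beta> j\<bar>)" for j by (rule member_le_sum) auto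
    fix s i
    have sm: "(\<Sum>j\<in>UNIV. L $ i $ j * (exp (lam * s) * \<phi> j)) = exp (lam * s) * ((\<beta> i - lam) * \<phi> i)"
      unfolding eig[symmetric] by (simp add: sum_distrib_left mult_ac)
    have e: "- ((\<Sum>j\<in>UNIV. L $ i $ j * (exp (lam * s) * \<phi> j)) - \<beta> i * (exp (lam * s) * \<phi> i)) = exp (lam * s) * lam * \<phi> i"
      unfolding sm by (simp add: algebra_simps)
    show "((\<lambda>t. exp (lam * t) * \<phi> i) has_real_derivative
      - ((\<Sum>j\<in>UNIV. L $ i $ j * (exp (lam * s) * \<phi> j)) - \<beta> i * (exp (lam * s) * \<phi> i))) (at s within {0..t})"
      unfolding e by (auto intro!: derivative_eq_intros)
  qed (use t in auto)
  then show ?thesis by simp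
qed

lemma gain_tendsto_0: "(gain \<longlongrightarrow> 0) at_top"
proof -
  have "((\<lambda>t. \<Sum>i\<in>UNIV. 2 * \<alpha> i * v t i) \<longlongrightarrow> (\<Sum>i\<in>(UNIV::'k set). 2 * \<alpha> i * 0)) at_top"
    by (intro tendsto_intros v_tendsto_0)
  then show ?thesis by (simp add: gain_def[abs_def])
qed

section \<open>Contraction of the oscillation of the derivative relative to the eigenvector\<close>

text \<open>The factor \<open>exp (lam * t)\<close> compensates the decay of the linearised
  equation, for which \<open>exp (- lam * t) * \<phi> i\<close> is a solution.\<close>

definition rel_dv :: "real \<Rightarrow> 'k \<Rightarrow> real" where
  "rel_dv t i = - dv t i * exp (lam * t) / \<phi> i"

text \<open>The Doob transform of the kernel for \<open>\<beta>\<close> by the eigenvector; its rows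
  sum to 1 because \<open>exp (lam * t) * \<phi> j\<close> is harmonic.\<close>

definition stoch :: "real \<Rightarrow> 'k \<Rightarrow> 'k \<Rightarrow> real" where
  "stoch t i j = kac_kernel P (\<lambda>_. \<beta>) Y 0 t i j * (exp (lam * t) * \<phi> j) / \<phi> i"

lemma stoch_nonneg: "0 \<le> t \<Longrightarrow> 0 \<le> stoch t i j"
  unfolding stoch_def using \<phi>_pos[of i] \<phi>_pos[of j]
    kac_kernel_nonneg[where c = "\<lambda>_. \<beta>" and T = t, OF _ continuous_on_const \<beta>_bound]
  by (auto intro!: mult_nonneg_nonneg divide_nonneg_nonneg less_imp_le)

lemma stoch_sum: "0 \<le> t \<Longrightarrow> (\<Sum>j\<in>UNIV. stoch t i j) = 1"
  unfolding stoch_def sum_divide_distrib[symmetric] using kac_kernel_eigenvector[of t i] \<phi>_pos[of i] by simp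

text \<open>Going from \<open>s\<close> to \<open>s + t\<close>, the potential exceeds
  \<open>\<beta>\<close> by at most \<open>gain s\<close>, since \<open>v\<close> decreases. The
  transport is therefore squeezed between the stochastic matrix and
  \<open>exp (- gain s * t)\<close> times it.\<close>

lemma rel_dv_averaging:
  assumes s: "0 < s" and t: "0 \<le> t"
  shows "rel_dv (s + t) i \<le> (\<Sum>j\<in>UNIV. stoch t i j * rel_dv s j)"
    and "exp (- gain s * t) * (\<Sum>j\<in>UNIV. stoch t i j * rel_dv s j) \<le> rel_dv (s + t) i"
proof -
  let ?c = "pot (s + t)"
  let ?U = "kac_kernel P ?c Y 0 t" and ?V = "kac_kernel P (\<lambda>_. \<beta>) Y 0 t"
  have th: "t < s + t" using s by simp
  note pp = pot_props[OF t th]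
  have "(\<Sum>j\<in>UNIV. ?U i j * - dv (s + t - t) j) = - dv (s + t - 0) i"
    by (rule kac_kernel_harmonic[where c = ?c and \<theta> = "\<lambda>r j. - dv (s + t - r) j", OF t pp(1,2)])
      (use t th dv_backward_derivative in auto)
  then have U: "(\<Sum>j\<in>UNIV. ?U i j * - dv s j) = - dv (s + t) i" by simp
  have G: "rel_dv (s + t) i = (\<Sum>j\<in>UNIV. ?U i j * (exp (lam * t) * \<phi> j) / \<phi> i * rel_dv s j)"
  proof -
    have nz: "\<phi> j \<noteq> 0" for j using \<phi>_pos[of j] by simp
    have "rel_dv (s + t) i = (\<Sum>j\<in>UNIV. ?U i j * - dv s j) * exp (lam * (s + t)) / \<phi> i" by (simp only: rel_dv_def U)
    also have "\<dots> = (\<Sum>j\<in>UNIV. ?U i j * - dv s j * exp (lam * (s + t)) / \<phi> i)"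
      by (simp only: sum_distrib_right sum_divide_distrib)
    also have "\<dots> = (\<Sum>j\<in>UNIV. ?U i j * (exp (lam * t) * \<phi> j) / \<phi> i * rel_dv s j)"
      by (intro sum.cong refl) (simp add: rel_dv_def nz distrib_left exp_add mult_ac)
    finally show ?thesis .
  qed
  have rel_dv_nonneg: "0 \<le> rel_dv s j" for j
    unfolding rel_dv_def using dv_nonpos[OF s, of j] \<phi>_pos[of j] by (intro divide_nonneg_pos mult_nonneg_nonneg) auto
  have w: "0 \<le> exp (lam * t) * \<phi> j / \<phi> i" for j using \<phi>_pos[of i] \<phi>_pos[of j] by simp
  note cmp = kac_kernel_compare[where c = "\<lambda>_. \<beta>" and d = ?c and \<kappa> = "gain (s + t - t)", OF t continuous_on_const \<beta>_bound pp]
  show "rel_dv (s + t) i \<le> (\<Sum>j\<in>UNIV. stoch t i j * rel_dv s j)"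
    unfolding G stoch_def
    using cmp(1) \<phi>_pos by (intro sum_mono mult_right_mono divide_right_mono rel_dv_nonneg mult_nonneg_nonneg) (auto intro: less_imp_le)
  have "exp (- gain s * t) * (stoch t i j * rel_dv s j) \<le> ?U i j * (exp (lam * t) * \<phi> j) / \<phi> i * rel_dv s j" for j
  proof -
    have "exp (- gain s * t) * ?V i j * ((exp (lam * t) * \<phi> j / \<phi> i) * rel_dv s j) \<le> ?U i j * ((exp (lam * t) * \<phi> j / \<phi> i) * rel_dv s j)"
      using cmp(2)[of i j] w rel_dv_nonneg by (intro mult_right_mono mult_nonneg_nonneg) auto
    then show ?thesis by (simp add: stoch_def mult_ac)
  qed
  then show "exp (- gain s * t) * (\<Sum>j\<in>UNIV. stoch t i j * rel_dv s j) \<le> rel_dv (s + t) i"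
    unfolding G sum_distrib_left by (rule sum_mono)
qed

context
  assumes irr: "irreducible_generator L"
begin

lemma rel_dv_pos: "0 < t \<Longrightarrow> 0 < rel_dv t i"
  unfolding rel_dv_def using dv_neg[OF irr, of t i] \<phi>_pos[of i] by (simp add: divide_neg_pos mult_neg_pos)

lemma stoch_lower:
  obtains d where "0 < d" "\<And>i j. d \<le> stoch 1 i j"
proof -
  have pos: "0 < stoch 1 i j" for i j
  proof -
    have "0 < p (1 - 0) i j * exp (- (\<Sum>j\<in>UNIV. \<bar>\<beta> j\<bar>) * (1 - 0))" using p_pos[OF irr, of 1 i j] by simp
    also have "\<dots> \<le> kac_kernel P (\<lambda>_. \<beta>) Y 0 1 i j"
      by (rule kac_kernel_bounds(1)[where c = "\<lambda>_. \<beta>" and T = 1, OF _ continuous_on_const \<beta>_bound]) auto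
    finally show ?thesis unfolding stoch_def using \<phi>_pos[of i] \<phi>_pos[of j] by simp
  qed
  define d where "d = Min (range (\<lambda>(i, j). stoch 1 i j))"
  show thesis
  proof (rule that)
    show "0 < d" unfolding d_def using pos by (subst Min_gr_iff) auto
    show "d \<le> stoch 1 i j" for i j unfolding d_def by (rule Min_le) auto
  qed
qed

text \<open>The largest ratio of two components, a multiplicative oscillation that is at least 1 and
  equals 1 for constant vectors.\<close>

definition osc :: "real \<Rightarrow> real" where
  "osc s = Max (range (\<lambda>(i, j). rel_dv s i / rel_dv s j))"

lemma osc_ge: "0 < s \<Longrightarrow> rel_dv s i \<le> osc s * rel_dv s j"
proof -
  assume s: "0 < s"
  have "rel_dv s i / rel_dv s j \<le> osc s" unfolding osc_def by (rule Max_ge) auto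
  then show ?thesis using rel_dv_pos[OF s, of j] by (simp add: pos_divide_le_eq)
qed

lemma osc_ge_1: "0 < s \<Longrightarrow> 1 \<le> osc s"
  using osc_ge[of s undefined undefined] rel_dv_pos[of s undefined] by simp

lemma osc_le: "0 < s \<Longrightarrow> (\<And>i j. rel_dv s i \<le> c * rel_dv s j) \<Longrightarrow> osc s \<le> c"
  unfolding osc_def by (subst Max_le_iff) (auto simp: pos_divide_le_eq rel_dv_pos)

text \<open>Both bounds pass through a state \<open>k\<close> of least value: all values are at most
  \<open>osc s\<close> times the least one, and the average puts weight at least \<open>q\<close> on
  that state.\<close>

lemma rel_dv_comparison:
  assumes s: "0 < s" and t: "0 \<le> t" and q: "\<And>i j. q \<le> stoch t i j"
  shows "rel_dv (s + t) i \<le> (osc s - q * (osc s - 1)) * rel_dv s j"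
    and "exp (- gain s * t) * rel_dv s j \<le> osc s * rel_dv (s + t) i"
proof -
  obtain k where k: "\<And>l. rel_dv s k \<le> rel_dv s l" using finite_attains_min[of "rel_dv s"] by blast
  have gk: "0 < rel_dv s k" by (rule rel_dv_pos[OF s])
  have R: "1 \<le> osc s" by (rule osc_ge_1[OF s])
  have "rel_dv (s + t) i \<le> (\<Sum>l\<in>UNIV. stoch t i l * rel_dv s l)" by (rule rel_dv_averaging(1)[OF s t])
  \<comment> \<open>Every value is replaced by the largest admissible one, except at
    \<open>k\<close>, where the exact value saves \<open>(osc s - 1) * rel_dv s k\<close>.\<close>
  also have "\<dots> \<le> (\<Sum>l\<in>UNIV. stoch t i l * (osc s * rel_dv s k - of_bool (l = k) * ((osc s - 1) * rel_dv s k)))"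
    using osc_ge[OF s, of _ k] by (intro sum_mono mult_left_mono stoch_nonneg[OF t]) (auto simp: algebra_simps)
  also have "\<dots> = (\<Sum>l\<in>UNIV. stoch t i l) * (osc s * rel_dv s k) - stoch t i k * ((osc s - 1) * rel_dv s k)"
  proof -
    have "(\<Sum>l\<in>UNIV. stoch t i l * (of_bool (l = k) * c)) = stoch t i k * c" for c :: real
    proof -
      have "(\<Sum>l\<in>UNIV. stoch t i l * (of_bool (l = k) * c)) = (\<Sum>l\<in>UNIV. if l = k then stoch t i k * c else 0)"
        by (rule sum.cong) auto
      then show ?thesis by simp
    qed
    then show ?thesis by (simp only: right_diff_distrib sum_subtractf sum_distrib_right)
  qed
  also have "\<dots> = osc s * rel_dv s k - stoch t i k * ((osc s - 1) * rel_dv s k)" using stoch_sum[OF t, of i] by simp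
  also have "\<dots> \<le> osc s * rel_dv s k - q * ((osc s - 1) * rel_dv s k)"
    using q[of i k] R gk by (intro diff_left_mono mult_right_mono) auto
  also have "\<dots> = (osc s - q * (osc s - 1)) * rel_dv s k" by (simp add: algebra_simps)
  also have "\<dots> \<le> (osc s - q * (osc s - 1)) * rel_dv s j"
  proof (rule mult_left_mono[OF k])
    have "stoch t i k \<le> (\<Sum>l\<in>UNIV. stoch t i l)" by (rule member_le_sum) (auto intro: stoch_nonneg[OF t])
    then have "q \<le> 1" using q[of i k] stoch_sum[OF t, of i] by linarith
    then have "q * (osc s - 1) \<le> 1 * (osc s - 1)" using R by (intro mult_right_mono) auto
    moreover have "X \<le> 1 * (osc s - 1) \<Longrightarrow> 0 \<le> osc s - X" for X by simp
    ultimately show "0 \<le> osc s - q * (osc s - 1)" by blast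
  qed
  finally show "rel_dv (s + t) i \<le> (osc s - q * (osc s - 1)) * rel_dv s j" .
  have "exp (- gain s * t) * rel_dv s j \<le> exp (- gain s * t) * (osc s * rel_dv s k)"
    using osc_ge[OF s, of j k] by (intro mult_left_mono) auto
  also have "\<dots> = osc s * (exp (- gain s * t) * rel_dv s k)" by simp
  also have "\<dots> = osc s * (exp (- gain s * t) * (\<Sum>l\<in>UNIV. stoch t i l * rel_dv s k))"
    using stoch_sum[OF t, of i] by (simp flip: sum_distrib_right)
  also have "\<dots> \<le> osc s * (exp (- gain s * t) * (\<Sum>l\<in>UNIV. stoch t i l * rel_dv s l))"
    using R k by (intro mult_left_mono sum_mono stoch_nonneg[OF t]) auto
  also have "\<dots> \<le> osc s * rel_dv (s + t) i"
    using R by (intro mult_left_mono rel_dv_averaging(2)[OF s t]) auto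
  finally show "exp (- gain s * t) * rel_dv s j \<le> osc s * rel_dv (s + t) i" .
qed

text \<open>Doeblin's argument: a minorisation by \<open>q\<close> reduces \<open>osc - 1\<close> by
  the factor \<open>1 - q\<close>, up to the loss \<open>exp (gain s * t)\<close> from the
  comparison of potentials.\<close>

lemma osc_step:
  assumes s: "0 < s" and t: "0 \<le> t" and q: "\<And>i j. q \<le> stoch t i j"
  shows "osc (s + t) \<le> exp (gain s * t) * (osc s - q * (osc s - 1))"
proof (rule osc_le)
  obtain k where k: "\<And>l. rel_dv s k \<le> rel_dv s l" using finite_attains_min[of "rel_dv s"] by blast
  have "1 * 0 \<le> exp (gain s * t) * (osc s - q * (osc s - 1))"
  proof -
    have "0 < rel_dv (s + t) k" using s t by (intro rel_dv_pos) auto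
    also have "\<dots> \<le> (osc s - q * (osc s - 1)) * rel_dv s k" by (rule rel_dv_comparison(1)[OF s t q])
    finally have "0 < osc s - q * (osc s - 1)" using rel_dv_pos[OF s, of k] by (simp add: zero_less_mult_iff)
    then show ?thesis by simp
  qed
  then have nn: "0 \<le> osc s - q * (osc s - 1)" by (simp add: zero_le_mult_iff)
  fix i j
  have "exp (- gain s * t) * rel_dv s k = exp (- gain s * t) * (\<Sum>l\<in>UNIV. stoch t j l * rel_dv s k)"
    using stoch_sum[OF t, of j] by (simp flip: sum_distrib_right)
  also have "\<dots> \<le> exp (- gain s * t) * (\<Sum>l\<in>UNIV. stoch t j l * rel_dv s l)"
    using k by (intro mult_left_mono sum_mono stoch_nonneg[OF t]) auto
  also have "\<dots> \<le> rel_dv (s + t) j" by (rule rel_dv_averaging(2)[OF s t])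
  finally have lo: "exp (- gain s * t) * rel_dv s k \<le> rel_dv (s + t) j" .
  have "rel_dv (s + t) i \<le> (osc s - q * (osc s - 1)) * rel_dv s k" by (rule rel_dv_comparison(1)[OF s t q])
  also have "\<dots> = exp (gain s * t) * (osc s - q * (osc s - 1)) * (exp (- gain s * t) * rel_dv s k)"
    by (simp add: exp_minus field_simps)
  also have "\<dots> \<le> exp (gain s * t) * (osc s - q * (osc s - 1)) * rel_dv (s + t) j"
    using nn by (intro mult_left_mono lo) auto
  finally show "rel_dv (s + t) i \<le> exp (gain s * t) * (osc s - q * (osc s - 1)) * rel_dv (s + t) j" .
qed (use s t in auto)

text \<open>Unit steps contract by \<open>1 - d\<close> in the limit, because the loss factors tend
  to 1; an integer time then controls the times up to the next one.\<close>

lemma osc_tendsto_1: "(osc \<longlongrightarrow> 1) at_top"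
proof -
  obtain d where d: "0 < d" "\<And>i j. d \<le> stoch 1 i j" using stoch_lower by blast
  have gl: "(\<lambda>n. exp (gain (real (Suc n)))) \<longlonglongrightarrow> exp 0"
    by (intro tendsto_exp filterlim_compose[OF gain_tendsto_0] filterlim_compose[OF filterlim_real_sequentially filterlim_Suc])
  have "(\<lambda>n. osc (real (Suc n)) - 1) \<longlonglongrightarrow> 0"
  proof (rule contraction_tendsto_0[where a = "\<lambda>n. exp (gain (real (Suc n))) * (1 - d)" and b = "\<lambda>n. exp (gain (real (Suc n))) - 1" and \<rho> = "exp 0 * (1 - d)"])
    show "0 \<le> osc (real (Suc n)) - 1" for n using osc_ge_1[of "real (Suc n)"] by simp
    show "osc (real (Suc (Suc n))) - 1 \<le> exp (gain (real (Suc n))) * (1 - d) * (osc (real (Suc n)) - 1) + (exp (gain (real (Suc n))) - 1)" for n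
    proof -
      have "osc (real (Suc n) + 1) \<le> exp (gain (real (Suc n)) * 1) * (osc (real (Suc n)) - d * (osc (real (Suc n)) - 1))"
        by (rule osc_step[OF _ _ d(2)]) auto
      then show ?thesis by (simp add: algebra_simps)
    qed
    show "(\<lambda>n. exp (gain (real (Suc n))) * (1 - d)) \<longlonglongrightarrow> exp 0 * (1 - d)" by (intro tendsto_intros gl)
    show "(\<lambda>n. exp (gain (real (Suc n))) - 1) \<longlonglongrightarrow> 0" using tendsto_diff[OF gl tendsto_const[of 1]] by simp
  qed (use d in auto)
  then have osc_n: "(\<lambda>n. osc (real (Suc n))) \<longlonglongrightarrow> 1" by (simp add: LIM_zero_iff)
  show ?thesis
  proof (rule tendsto_sandwich)
    show "\<forall>\<^sub>F t in at_top. 1 \<le> osc t"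
      using eventually_gt_at_top[of 0] by eventually_elim (rule osc_ge_1)
    show "\<forall>\<^sub>F t in at_top. osc t \<le> exp (gain (real (Suc (nat \<lfloor>t\<rfloor> - 1)))) * osc (real (Suc (nat \<lfloor>t\<rfloor> - 1)))"
      using eventually_ge_at_top[of 2]
    proof eventually_elim
      case (elim t)
      define n where "n = real (Suc (nat \<lfloor>t\<rfloor> - 1))"
      have n: "n \<le> t" "t \<le> n + 1" "0 < n" using elim unfolding n_def by linarith+
      \<comment> \<open>With \<open>q = 0\<close> no contraction is claimed on the incomplete step,
        only growth by at most \<open>exp (gain n)\<close>.\<close>
      have "osc (n + (t - n)) \<le> exp (gain n * (t - n)) * (osc n - 0 * (osc n - 1))"
        using n by (intro osc_step stoch_nonneg) auto
      also have "\<dots> = exp (gain n * (t - n)) * osc n" by simp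
      also have "\<dots> \<le> exp (gain n) * osc n"
      proof (rule mult_right_mono)
        have "gain n * (t - n) \<le> gain n" using n gain_nonneg[OF n(3)] by (intro mult_left_le) auto
        then show "exp (gain n * (t - n)) \<le> exp (gain n)" by simp
        show "0 \<le> osc n" using osc_ge_1[OF n(3)] by simp
      qed
      finally show ?case by (simp add: n_def)
    qed
    show "((\<lambda>_::real. 1::real) \<longlongrightarrow> 1) at_top" by simp
    show "((\<lambda>t::real. exp (gain (real (Suc (nat \<lfloor>t\<rfloor> - 1)))) * osc (real (Suc (nat \<lfloor>t\<rfloor> - 1)))) \<longlongrightarrow> 1) at_top"
      using filterlim_compose[OF tendsto_mult[OF gl osc_n] filterlim_pred_floor] by simp
  qed
qed

text \<open>The two values belong to different times at fixed distance \<open>t\<close>. The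
  comparison with \<open>q = 0\<close> bounds their ratio by \<open>osc (h - t)\<close> and a loss
  factor, all of which tend to 1.\<close>

lemma rel_dv_ratio_tendsto_1:
  assumes t: "0 \<le> t"
  shows "((\<lambda>h. rel_dv (h - t) y / rel_dv h x) \<longlongrightarrow> 1) at_top"
proof -
  have shift: "filterlim (\<lambda>h. h - t) at_top at_top"
    using filterlim_tendsto_add_at_top[OF tendsto_const[of "- t"] filterlim_ident] by simp
  have o: "((\<lambda>h. osc (h - t)) \<longlongrightarrow> 1) at_top" by (rule filterlim_compose[OF osc_tendsto_1 shift])
  have gn: "((\<lambda>h. gain (h - t)) \<longlongrightarrow> 0) at_top" by (rule filterlim_compose[OF gain_tendsto_0 shift])
  show ?thesis
  proof (rule tendsto_sandwich)
    have ev: "\<forall>\<^sub>F h in at_top. t < h" by (rule eventually_gt_at_top)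
    show "\<forall>\<^sub>F h in at_top. inverse (osc (h - t)) \<le> rel_dv (h - t) y / rel_dv h x"
      using ev
    proof eventually_elim
      case (elim h)
      have s: "0 < h - t" using elim by simp
      have "rel_dv h x \<le> osc (h - t) * rel_dv (h - t) y"
        using rel_dv_comparison(1)[OF s t stoch_nonneg[OF t], of x y] by simp
      then show ?case using rel_dv_pos[of h x] osc_ge_1[OF s] elim t by (simp add: field_simps)
    qed
    show "\<forall>\<^sub>F h in at_top. rel_dv (h - t) y / rel_dv h x \<le> exp (gain (h - t) * t) * osc (h - t)"
      using ev
    proof eventually_elim
      case (elim h)
      have s: "0 < h - t" using elim by simp
      have "exp (- gain (h - t) * t) * rel_dv (h - t) y \<le> osc (h - t) * rel_dv h x"
        using rel_dv_comparison(2)[OF s t stoch_nonneg[OF t], of y x] by simp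
      then have "exp (gain (h - t) * t) * (exp (- gain (h - t) * t) * rel_dv (h - t) y) \<le> exp (gain (h - t) * t) * (osc (h - t) * rel_dv h x)"
        by (rule mult_left_mono) simp
      then have "rel_dv (h - t) y \<le> exp (gain (h - t) * t) * osc (h - t) * rel_dv h x"
        by (simp add: mult.assoc[symmetric] flip: exp_add)
      then show ?case using rel_dv_pos[of h x] elim t by (simp add: pos_divide_le_eq)
    qed
    show "((\<lambda>h. inverse (osc (h - t))) \<longlongrightarrow> 1) at_top" using tendsto_inverse[OF o] by simp
    show "((\<lambda>h. exp (gain (h - t) * t) * osc (h - t)) \<longlongrightarrow> 1) at_top"
      using tendsto_mult[OF tendsto_exp[OF tendsto_mult[OF gn tendsto_const[of t]]] o] by simp
  qed
qed

lemma dv_ratio_tendsto: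
  assumes t: "0 \<le> t"
  shows "((\<lambda>h. dv (h - t) y / dv h x) \<longlongrightarrow> exp (lam * t) * \<phi> y / \<phi> x) at_top"
proof -
  have "dv (h - t) y / dv h x = rel_dv (h - t) y / rel_dv h x * (exp (lam * t) * \<phi> y / \<phi> x)" for h
  proof -
    have *: "dv s i = - (rel_dv s i * \<phi> i / exp (lam * s))" for s i using \<phi>_pos[of i] by (simp add: rel_dv_def)
    have "exp (lam * h) = exp (lam * t) * exp (lam * (h - t))" by (simp add: algebra_simps flip: exp_add)
    then show ?thesis unfolding * by simp
  qed
  then show ?thesis using tendsto_mult[OF rel_dv_ratio_tendsto_1[OF t, of y x] tendsto_const[of "exp (lam * t) * \<phi> y / \<phi> x"]] by simp
qed

end

end

end

section \<open>The two densities as Doob transforms\<close>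

lemma has_transition_rates_cong:
  assumes "\<And>t i j. t \<in> I \<Longrightarrow> r t i j = r' t i j"
  shows "has_transition_rates I p r = has_transition_rates I p r'"
  unfolding has_transition_rates_def using assms by simp

lemma deriv_psi: "deriv (psi \<beta> \<alpha> y) l = \<beta> y + 2 * \<alpha> y * l"
  by (rule DERIV_imp_deriv) (auto simp: psi_def[abs_def] intro!: derivative_eq_intros)

context feller_superprocess
begin

lemma dv_ext_eq:
  assumes N: "canonical_measures PX N" and t: "0 < t"
  shows "dv_ext N t x = dv t x"
  unfolding dv_ext_def
proof (rule DERIV_imp_deriv)
  show "((\<lambda>r. v_ext N r x) has_real_derivative dv t x) (at t)"
    by (rule has_field_derivative_transform_within_open[OF v_has_derivative[OF t] open_greaterThan[of 0]])
      (use t v_ext_eq[OF N] in auto)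
qed

context
  fixes N :: "'k \<Rightarrow> (real \<Rightarrow> real^'k) measure" and x :: 'k
  assumes N: "canonical_measures PX N" and irr: "irreducible_generator L"
begin

text \<open>The integral involves only remaining times \<open>h - s\<close> with
  \<open>s \<le> t < h\<close>; they are positive, which is where \<open>v_ext\<close> and
  \<open>v\<close> agree.\<close>

lemma M_h_eq:
  assumes th: "0 \<le> t" "t < h"
  shows "M_h Y \<beta> \<alpha> N x h t \<omega> = dv (h - t) (Y t \<omega>) / dv h x * kac (pot h) Y 0 t \<omega>"
proof -
  have "(LINT s:{0..t}|lborel. deriv (psi \<beta> \<alpha> (Y s \<omega>)) (v_ext N (h - s) (Y s \<omega>))) =
      (LINT s:{0..t}|lborel. pot h s (Y s \<omega>))"
    unfolding set_lebesgue_integral_def using th v_ext_eq[OF N]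
    by (intro Bochner_Integration.integral_cong) (auto simp: indicator_def deriv_psi pot_def)
  then show ?thesis using th by (simp add: M_h_def kac_def dv_ext_eq[OF N])
qed

lemma finite_horizon:
  assumes h: "0 < h" and Q: "has_density_process {0..<h} (P x) Y (M_h Y \<beta> \<alpha> N x h) Q"
  shows "inhomogeneous_markov_chain {0..<h} Q Y x (\<lambda>t i j. dv_ext N (h - t) j / dv_ext N (h - t) i * L $ i $ j)"
proof -
  let ?\<theta> = "\<lambda>t i. - dv (h - t) i"
  note doob = doob_transform[where I = "{0..<h}" and c = "pot h" and \<theta> = ?\<theta> and D = "M_h Y \<beta> \<alpha> N x h" and Q = Q and x = x]
  have I: "\<exists>u\<in>{0..<h}. t < u" if "t \<in> {0..<h}" for t
    using that by (intro bexI[of _ "(t + h) / 2"]) auto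
  \<comment> \<open>Continuity is proved locally: a time \<open>T\<close> between \<open>r\<close>
    and \<open>h\<close> keeps away from the horizon, where \<open>v\<close> is singular.\<close>
  have cc: "continuous_on {0..<h} (\<lambda>r. pot h r j)" for j
    unfolding continuous_on_eq_continuous_within
  proof
    fix r assume r: "r \<in> {0..<h}"
    define T where "T = (r + h) / 2"
    have T: "0 \<le> T" "T < h" "r < T" using r by (auto simp: T_def)
    have "continuous (at r within {0..T}) (\<lambda>r. pot h r j)"
      using pot_props(1)[OF T(1,2), of j] r T by (simp add: continuous_on_eq_continuous_within)
    moreover have "at r within {0..T} = at r within {0..<h}"
      by (rule at_within_nhd[where S = "{..<T}"]) (use T in auto)
    ultimately show "continuous (at r within {0..<h}) (\<lambda>r. pot h r j)" by simp
  qed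
  have pos: "0 < ?\<theta> t i" if "t \<in> {0..<h}" for t i using dv_neg[OF irr, of "h - t" i] that by simp
  have der: "((\<lambda>t. ?\<theta> t i) has_real_derivative
      - ((\<Sum>j\<in>UNIV. L $ i $ j * ?\<theta> t j) - pot h t i * ?\<theta> t i)) (at t within {0..T})"
    if "T \<in> {0..<h}" "t \<in> {0..T}" for T t i
    using dv_backward_derivative[of t T h i] that by simp
  have Deq: "M_h Y \<beta> \<alpha> N x h t \<omega> = ?\<theta> t (Y t \<omega>) / ?\<theta> 0 x * kac (pot h) Y 0 t \<omega>"
    if "t \<in> {0..<h}" "\<omega> \<in> space (P x)" for t \<omega>
    using M_h_eq[of t h \<omega>] that by simp
  have "markov_chain_with {0..<h} Q Y x (\<lambda>s t i j. kac_kernel P (pot h) Y s t i j * ?\<theta> t j / ?\<theta> s i)"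
    by (rule doob(1)[OF _ _ _ I cc pos der Q Deq]) (use h in auto)
  moreover have "has_transition_rates {0..<h} (\<lambda>s t i j. kac_kernel P (pot h) Y s t i j * ?\<theta> t j / ?\<theta> s i)
      (\<lambda>t i j. ?\<theta> t j / ?\<theta> t i * L $ i $ j)"
    by (rule doob(2)[OF _ _ _ I cc pos der Q Deq]) (use h in auto)
  then have "has_transition_rates {0..<h} (\<lambda>s t i j. kac_kernel P (pot h) Y s t i j * ?\<theta> t j / ?\<theta> s i)
      (\<lambda>t i j. dv_ext N (h - t) j / dv_ext N (h - t) i * L $ i $ j)"
    by (rule has_transition_rates_cong[THEN iffD1, rotated]) (simp add: dv_ext_eq[OF N])
  ultimately show ?thesis unfolding inhomogeneous_markov_chain_def by blast
qed

context
  fixes \<phi> :: "'k \<Rightarrow> real" and lam :: real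
  assumes \<phi>_pos: "\<And>i. 0 < \<phi> i" and lam: "0 \<le> lam"
    and eig: "\<And>i. (\<Sum>j\<in>UNIV. L $ i $ j * \<phi> j) = (\<beta> i - lam) * \<phi> i"
begin

text \<open>The convergence is shown for each path, so \<open>Lim\<close> denotes a genuine limit.
  The quotient of derivatives gives the eigenvector factor, and the weight converges because the
  extra potential on \<open>[0, t]\<close> is at most \<open>gain (h - t)\<close>.\<close>

lemma M_inf_eq:
  assumes t: "0 \<le> t" and \<omega>: "\<omega> \<in> space (P x)"
  shows "M_inf Y \<beta> \<alpha> N x t \<omega> = exp (lam * t) * \<phi> (Y t \<omega>) / (exp (lam * 0) * \<phi> x) * kac (\<lambda>_. \<beta>) Y 0 t \<omega>"
proof -
  let ?K = "kac (\<lambda>_. \<beta>) Y 0 t \<omega>"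
  have shift: "filterlim (\<lambda>h. h - t) at_top at_top"
    using filterlim_tendsto_add_at_top[OF tendsto_const[of "- t"] filterlim_ident] by simp
  have gn: "((\<lambda>h. gain (h - t)) \<longlongrightarrow> 0) at_top"
    by (rule filterlim_compose[OF gain_tendsto_0[OF \<phi>_pos lam eig] shift])
  have kac_lim: "((\<lambda>h. kac (pot h) Y 0 t \<omega>) \<longlongrightarrow> ?K) at_top"
  proof (rule tendsto_sandwich)
    have cmp: "kac (pot h) Y 0 t \<omega> \<le> ?K" "exp (- gain (h - t) * (t - 0)) * ?K \<le> kac (pot h) Y 0 t \<omega>" if h: "t < h" for h
    proof -
      note pp = pot_props[OF t h]
      show "kac (pot h) Y 0 t \<omega> \<le> ?K"
        by (rule chain.kac_compare(1)[where c = "\<lambda>_. \<beta>" and d = "pot h" and T = t and \<kappa> = "gain (h - t)", OF t continuous_on_const \<beta>_bound pp \<omega>]) (use t in auto)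
      show "exp (- gain (h - t) * (t - 0)) * ?K \<le> kac (pot h) Y 0 t \<omega>"
        by (rule chain.kac_compare(2)[where c = "\<lambda>_. \<beta>" and d = "pot h" and T = t and \<kappa> = "gain (h - t)", OF t continuous_on_const \<beta>_bound pp \<omega>]) (use t in auto)
    qed
    show "\<forall>\<^sub>F h in at_top. exp (- gain (h - t) * (t - 0)) * ?K \<le> kac (pot h) Y 0 t \<omega>"
      using eventually_gt_at_top[of t] by eventually_elim (rule cmp(2))
    show "\<forall>\<^sub>F h in at_top. kac (pot h) Y 0 t \<omega> \<le> ?K"
      using eventually_gt_at_top[of t] by eventually_elim (rule cmp(1))
    have "((\<lambda>h. exp (- gain (h - t) * (t - 0)) * ?K) \<longlongrightarrow> exp (- 0 * (t - 0)) * ?K) at_top"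
      by (intro tendsto_intros gn)
    then show "((\<lambda>h. exp (- gain (h - t) * (t - 0)) * ?K) \<longlongrightarrow> ?K) at_top" by simp
  qed simp
  have "((\<lambda>h. dv (h - t) (Y t \<omega>) / dv h x * kac (pot h) Y 0 t \<omega>) \<longlongrightarrow> exp (lam * t) * \<phi> (Y t \<omega>) / \<phi> x * ?K) at_top"
    by (intro tendsto_mult kac_lim dv_ratio_tendsto[OF \<phi>_pos lam eig irr t])
  moreover have "\<forall>\<^sub>F h in at_top. dv (h - t) (Y t \<omega>) / dv h x * kac (pot h) Y 0 t \<omega> = M_h Y \<beta> \<alpha> N x h t \<omega>"
    using eventually_gt_at_top[of t] by eventually_elim (use M_h_eq[OF t] in simp)
  ultimately have "((\<lambda>h. M_h Y \<beta> \<alpha> N x h t \<omega>) \<longlongrightarrow> exp (lam * t) * \<phi> (Y t \<omega>) / \<phi> x * ?K) at_top"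
    by (rule Lim_transform_eventually)
  then show ?thesis unfolding M_inf_def by (simp add: tendsto_Lim)
qed

lemma infinite_horizon:
  assumes Q: "has_density_process {0..} (P x) Y (M_inf Y \<beta> \<alpha> N x) Q"
  shows "homogeneous_markov_chain Q Y x (\<lambda>i j. \<phi> j / \<phi> i * L $ i $ j)"
proof -
  let ?\<theta> = "\<lambda>t i. exp (lam * t) * \<phi> i"
  let ?q = "\<lambda>s t i j. kac_kernel P (\<lambda>_. \<beta>) Y s t i j * ?\<theta> t j / ?\<theta> s i"
  note doob = doob_transform[where I = "{0..}" and c = "\<lambda>_. \<beta>" and \<theta> = ?\<theta> and D = "M_inf Y \<beta> \<alpha> N x" and Q = Q and x = x]
  have I: "\<exists>u\<in>{0..}. t < u" if "t \<in> {0..}" for t :: real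
    using that by (intro bexI[of _ "t + 1"]) auto
  have pos: "0 < ?\<theta> t i" for t i using \<phi>_pos by simp
  have der: "((\<lambda>t. ?\<theta> t i) has_real_derivative
      - ((\<Sum>j\<in>UNIV. L $ i $ j * ?\<theta> t j) - \<beta> i * ?\<theta> t i)) (at t within {0..T})" for T t i
  proof -
    have "(\<Sum>j\<in>UNIV. L $ i $ j * ?\<theta> t j) = exp (lam * t) * (\<Sum>j\<in>UNIV. L $ i $ j * \<phi> j)"
      by (simp add: sum_distrib_left mult_ac)
    also have "\<dots> = exp (lam * t) * ((\<beta> i - lam) * \<phi> i)" by (simp only: eig)
    finally have e: "- ((\<Sum>j\<in>UNIV. L $ i $ j * ?\<theta> t j) - \<beta> i * ?\<theta> t i) = exp (lam * t) * lam * \<phi> i"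
      by (simp add: algebra_simps)
    show ?thesis unfolding e by (auto intro!: derivative_eq_intros)
  qed
  have "markov_chain_with {0..} Q Y x ?q"
    by (rule doob(1)[OF _ _ _ I continuous_on_const pos der Q M_inf_eq]) auto
  moreover have "has_transition_rates {0..} ?q (\<lambda>t i j. ?\<theta> t j / ?\<theta> t i * L $ i $ j)"
    by (rule doob(2)[OF _ _ _ I continuous_on_const pos der Q M_inf_eq]) auto
  \<comment> \<open>Time-homogeneity: the potential \<open>\<beta>\<close> is constant in time, and
    the exponential factors at \<open>t\<close> and \<open>s\<close> combine to
    \<open>exp (lam * (t - s))\<close>.\<close>
  moreover define q where "q d i j = kac_kernel P (\<lambda>_. \<beta>) Y 0 d i j * (exp (lam * d) * \<phi> j / \<phi> i)" for d i j
  have "?q = (\<lambda>s t. q (t - s))"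
    by (simp add: fun_eq_iff q_def kac_kernel_def right_diff_distrib exp_diff)
  ultimately show ?thesis
    unfolding homogeneous_markov_chain_def by (intro exI[of _ q]) simp
qed

end

end

end

theorem lemma7p4:
  fixes L :: "real^'k^'k::finite"
    and P :: "'k \<Rightarrow> 'a measure"
    and Y :: "real \<Rightarrow> 'a \<Rightarrow> 'k"
    and \<alpha> \<beta> :: "'k \<Rightarrow> real"
    and PX :: "real^'k \<Rightarrow> (real \<Rightarrow> real^'k) measure"
    and N :: "'k \<Rightarrow> (real \<Rightarrow> real^'k) measure"
    and \<phi>\<^sub>0 :: "real^'k"
    and x :: 'k
  assumes "generator_matrix L"
    and "irreducible_generator L"
    and "markov_jump_process L P Y"
    and "\<forall>i. 0 < \<alpha> i"
    and "superprocess P Y \<beta> \<alpha> PX"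
    and "canonical_measures PX N"
    and "\<forall>i. 0 < \<phi>\<^sub>0 $ i"
    and "diag_minus \<beta> L *v \<phi>\<^sub>0 = lambda0 \<beta> L *\<^sub>R \<phi>\<^sub>0"
    and "0 \<le> lambda0 \<beta> L"
  shows "(\<forall>h>0. \<forall>P_h :: 'a measure.
           has_density_process {0..<h} (P x) Y (M_h Y \<beta> \<alpha> N x h) P_h \<longrightarrow>
           inhomogeneous_markov_chain {0..<h} P_h Y x
             (\<lambda>t i j. dv_ext N (h - t) j / dv_ext N (h - t) i * L $ i $ j)) \<and>
         (\<forall>P_inf :: 'a measure.
           has_density_process {0..} (P x) Y (M_inf Y \<beta> \<alpha> N x) P_inf \<longrightarrow>
           homogeneous_markov_chain P_inf Y x (\<lambda>i j. \<phi>\<^sub>0 $ j / \<phi>\<^sub>0 $ i * L $ i $ j))"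
proof -
  obtain p where p: "jump_chains p L P Y"
    using markov_jump_process_imp_jump_chains[OF assms(1,3)] by blast
  interpret feller_superprocess p L P Y \<alpha> \<beta> PX
    by (rule feller_superprocess.intro[OF p feller_superprocess_axioms.intro]) (use assms in auto)
  have eig: "(\<Sum>j\<in>UNIV. L $ i $ j * \<phi>\<^sub>0 $ j) = (\<beta> i - lambda0 \<beta> L) * \<phi>\<^sub>0 $ i" for i
  proof -
    have "(\<Sum>j\<in>UNIV. (if i = j then \<beta> i else 0) * \<phi>\<^sub>0 $ j) = (\<Sum>j\<in>UNIV. if j = i then \<beta> i * \<phi>\<^sub>0 $ i else 0)"
      by (rule sum.cong) auto
    then have "(diag_minus \<beta> L *v \<phi>\<^sub>0) $ i = \<beta> i * \<phi>\<^sub>0 $ i - (\<Sum>j\<in>UNIV. L $ i $ j * \<phi>\<^sub>0 $ j)"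
      by (simp add: diag_minus_def matrix_vector_mult_def left_diff_distrib sum_subtractf)
    then show ?thesis using assms(8) by (simp add: algebra_simps)
  qed
  have pos: "0 < \<phi>\<^sub>0 $ i" for i using assms(7) by blast
  show ?thesis
    using finite_horizon[OF assms(6,2)] infinite_horizon[OF assms(6,2) pos assms(9) eig] by blast
qed

end
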